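(* Let $n\ge2$. There exist constants $\hat C(n)>0$, $\eta(n)>0$ and $\bar C(n)>0$, depending only on $n$, such that for every $s\in(0,1/2)$ and every nonempty bounded open set $\Omega\subset\mathbb{R}^n$ with $C^{2,\alpha}$-boundary for some $\alpha>2s$ the following hold. (i) $\rho(\Omega)\le \hat C(n)\,\eta_s(\Omega)$, where $$\eta_s(\Omega)=\frac{\mathrm{diam}(\Omega)^{2n+2s+1}}{|\Omega|^2}\,\delta_s(\Omega).$$ (ii) If $\eta_s(\Omega)\le\eta(n)$ then, up to rescaling $\Omega$ (i.e. after replacing $\Omega$ by $\kappa\Omega$ for a suitable $\kappa>0$; note that $\eta_s$ is scaling invariant), there is a bi-Lipschitz map $F:\partial B_1(\mathbf{0})\to\partial\Omega$ satisfying $$\bigl(1-\bar C(n)\sqrt{\eta_s(\Omega)}\bigr)|x-y|\le|F(x)-F(y)|\le\bigl(1+\bar C(n)\sqrt{\eta_s(\Omega)}\bigr)|x-y|\qquad\forall\,x,y\in\partial B_1(\mathbf{0}).$$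
   Context: For $p\in\partial\Omega$ the nonlocal mean curvature is $$H_s^\Omega(p)=\frac{1}{\omega_{n-2}}\int_{\mathbb{R}^n}\frac{\chi_{\Omega^c}(x)-\chi_\Omega(x)}{|x-p|^{n+2s}}\,dx,$$ in the principal value sense, where $\Omega^c=\mathbb{R}^n\setminus\Omega$, $\chi_E$ is the characteristic function of $E$ and $\omega_{n-2}$ is the measure of the $(n-2)$-dimensional unit sphere. Define $$\delta_s(\Omega)=\sup_{p,q\in\partial\Omega,\,p\neq q}\frac{|H_s^\Omega(p)-H_s^\Omega(q)|}{|p-q|},$$ $$\rho(\Omega)=\inf\Bigl\{\frac{R-r}{\mathrm{diam}(\Omega)}:\ p\in\Omega,\ B_r(p)\subset\Omega\subset B_R(p)\Bigr\}.$$ $B_r(p)$ is the open ball of radius $r$ centered at $p$, $\mathbf{0}$ is the origin, and $|\Omega|$ is the Lebesgue measure of $\Omega$. *)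

theory Defs
  imports "HOL-Analysis.Analysis"
begin

text \<open>The measure of the \<open>d\<close>-dimensional unit sphere in dimension \<open>d + 1\<close> is \<open>d + 1\<close> times the
  volume of the unit ball that it bounds; for \<open>d = 0\<close> this is 2, the number of points.\<close>

definition sphere_area :: "nat \<Rightarrow> real" where
  "sphere_area d = real (d + 1) * unit_ball_vol (real (d + 1))"

text \<open>The principal value is the limit of the integrals over the complements of balls around \<open>p\<close>.\<close>

definition nonlocal_mean_curvature :: "real \<Rightarrow> (real^'n) set \<Rightarrow> real^'n \<Rightarrow> real" where
  "nonlocal_mean_curvature s \<Omega> p =
     1 / sphere_area (CARD('n) - 2) *
     Lim (at_right 0) (\<lambda>\<epsilon>. LINT x:- ball p \<epsilon>|lebesgue.
       (indicator (- \<Omega>) x - indicator \<Omega> x) / norm (x - p) powr (real CARD('n) + 2 * s))"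

text \<open>The supremum is taken in \<open>[0, \<infinity>]\<close>, so that no finiteness is presupposed.\<close>

definition curvature_deficit :: "real \<Rightarrow> (real^'n) set \<Rightarrow> ennreal" where
  "curvature_deficit s \<Omega> =
     (SUP (p, q) \<in> {(p, q). p \<in> frontier \<Omega> \<and> q \<in> frontier \<Omega> \<and> p \<noteq> q}.
        ennreal (\<bar>nonlocal_mean_curvature s \<Omega> p - nonlocal_mean_curvature s \<Omega> q\<bar> / norm (p - q)))"

definition scaled_deficit :: "real \<Rightarrow> (real^'n) set \<Rightarrow> ennreal" where
  "scaled_deficit s \<Omega> =
     ennreal (diameter \<Omega> powr (2 * real CARD('n) + 2 * s + 1) / (measure lebesgue \<Omega>)\<^sup>2) *
     curvature_deficit s \<Omega>"

definition ball_distance :: "(real^'n) set \<Rightarrow> real" where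
  "ball_distance \<Omega> =
     Inf {(R - r) / diameter \<Omega> | p r R. p \<in> \<Omega> \<and> 0 < r \<and> ball p r \<subseteq> \<Omega> \<and> \<Omega> \<subseteq> ball p R}"

text \<open>Here \<open>G\<close> is the gradient and \<open>A\<close> the Hessian matrix of \<open>f\<close>.  For \<open>\<alpha> > 0\<close> and bounded \<open>S\<close>,
  the Hoelder condition makes \<open>A\<close> continuous and bounded.\<close>

definition C2_Hoelder_on :: "real \<Rightarrow> (real^'n) set \<Rightarrow> (real^'n \<Rightarrow> real) \<Rightarrow> bool" where
  "C2_Hoelder_on \<alpha> S f \<longleftrightarrow>
     (\<exists>(G :: real^'n \<Rightarrow> real^'n) (A :: real^'n \<Rightarrow> real^'n^'n) K.
        (\<forall>x\<in>S. (f has_derivative (\<lambda>h. G x \<bullet> h)) (at x) \<and>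
               (G has_derivative (\<lambda>h. A x *v h)) (at x)) \<and>
        (\<forall>x\<in>S. \<forall>y\<in>S. norm (A x - A y) \<le> K * norm (x - y) powr \<alpha>))"

text \<open>Near each boundary point, \<open>\<Omega>\<close> is the region below a \<open>C\<^sup>2\<^sup>,\<^sup>\<alpha>\<close> graph in some direction \<open>\<nu>\<close>.
  The function \<open>\<phi>\<close> only matters on the hyperplane orthogonal to \<open>\<nu>\<close>; its regularity is that of
  its extension to the ball that is constant along \<open>\<nu>\<close>.\<close>

definition C2_Hoelder_boundary :: "real \<Rightarrow> (real^'n) set \<Rightarrow> bool" where
  "C2_Hoelder_boundary \<alpha> \<Omega> \<longleftrightarrow>
     (\<forall>p\<in>frontier \<Omega>. \<exists>r>0. \<exists>\<nu> \<phi>. norm \<nu> = 1 \<and>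
        C2_Hoelder_on \<alpha> (ball p r) (\<lambda>x. \<phi> (x - (x \<bullet> \<nu>) *\<^sub>R \<nu>)) \<and>
        \<Omega> \<inter> ball p r = {x \<in> ball p r. x \<bullet> \<nu> < \<phi> (x - (x \<bullet> \<nu>) *\<^sub>R \<nu>)})"

definition bilipschitz_map ::
    "'a::metric_space set \<Rightarrow> 'b::metric_space set \<Rightarrow> ('a \<Rightarrow> 'b) \<Rightarrow> bool" where
  "bilipschitz_map X Y F \<longleftrightarrow>
     bij_betw F X Y \<and> (\<exists>L. L-lipschitz_on X F) \<and> (\<exists>L. L-lipschitz_on Y (inv_into X F))"

end

theory Submission
  imports Defs
begin

text \<open>The proof is the method of moving planes in quantitative form.  For a unit vector \<open>e\<close> let the
  plane \<open>x \<bullet> e = c\<close> stop at the largest midpoint of two boundary points on a line parallel to \<open>e\<close>.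
  The part of \<open>\<Omega>\<close> beyond the plane then reflects into \<open>\<Omega>\<close>, and comparing the curvatures at two
  boundary points that are mirror images (or, in the limit, the derivative of the curvature along \<open>e\<close>
  at a point where the plane meets the boundary orthogonally) bounds the first moment, with respect to
  the plane, of the part of \<open>\<Omega>\<close> that is not symmetric by a multiple of \<open>\<delta>\<^sub>s(\<Omega>)\<close>.  By antisymmetry this
  moment is \<open>|\<Omega>|\<close> times the distance \<open>c - b \<bullet> e\<close> of the plane from the barycenter \<open>b\<close>.  So every
  midpoint \<open>(x + y) / 2\<close> of boundary points satisfies \<open>((x + y) / 2 - b) \<bullet> e \<le> \<epsilon>\<close> for
  \<open>e = (x - y) / |x - y|\<close>, that is, \<open>|x - b|\<^sup>2 - |y - b|\<^sup>2 \<le> 2 \<epsilon> |x - y|\<close>.  This one inequality says both that the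
  boundary lies in a thin annulus around \<open>b\<close> and that it is a radial graph with small Lipschitz
  constant.\<close>

section \<open>Lebesgue measure\<close>

text \<open>The obstacle is the tangential case. The derivative of the curvature along
  \<open>e\<close> is never formed; it is replaced by the difference quotient over two boundary
  points at heights \<open>t\<close> and \<open>- t\<close> over the plane, which are mirror images
  only up to order \<open>t powr (\<alpha> + 2)\<close>. Its errors (the singular part of the
  kernel, the defect of mirror symmetry, the excess inside the truncation ball) are of order
  \<open>t powr (1 + \<alpha> - 2 * s)\<close>. As \<open>2 * s < \<alpha>\<close>, they vanish
  after division by \<open>t\<close>, and with them every constant that depends on a chart of the
  boundary or degenerates for \<open>s\<close> near 1/2. What remains is the kernel factor
  \<open>2 * \<beta> * D powr (- \<beta> - 2)\<close> with \<open>\<beta> = n + 2 * s\<close>, hence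
  constants depending on \<open>n\<close> alone. Principal values enter only through differences of
  potentials truncated at the same radius, in which the divergent parts cancel. In
  \<open>scaled_deficit\<close> one division by the volume turns the moment into a distance; the
  remaining factor \<open>D ^ (n - 1) / V\<close> measures the volume of a shell of thickness
  \<epsilon> relative to \<Omega>, which also settles the case of a barycenter outside
  \<Omega>.\<close>

lemma borel_measurable_orthogonal:
  fixes f :: "'a::euclidean_space \<Rightarrow> 'a"
  assumes "orthogonal_transformation f"
  shows "(\<lambda>x. c + f x) \<in> borel_measurable borel"
  using assms
  by (intro borel_measurable_continuous_onI continuous_intros linear_continuous_on
      linear_conv_bounded_linear[THEN iffD1] orthogonal_transformation_linear)

lemma nn_integral_lborel_translate:
  fixes h :: "'a::euclidean_space \<Rightarrow> ennreal"
  assumes "h \<in> borel_measurable borel"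
  shows "(\<integral>\<^sup>+x. h (c + x) \<partial>lborel) = (\<integral>\<^sup>+x. h x \<partial>lborel)"
proof -
  have "(\<integral>\<^sup>+x. h x \<partial>lborel) = (\<integral>\<^sup>+x. h x \<partial>(distr lborel borel ((+) c)))"
    by (simp add: lborel_distr_plus)
  also have "\<dots> = (\<integral>\<^sup>+x. h (c + x) \<partial>lborel)"
    using assms by (subst nn_integral_distr) auto
  finally show ?thesis by simp
qed

text \<open>Evaluating \<open>\<integral>\<integral> 1\<^sub>A(f x) 1\<^sub>B(y - f x)\<close> for the unit ball \<open>B\<close> in both orders compares the measure
  of \<open>A\<close> with that of its preimage; the change of variables theorems of the library require a
  well-ordered index type.\<close>

lemma lborel_distr_orthogonal:
  fixes f :: "'a::euclidean_space \<Rightarrow> 'a"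
  assumes f: "orthogonal_transformation f"
  shows "distr lborel borel (\<lambda>x. c + f x) = lborel"
proof -
  have lin: "linear f" and bij: "bij f" and nf: "\<And>x. norm (f x) = norm x"
    using f orthogonal_transformation_linear orthogonal_transformation_bij orthogonal_transformation_norm
    by blast+
  have [measurable]: "f \<in> borel_measurable borel"
    using borel_measurable_orthogonal[OF f, of 0] by simp
  define g where "g = inv f"
  have fg: "f (g y) = y" for y unfolding g_def using bij by (simp add: bij_is_surj surj_f_inv_f)
  let ?B = "ball (0::'a) 1"
  have key: "emeasure lborel (f -` A) = emeasure lborel A" if [measurable]: "A \<in> sets borel" for A
  proof -
    have [measurable]: "f -` A \<in> sets borel" using measurable_sets_borel[of f borel A] by simp
    have "(\<integral>\<^sup>+x. (\<integral>\<^sup>+y. indicator A (f x) * indicator {..<1::real} (norm (y - f x)) \<partial>lborel) \<partial>lborel)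
        = (\<integral>\<^sup>+x. indicator A (f x) * emeasure lborel ?B \<partial>lborel)"
    proof (rule nn_integral_cong)
      fix x
      have "(\<integral>\<^sup>+y. indicator A (f x) * indicator {..<1::real} (norm (y - f x)) \<partial>lborel)
          = (\<integral>\<^sup>+y. indicator A (f x) * indicator (ball (f x) 1) y \<partial>lborel)"
        by (intro nn_integral_cong) (auto simp: indicator_def dist_norm norm_minus_commute)
      also have "\<dots> = indicator A (f x) * emeasure lborel (ball (f x) 1)"
        by (rule nn_integral_cmult_indicator) simp
      also have "emeasure lborel (ball (f x) 1) = emeasure lborel ?B"
        by (simp add: emeasure_ball)
      finally show "(\<integral>\<^sup>+y. indicator A (f x) * indicator {..<1::real} (norm (y - f x)) \<partial>lborel)
          = indicator A (f x) * emeasure lborel ?B" .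
    qed
    also have "\<dots> = (\<integral>\<^sup>+x. indicator (f -` A) x * emeasure lborel ?B \<partial>lborel)"
      by (intro nn_integral_cong) (auto simp: indicator_def)
    also have "\<dots> = emeasure lborel (f -` A) * emeasure lborel ?B"
      by (subst nn_integral_multc) auto
    finally have 1: "(\<integral>\<^sup>+x. (\<integral>\<^sup>+y. indicator A (f x) * indicator {..<1::real} (norm (y - f x)) \<partial>lborel) \<partial>lborel)
        = emeasure lborel (f -` A) * emeasure lborel ?B" .
    have "(\<integral>\<^sup>+x. (\<integral>\<^sup>+y. indicator A (f x) * indicator {..<1::real} (norm (y - f x)) \<partial>lborel) \<partial>lborel)
        = (\<integral>\<^sup>+y. (\<integral>\<^sup>+x. indicator A (f x) * indicator {..<1::real} (norm (y - f x)) \<partial>lborel) \<partial>lborel)"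
      by (rule lborel_pair.Fubini'[where f="\<lambda>y x. indicator A (f x) * indicator {..<1::real} (norm (y - f x))"]) measurable
    \<comment> \<open>Translating \<open>x\<close> by a preimage of \<open>y\<close> moves the ball
      to the origin; as \<open>f\<close> preserves norms, the ball condition then involves
      \<open>x\<close> alone.\<close>
    also have "\<dots> = (\<integral>\<^sup>+y. (\<integral>\<^sup>+x. indicator A (y + f x) * indicator {..<1::real} (norm x) \<partial>lborel) \<partial>lborel)"
    proof (rule nn_integral_cong)
      fix y
      have "(\<integral>\<^sup>+x. indicator A (f x) * indicator {..<1::real} (norm (y - f x)) \<partial>lborel)
          = (\<integral>\<^sup>+x. indicator A (f (g y + x)) * indicator {..<1::real} (norm (y - f (g y + x))) \<partial>lborel)"
        by (subst nn_integral_lborel_translate[of "\<lambda>x. indicator A (f x) * indicator {..<1::real} (norm (y - f x))"]) auto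
      also have "\<dots> = (\<integral>\<^sup>+x. indicator A (y + f x) * indicator {..<1::real} (norm x) \<partial>lborel)"
        by (intro nn_integral_cong) (auto simp: linear_add[OF lin] fg indicator_def nf)
      finally show "(\<integral>\<^sup>+x. indicator A (f x) * indicator {..<1::real} (norm (y - f x)) \<partial>lborel)
          = (\<integral>\<^sup>+x. indicator A (y + f x) * indicator {..<1::real} (norm x) \<partial>lborel)" .
    qed
    also have "\<dots> = (\<integral>\<^sup>+x. (\<integral>\<^sup>+y. indicator A (y + f x) * indicator {..<1::real} (norm x) \<partial>lborel) \<partial>lborel)"
      by (rule lborel_pair.Fubini'[where f="\<lambda>x y. indicator A (y + f x) * indicator {..<1::real} (norm x)"]) measurable
    also have "\<dots> = (\<integral>\<^sup>+x. emeasure lborel A * indicator {..<1::real} (norm (x::'a)) \<partial>lborel)"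
    proof (rule nn_integral_cong)
      fix x
      have "(\<integral>\<^sup>+y. indicator A (y + f x) * indicator {..<1::real} (norm x) \<partial>lborel)
          = (\<integral>\<^sup>+y. indicator A (f x + y) \<partial>lborel) * indicator {..<1::real} (norm x)"
        by (subst nn_integral_multc) (auto simp: add.commute)
      also have "(\<integral>\<^sup>+y. indicator A (f x + y) \<partial>lborel) = emeasure lborel A"
        using nn_integral_lborel_translate[of "indicator A" "f x"] that by simp
      finally show "(\<integral>\<^sup>+y. indicator A (y + f x) * indicator {..<1::real} (norm x) \<partial>lborel) = emeasure lborel A * indicator {..<1::real} (norm x)" .
    qed
    also have "\<dots> = (\<integral>\<^sup>+x. emeasure lborel A * indicator ?B x \<partial>lborel)"
      by (intro nn_integral_cong) (auto simp: indicator_def)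
    also have "\<dots> = emeasure lborel A * emeasure lborel ?B"
      by (rule nn_integral_cmult_indicator) simp
    finally have "emeasure lborel (f -` A) * emeasure lborel ?B = emeasure lborel A * emeasure lborel ?B"
      using 1 by simp
    moreover have "emeasure lborel ?B \<noteq> 0" "emeasure lborel ?B \<noteq> top"
      by (auto simp: emeasure_ball ennreal_eq_0_iff not_le)
    ultimately show ?thesis by (metis ennreal_mult_cancel_left mult.commute)
  qed
  have "distr lborel borel (\<lambda>x. c + f x) = distr (distr lborel borel f) borel ((+) c)"
    by (subst distr_distr) (auto simp: comp_def)
  also have "distr lborel borel f = (lborel :: 'a measure)"
    by (rule measure_eqI) (auto simp: emeasure_distr key)
  also have "distr lborel borel ((+) c) = lborel" by (rule lborel_distr_plus)
  finally show ?thesis .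
qed

lemma
  fixes f :: "'a::euclidean_space \<Rightarrow> 'a" and h :: "'a \<Rightarrow> real"
  assumes f: "orthogonal_transformation f" and h: "h \<in> borel_measurable borel"
  shows integral_orthogonal: "(LINT x|lborel. h (c + f x)) = (LINT x|lborel. h x)"
    and integrable_orthogonal: "integrable lborel (\<lambda>x. h (c + f x)) \<longleftrightarrow> integrable lborel h"
proof -
  have m: "(\<lambda>x. c + f x) \<in> measurable lborel borel"
    using borel_measurable_orthogonal[OF f] by simp
  show "(LINT x|lborel. h (c + f x)) = (LINT x|lborel. h x)"
    using integral_distr[OF m h] lborel_distr_orthogonal[OF f] by simp
  show "integrable lborel (\<lambda>x. h (c + f x)) \<longleftrightarrow> integrable lborel h"
    using integrable_distr_eq[OF m h] lborel_distr_orthogonal[OF f] by simp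
qed

section \<open>Thin sets and integrals over dyadic shells\<close>

lemma emeasure_lborel_ball:
  fixes c :: "'a::euclidean_space"
  assumes "r \<ge> 0"
  shows "emeasure lborel (ball c r) = ennreal (unit_ball_vol (DIM('a)) * r ^ DIM('a))"
  using assms by (simp add: emeasure_ball)

lemma fmeasurable_ball: "ball c r \<in> fmeasurable (lborel :: 'a::euclidean_space measure)"
  by (rule fmeasurableI) (use emeasure_bounded_finite[of "ball c r"] in \<open>auto simp: less_top\<close>)

lemma fmeasurable_subset_ball:
  fixes E :: "'a::euclidean_space set"
  assumes "E \<in> sets borel" "E \<subseteq> ball c r"
  shows "E \<in> fmeasurable lborel"
  using assms by (intro fmeasurableI2[OF fmeasurable_ball]) auto

text \<open>Every line in direction \<nu> meets \<open>E\<close> in a set of diameter at most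
  \<open>c\<close>, so translates of \<open>E\<close> by multiples of \<open>2 * c\<close> are
  disjoint. About \<open>r / c\<close> of them fit into the ball of radius \<open>3 * r\<close>,
  whence the power of 3. This packing argument takes the place of Fubini in rotated
  coordinates.\<close>

lemma measure_disjoint_translates:
  fixes E :: "'a::euclidean_space set"
  assumes E: "E \<in> sets borel" "E \<subseteq> ball a r"
    and sec: "\<And>y s. y \<in> E \<Longrightarrow> y + s *\<^sub>R \<nu> \<in> E \<Longrightarrow> \<bar>s\<bar> \<le> c"
    and \<nu>: "norm \<nu> = 1" and c: "0 < c" "c \<le> r"
  shows "measure lborel E \<le> unit_ball_vol (DIM('a)) * 3 ^ DIM('a) * r ^ (DIM('a) - 1) * c"
proof -
  \<comment> \<open>The largest shift \<open>2 * c * m\<close> is at most \<open>2 * r\<close>,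
    while the number \<open>m + 1\<close> of translates is at least \<open>r / c\<close>.\<close>
  define m where "m = nat \<lfloor>r / c\<rfloor>"
  define F where "F k = (+) ((2 * c * real k) *\<^sub>R \<nu>) ` E" for k :: nat
  have fE: "E \<in> fmeasurable lborel"
    using E by (rule fmeasurable_subset_ball)
  have Fb: "F k \<in> fmeasurable lborel" "measure lborel (F k) = measure lborel E" for k
  proof -
    define v where "v = (2 * c * real k) *\<^sub>R \<nu>"
    have eq: "F k = (\<lambda>x. x - v) -` E"
    proof (intro set_eqI iffI)
      fix x assume "x \<in> (\<lambda>x. x - v) -` E"
      then have "x = v + (x - v)" "x - v \<in> E" by auto
      then show "x \<in> F k" unfolding F_def v_def[symmetric] by blast
    qed (auto simp: F_def v_def)
    have "(\<lambda>x. x - v) -` E \<in> sets borel"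
      using E measurable_sets_borel[of "\<lambda>x. x - v" borel E] by simp
    then have b: "F k \<in> sets borel" using eq by simp
    have "measure lebesgue (F k) = measure lebesgue E"
      unfolding F_def by (rule measure_translation)
    then show m: "measure lborel (F k) = measure lborel E"
      using b E by simp
    have "F k \<in> lmeasurable" unfolding F_def
      by (intro measurable_translation) (use fE in \<open>simp add: fmeasurable_def\<close>)
    then show "F k \<in> fmeasurable lborel"
      using b by (simp add: fmeasurable_def)
  qed
  have disj: "disjoint_family_on F {..m}"
    unfolding disjoint_family_on_def
  proof (intro ballI impI)
    fix i j assume ij: "i \<noteq> (j::nat)"
    show "F i \<inter> F j = {}"
    proof (rule ccontr)
      assume "F i \<inter> F j \<noteq> {}"
      then obtain y z where yz: "y \<in> E" "z \<in> E" "(2 * c * real i) *\<^sub>R \<nu> + y = (2 * c * real j) *\<^sub>R \<nu> + z"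
        unfolding F_def by auto
      then have "z = y + (2 * c * (real i - real j)) *\<^sub>R \<nu>"
        by (simp add: algebra_simps)
      then have "\<bar>2 * c * (real i - real j)\<bar> \<le> c" using sec[OF yz(1)] yz(2) by blast
      moreover have "\<bar>real i - real j\<bar> \<ge> 1" using ij by linarith
      then have "2 * c * 1 \<le> 2 * c * \<bar>real i - real j\<bar>" using c by (intro mult_left_mono) auto
      ultimately have "2 * c * 1 \<le> c" using c by (simp add: abs_mult)
      then show False using c by simp
    qed
  qed
  have sub: "(\<Union>k\<le>m. F k) \<subseteq> ball a (3 * r)"
  proof
    fix x assume "x \<in> (\<Union>k\<le>m. F k)"
    then obtain k y where k: "k \<le> m" "y \<in> E" "x = (2 * c * real k) *\<^sub>R \<nu> + y" unfolding F_def by auto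
    have "real k \<le> r / c" using k(1) c unfolding m_def by (simp add: le_nat_iff le_floor_iff)
    then have "2 * c * real k \<le> 2 * r" using c by (simp add: field_simps)
    moreover have "norm (y - a) < r" using k(2) E by (auto simp: dist_norm norm_minus_commute)
    moreover have "norm (x - a) \<le> norm ((2 * c * real k) *\<^sub>R \<nu>) + norm (y - a)"
      unfolding k(3) by (metis add_diff_eq norm_triangle_ineq)
    ultimately show "x \<in> ball a (3 * r)" using \<nu> c by (simp add: dist_norm norm_minus_commute)
  qed
  have "real (m + 1) * measure lborel E = (\<Sum>k\<le>m. measure lborel (F k))"
    using Fb by simp
  also have "\<dots> = measure lborel (\<Union>k\<le>m. F k)"
    by (rule measure_finite_Union[symmetric])
       (use fmeasurableD[OF Fb(1)] fmeasurableD2[OF Fb(1)] disj in auto)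
  also have "\<dots> \<le> measure lborel (ball a (3 * r))"
    by (rule measure_mono_fmeasurable[OF sub])
       (use fmeasurableD[OF Fb(1)] in \<open>auto simp: fmeasurable_ball\<close>)
  also have "\<dots> = unit_ball_vol (DIM('a)) * (3 * r) ^ DIM('a)"
    using c by (simp add: content_ball)
  finally have 1: "real (m + 1) * measure lborel E \<le> unit_ball_vol (DIM('a)) * 3 ^ DIM('a) * r ^ DIM('a)"
    by (simp add: power_mult_distrib mult.assoc)
  have "r / c \<le> real (m + 1)" unfolding m_def using c
    by linarith
  then have "r / c * measure lborel E \<le> real (m + 1) * measure lborel E"
    by (intro mult_right_mono) auto
  with 1 have "r / c * measure lborel E \<le> unit_ball_vol (DIM('a)) * 3 ^ DIM('a) * r ^ DIM('a)" by linarith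
  moreover have "r ^ DIM('a) = r * r ^ (DIM('a) - 1)"
    by (metis DIM_positive Suc_pred' power_Suc)
  ultimately have "r * measure lborel E \<le> r * (unit_ball_vol (DIM('a)) * 3 ^ DIM('a) * r ^ (DIM('a) - 1) * c)"
    using c by (simp add: field_simps)
  then show ?thesis using c by (simp add: mult_le_cancel_left)
qed

text \<open>The pieces may overlap: the sum of \<open>c j * indicator (A j)\<close> dominates the
  integrand wherever some piece contains the point, and only an upper bound is wanted. Points where
  \<open>f\<close> vanishes need no piece, which lets dyadic shells leave out the origin.\<close>

lemma nn_integral_geometric_cover:
  fixes f :: "'a::euclidean_space \<Rightarrow> real"
  assumes A: "\<And>j. A j \<in> sets borel" "\<And>j. emeasure lborel (A j) \<le> ennreal (m j)"
    and cover: "\<And>y. y \<in> E \<Longrightarrow> f y \<noteq> 0 \<Longrightarrow> \<exists>j. y \<in> A j"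
    and f: "\<And>y j. y \<in> A j \<Longrightarrow> f y \<le> c j"
    and c: "\<And>j. 0 \<le> c j" "\<And>j. c j * m j \<le> B * q ^ j" and q: "0 \<le> q" "q < 1" and B: "0 \<le> B"
  shows "(\<integral>\<^sup>+y. ennreal (indicator E y * f y) \<partial>lborel) \<le> ennreal (B / (1 - q))"
proof -
  have "(\<integral>\<^sup>+y. ennreal (indicator E y * f y) \<partial>lborel) \<le> (\<integral>\<^sup>+y. (\<Sum>j. ennreal (c j) * indicator (A j) y) \<partial>lborel)"
  proof (rule nn_integral_mono)
    fix y
    show "ennreal (indicator E y * f y) \<le> (\<Sum>j. ennreal (c j) * indicator (A j) y)"
    proof (cases "y \<in> E \<and> f y \<noteq> 0")
      case True
      then obtain j where j: "y \<in> A j" using cover by blast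
      have "ennreal (indicator E y * f y) \<le> ennreal (c j) * indicator (A j) y"
        using True j f[OF j] by (simp add: ennreal_leI)
      also have "\<dots> \<le> (\<Sum>j. ennreal (c j) * indicator (A j) y)"
        using sum_le_suminf[OF summableI[of "\<lambda>j. ennreal (c j) * indicator (A j) y"], of "{j}"] by (simp del: sum_mult_indicator)
      finally show ?thesis .
    qed auto
  qed
  also have "\<dots> = (\<Sum>j. (\<integral>\<^sup>+y. ennreal (c j) * indicator (A j) y \<partial>lborel))"
    by (rule nn_integral_suminf) (use A in measurable)
  also have "\<dots> = (\<Sum>j. ennreal (c j) * emeasure lborel (A j))"
    using A by (simp add: nn_integral_cmult_indicator)
  also have "\<dots> \<le> (\<Sum>j. ennreal (B * q ^ j))"
  proof (rule suminf_le)
    fix j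
    have "ennreal (c j) * emeasure lborel (A j) \<le> ennreal (c j) * ennreal (m j)"
      using A by (intro mult_left_mono) auto
    also have "\<dots> = ennreal (c j * m j)" using c by (simp add: ennreal_mult')
    also have "\<dots> \<le> ennreal (B * q ^ j)" using c by (intro ennreal_leI)
    finally show "ennreal (c j) * emeasure lborel (A j) \<le> ennreal (B * q ^ j)" .
  qed auto
  also have "\<dots> = ennreal (\<Sum>j. B * q ^ j)"
    using q B by (intro suminf_ennreal_eq) (auto intro!: sums_mult summable_mult summable_sums summable_geometric)
  also have "(\<Sum>j. B * q ^ j) = B / (1 - q)"
    using q by (simp add: suminf_mult suminf_geometric)
  finally show ?thesis .
qed

lemma dyadic_near:
  fixes x \<rho> :: real
  assumes "0 < x" "x < \<rho>"
  shows "\<exists>j::nat. \<rho> / 2 ^ (j + 1) \<le> x \<and> x < \<rho> / 2 ^ j"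
proof -
  obtain k :: nat where "(1/2) ^ k < x / \<rho>"
    using real_arch_pow_inv[of "x / \<rho>" "1/2"] assms by auto
  then have k: "\<rho> / 2 ^ k \<le> x" using assms by (simp add: field_simps)
  define i where "i = (LEAST i::nat. \<rho> / 2 ^ i \<le> x)"
  have i: "\<rho> / 2 ^ i \<le> x" unfolding i_def by (rule LeastI) (rule k)
  have "i \<noteq> 0" using i assms by (metis div_by_1 not_le power_0)
  then obtain j where j: "i = Suc j" using not0_implies_Suc by blast
  then have "\<not> \<rho> / 2 ^ j \<le> x" unfolding i_def using not_less_Least[of j] by (metis i_def lessI)
  then show ?thesis using i j by auto
qed

lemma dyadic_far:
  fixes x \<rho> :: real
  assumes "0 < \<rho>" "\<rho> \<le> x"
  shows "\<exists>j::nat. \<rho> * 2 ^ j \<le> x \<and> x < \<rho> * 2 ^ (j + 1)"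
proof -
  obtain k :: nat where "x / \<rho> < 2 ^ k"
    using real_arch_pow[of 2 "x / \<rho>"] by auto
  then have k: "x < \<rho> * 2 ^ k" using assms by (simp add: field_simps)
  define i where "i = (LEAST i::nat. x < \<rho> * 2 ^ i)"
  have i: "x < \<rho> * 2 ^ i" unfolding i_def by (rule LeastI) (rule k)
  have "i \<noteq> 0" using i assms by (metis mult.right_neutral not_le power_0)
  then obtain j where j: "i = Suc j" using not0_implies_Suc by blast
  then have "\<not> x < \<rho> * 2 ^ j" unfolding i_def using not_less_Least[of j] by (metis i_def lessI)
  then have "\<rho> * 2 ^ j \<le> x \<and> x < \<rho> * 2 ^ (j + 1)" using i j by simp
  then show ?thesis by blast
qed

text \<open>The kernel alone is not integrable at 0 once \<beta> reaches the dimension. The decay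
  \<open>M * r powr k\<close> of the mass of \<open>E\<close>, with \<open>\<beta> < k\<close>,
  makes the shell at radius \<open>\<rho> / 2 ^ j\<close> contribute a geometric term of ratio
  \<open>2 powr (\<beta> - k)\<close>. Later \<open>k = n + 1\<close> and
  \<open>\<beta> = n + 2 * s\<close>.\<close>

lemma nn_integral_powr_near:
  fixes E :: "'a::euclidean_space set"
  assumes E: "E \<in> sets borel" "E \<subseteq> ball 0 \<rho>" and \<rho>: "0 < \<rho>" and M: "0 \<le> M"
    and meas: "\<And>r. 0 < r \<Longrightarrow> r \<le> \<rho> \<Longrightarrow> measure lborel (E \<inter> ball 0 r) \<le> M * r powr k"
    and \<beta>: "0 \<le> \<beta>" "\<beta> < k"
  shows "(\<integral>\<^sup>+y. ennreal (indicator E y * norm y powr - \<beta>) \<partial>lborel)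
           \<le> ennreal (M * 2 powr \<beta> / (1 - 2 powr (\<beta> - k)) * \<rho> powr (k - \<beta>))"
proof -
  have fm: "E \<inter> ball 0 r \<in> fmeasurable lborel" if "0 < r" for r
    using E by (intro fmeasurable_subset_ball) auto
  define A where "A j = E \<inter> ball 0 (\<rho> / 2 ^ j) - ball 0 (\<rho> / 2 ^ (j + 1))" for j :: nat
  have "(\<integral>\<^sup>+y. ennreal (indicator E y * norm y powr - \<beta>) \<partial>lborel)
     \<le> ennreal (M * 2 powr \<beta> * \<rho> powr (k - \<beta>) / (1 - 2 powr (\<beta> - k)))"
  proof (rule nn_integral_geometric_cover[where A=A and m="\<lambda>j. M * (\<rho> / 2 ^ j) powr k"
        and c="\<lambda>j. (\<rho> / 2 ^ (j + 1)) powr - \<beta>"])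
    show "A j \<in> sets borel" for j using E unfolding A_def by auto
    show "emeasure lborel (A j) \<le> ennreal (M * (\<rho> / 2 ^ j) powr k)" for j
    proof -
      have r: "0 < \<rho> / 2 ^ j" "\<rho> / 2 ^ j \<le> \<rho>" using \<rho> by (auto simp: field_simps)
      have "emeasure lborel (A j) \<le> emeasure lborel (E \<inter> ball 0 (\<rho> / 2 ^ j))"
        unfolding A_def using E by (intro emeasure_mono) auto
      also have "\<dots> = ennreal (measure lborel (E \<inter> ball 0 (\<rho> / 2 ^ j)))"
        using fm[OF r(1)] by (simp add: emeasure_eq_measure2)
      also have "\<dots> \<le> ennreal (M * (\<rho> / 2 ^ j) powr k)" using meas[OF r] by (rule ennreal_leI)
      finally show ?thesis .
    qed
    \<comment> \<open>The origin lies in no shell, but \<open>0 powr - \<beta>\<close> is 0, so a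
      nonzero value of the kernel already gives \<open>0 < norm y\<close>.\<close>
    show "\<exists>j. y \<in> A j" if "y \<in> E" "norm y powr - \<beta> \<noteq> 0" for y
    proof -
      have "0 < norm y" "norm y < \<rho>" using that E by auto
      then obtain j :: nat where "\<rho> / 2 ^ (j + 1) \<le> norm y" "norm y < \<rho> / 2 ^ j" using dyadic_near by blast
      then show ?thesis using that unfolding A_def by (intro exI[of _ j]) (auto simp: not_less)
    qed
    show "norm y powr - \<beta> \<le> (\<rho> / 2 ^ (j + 1)) powr - \<beta>" if "y \<in> A j" for y j
      using that \<beta> \<rho> unfolding A_def by (intro powr_mono2') (auto simp: not_less)
    show "(\<rho> / 2 ^ (j + 1)) powr - \<beta> * (M * (\<rho> / 2 ^ j) powr k) \<le> M * 2 powr \<beta> * \<rho> powr (k - \<beta>) * (2 powr (\<beta> - k)) ^ j" for j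
    proof -
      have p: "(2::real) ^ i = 2 powr real i" for i by (simp add: powr_realpow)
      have "(\<rho> / 2 ^ (j + 1)) powr - \<beta> = \<rho> powr - \<beta> * (2 powr (\<beta> * real j) * 2 powr \<beta>)"
        unfolding p using \<rho> by (simp add: powr_divide powr_powr powr_minus field_simps powr_add[symmetric])
      moreover have "(\<rho> / 2 ^ j) powr k = \<rho> powr k * 2 powr (- k * real j)"
        unfolding p using \<rho> by (simp add: powr_divide powr_powr powr_minus field_simps powr_add[symmetric])
      moreover have "(2 powr (\<beta> - k)) ^ j = 2 powr (\<beta> * real j) * 2 powr (- k * real j)"
        by (simp add: powr_realpow[symmetric] powr_powr powr_add[symmetric] algebra_simps)
      moreover have "\<rho> powr (k - \<beta>) = \<rho> powr k * \<rho> powr - \<beta>"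
        by (simp add: powr_add[symmetric])
      ultimately show ?thesis by (simp add: mult_ac)
    qed
    show "2 powr (\<beta> - k) < (1::real)" using \<beta> by (simp add: powr_less_one)
  qed (use M \<rho> in auto)
  then show ?thesis by simp
qed

lemma nn_integral_powr_far:
  fixes \<rho> \<gamma> :: real
  assumes \<rho>: "0 < \<rho>" and g: "real (DIM('a)) < \<gamma>"
  shows "(\<integral>\<^sup>+y. ennreal (indicator (- ball 0 \<rho>) y * norm (y::'a::euclidean_space) powr - \<gamma>) \<partial>lborel)
       \<le> ennreal (unit_ball_vol (DIM('a)) * 2 ^ DIM('a) / (1 - 2 powr (DIM('a) - \<gamma>)) * \<rho> powr (DIM('a) - \<gamma>))"
proof -
  define n where "n = DIM('a)"
  define A where "A j = ball 0 (\<rho> * 2 ^ (j + 1)) - ball (0::'a) (\<rho> * 2 ^ j)" for j :: nat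
  have "(\<integral>\<^sup>+y. ennreal (indicator (- ball 0 \<rho>) y * norm (y::'a) powr - \<gamma>) \<partial>lborel)
     \<le> ennreal (unit_ball_vol n * 2 ^ n * \<rho> powr (n - \<gamma>) / (1 - 2 powr (n - \<gamma>)))"
  proof (rule nn_integral_geometric_cover[where A=A and m="\<lambda>j. unit_ball_vol n * (\<rho> * 2 ^ (j + 1)) ^ n"
        and c="\<lambda>j. (\<rho> * 2 ^ j) powr - \<gamma>"])
    show "A j \<in> sets borel" for j unfolding A_def by auto
    show "emeasure lborel (A j) \<le> ennreal (unit_ball_vol n * (\<rho> * 2 ^ (j + 1)) ^ n)" for j
    proof -
      have "emeasure lborel (A j) \<le> emeasure lborel (ball (0::'a) (\<rho> * 2 ^ (j + 1)))"
        unfolding A_def by (intro emeasure_mono) auto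
      then show ?thesis using \<rho> by (simp add: emeasure_lborel_ball n_def)
    qed
    show "\<exists>j. y \<in> A j" if "y \<in> - ball 0 \<rho>" for y
    proof -
      have "\<rho> \<le> norm y" using that by auto
      then obtain j :: nat where "\<rho> * 2 ^ j \<le> norm y" "norm y < \<rho> * 2 ^ (j + 1)" using dyadic_far \<rho> by blast
      then show ?thesis unfolding A_def by (intro exI[of _ j]) (auto simp: not_less)
    qed
    show "norm y powr - \<gamma> \<le> (\<rho> * 2 ^ j) powr - \<gamma>" if "y \<in> A j" for y j
      using that g \<rho> unfolding A_def by (intro powr_mono2') (auto simp: not_less)
    show "(\<rho> * 2 ^ j) powr - \<gamma> * (unit_ball_vol n * (\<rho> * 2 ^ (j + 1)) ^ n)
        \<le> unit_ball_vol n * 2 ^ n * \<rho> powr (n - \<gamma>) * (2 powr (n - \<gamma>)) ^ j" for j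
    proof -
      have p: "(2::real) ^ i = 2 powr real i" for i by (simp add: powr_realpow)
      have "(\<rho> * 2 ^ (j + 1)) ^ n = \<rho> powr n * 2 ^ n * 2 powr (real j * real n)"
        using \<rho> by (simp add: powr_realpow[symmetric] powr_mult powr_powr field_simps powr_add)
      moreover have "(\<rho> * 2 ^ j) powr - \<gamma> = \<rho> powr - \<gamma> * 2 powr (- \<gamma> * real j)"
        unfolding p using \<rho> by (simp add: powr_mult powr_powr mult_ac)
      moreover have "(2 powr (n - \<gamma>)) ^ j = 2 powr (real j * real n) * 2 powr (- \<gamma> * real j)"
        by (subst powr_realpow[symmetric]) (simp_all add: powr_powr powr_add[symmetric] algebra_simps)
      moreover have "\<rho> powr (n - \<gamma>) = \<rho> powr n * \<rho> powr - \<gamma>"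
        by (simp add: powr_add[symmetric])
      ultimately show ?thesis by (simp add: mult_ac)
    qed
    show "2 powr (n - \<gamma>) < (1::real)" using g by (simp add: powr_less_one n_def)
  qed (use \<rho> in auto)
  then show ?thesis by (simp add: n_def)
qed

section \<open>Truncated potentials\<close>

definition cut_kernel :: "real \<Rightarrow> real \<Rightarrow> 'a::euclidean_space \<Rightarrow> real" where
  "cut_kernel \<beta> \<epsilon> y = indicator (- ball 0 \<epsilon>) y * norm y powr - \<beta>"

text \<open>Written in coordinates centred at \<open>q\<close>, so that potentials at two points can
  be compared integrand by integrand, also after a rotation of one of the two coordinate
  systems.\<close>

definition outer_potential :: "real \<Rightarrow> 'a::euclidean_space set \<Rightarrow> 'a \<Rightarrow> real \<Rightarrow> real" where
  "outer_potential \<beta> \<Omega> q \<epsilon> = (LINT y|lborel. indicator \<Omega> (q + y) * cut_kernel \<beta> \<epsilon> y)"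

lemma cut_kernel_nonneg [simp]: "0 \<le> cut_kernel \<beta> \<epsilon> y"
  by (simp add: cut_kernel_def)

lemma cut_kernel_cong_norm: "norm x = norm y \<Longrightarrow> cut_kernel \<beta> \<epsilon> x = cut_kernel \<beta> \<epsilon> y"
  by (simp add: cut_kernel_def indicator_def)

lemma cut_kernel_eq: "\<epsilon> \<le> norm y \<Longrightarrow> cut_kernel \<beta> \<epsilon> y = norm y powr - \<beta>"
  by (simp add: cut_kernel_def indicator_def)

lemma cut_kernel_eq_0: "norm y < \<epsilon> \<Longrightarrow> cut_kernel \<beta> \<epsilon> y = 0"
  by (simp add: cut_kernel_def indicator_def)

lemma borel_measurable_cut_kernel [measurable]: "cut_kernel \<beta> \<epsilon> \<in> borel_measurable borel"
proof -
  have "cut_kernel \<beta> \<epsilon> = (\<lambda>y::'a. (if norm y < \<epsilon> then 0 else norm y powr - \<beta>))"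
    by (auto simp: cut_kernel_def indicator_def)
  then show ?thesis by simp
qed

lemma borel_indicator_shift:
  fixes \<Omega> :: "'a::euclidean_space set"
  assumes "\<Omega> \<in> sets borel"
  shows "(\<lambda>y. indicator \<Omega> (q + y) :: real) \<in> borel_measurable borel"
    "(\<lambda>y. indicator \<Omega> (q - y) :: real) \<in> borel_measurable borel"
proof -
  have i: "indicator \<Omega> \<in> borel_measurable borel" using assms by simp
  have "(\<lambda>y. q + y) \<in> borel_measurable borel" "(\<lambda>y. q - y) \<in> borel_measurable borel" by auto
  from this[THEN measurable_compose, OF i]
  show "(\<lambda>y. indicator \<Omega> (q + y) :: real) \<in> borel_measurable borel"
    "(\<lambda>y. indicator \<Omega> (q - y) :: real) \<in> borel_measurable borel" by auto
qed

lemma borel_sets_coincidence: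
  assumes "f \<in> borel_measurable borel" "g \<in> borel_measurable borel" and \<Omega>: "\<Omega> \<in> sets borel" and S: "S \<in> sets borel"
  shows "{y \<in> S. f y \<in> \<Omega> \<longleftrightarrow> g y \<in> \<Omega>} \<in> sets borel" "{y \<in> S. (f y \<in> \<Omega>) \<noteq> (g y \<in> \<Omega>)} \<in> sets borel"
proof -
  have m: "f -` \<Omega> \<in> sets borel" "g -` \<Omega> \<in> sets borel" 
    using measurable_sets_borel[OF assms(1) \<Omega>] measurable_sets_borel[OF assms(2) \<Omega>] by auto
  have "{y \<in> S. (f y \<in> \<Omega>) \<noteq> (g y \<in> \<Omega>)} = S \<inter> ((f -` \<Omega> - g -` \<Omega>) \<union> (g -` \<Omega> - f -` \<Omega>))" by auto
  then show d: "{y \<in> S. (f y \<in> \<Omega>) \<noteq> (g y \<in> \<Omega>)} \<in> sets borel" using m S by auto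
  have "{y \<in> S. f y \<in> \<Omega> \<longleftrightarrow> g y \<in> \<Omega>} = S - {y \<in> S. (f y \<in> \<Omega>) \<noteq> (g y \<in> \<Omega>)}" by auto
  then show "{y \<in> S. f y \<in> \<Omega> \<longleftrightarrow> g y \<in> \<Omega>} \<in> sets borel" using d S by auto
qed

lemma integral_le_of_nn_integral:
  fixes h :: "'a::euclidean_space \<Rightarrow> real"
  assumes h: "h \<in> borel_measurable borel" "\<And>y. 0 \<le> h y"
    and le: "(\<integral>\<^sup>+y. ennreal (h y) \<partial>lborel) \<le> ennreal C" and C: "0 \<le> C"
  shows "integrable lborel h" "(LINT y|lborel. h y) \<le> C"
proof -
  show int: "integrable lborel h"
    using h le by (intro integrableI_nonneg) (auto intro: le_less_trans)
  have "ennreal (LINT y|lborel. h y) \<le> ennreal C"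
    using nn_integral_eq_integral[OF int] h le by simp
  then show "(LINT y|lborel. h y) \<le> C" using C by (simp add: ennreal_le_iff)
qed

lemma
  fixes \<rho> \<gamma> :: real
  assumes \<rho>: "0 < \<rho>" and g: "real (DIM('a::euclidean_space)) < \<gamma>"
  shows integrable_cut_kernel: "integrable lborel (cut_kernel \<gamma> \<rho> :: 'a \<Rightarrow> real)"
    and integral_cut_kernel_le: "(LINT y|lborel. cut_kernel \<gamma> \<rho> (y::'a)) \<le>
      unit_ball_vol (DIM('a)) * 2 ^ DIM('a) / (1 - 2 powr (DIM('a) - \<gamma>)) * \<rho> powr (DIM('a) - \<gamma>)"
proof -
  have q: "2 powr (DIM('a) - \<gamma>) < 1" using g by (simp add: powr_less_one)
  have C: "0 \<le> unit_ball_vol (DIM('a)) * 2 ^ DIM('a) / (1 - 2 powr (DIM('a) - \<gamma>)) * \<rho> powr (DIM('a) - \<gamma>)"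
    using q by (intro mult_nonneg_nonneg divide_nonneg_nonneg) auto
  have nn: "(\<integral>\<^sup>+y. ennreal (cut_kernel \<gamma> \<rho> (y::'a)) \<partial>lborel) \<le>
      ennreal (unit_ball_vol (DIM('a)) * 2 ^ DIM('a) / (1 - 2 powr (DIM('a) - \<gamma>)) * \<rho> powr (DIM('a) - \<gamma>))"
    using nn_integral_powr_far[OF \<rho> g] by (simp add: cut_kernel_def)
  show "integrable lborel (cut_kernel \<gamma> \<rho> :: 'a \<Rightarrow> real)"
    using integral_le_of_nn_integral(1)[OF borel_measurable_cut_kernel cut_kernel_nonneg nn C] .
  show "(LINT y|lborel. cut_kernel \<gamma> \<rho> (y::'a)) \<le>
      unit_ball_vol (DIM('a)) * 2 ^ DIM('a) / (1 - 2 powr (DIM('a) - \<gamma>)) * \<rho> powr (DIM('a) - \<gamma>)"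
    using integral_le_of_nn_integral(2)[OF borel_measurable_cut_kernel cut_kernel_nonneg nn C] .
qed

lemma integrable_cut_kernel_mult:
  fixes h :: "'a::euclidean_space \<Rightarrow> real"
  assumes "0 < \<rho>" "real (DIM('a)) < \<gamma>" and h: "h \<in> borel_measurable borel" "\<And>y. \<bar>h y\<bar> \<le> B"
  shows "integrable lborel (\<lambda>y. h y * cut_kernel \<gamma> \<rho> y)"
proof (rule Bochner_Integration.integrable_bound)
  show "integrable lborel (\<lambda>y::'a. B * cut_kernel \<gamma> \<rho> y)"
    using integrable_cut_kernel[OF assms(1,2)] by simp
  show "AE y in lborel. norm (h y * cut_kernel \<gamma> \<rho> y) \<le> norm (B * cut_kernel \<gamma> \<rho> y)"
  proof (intro AE_I2)
    fix y
    have "\<bar>h y\<bar> * cut_kernel \<gamma> \<rho> y \<le> \<bar>B\<bar> * cut_kernel \<gamma> \<rho> y"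
      using h(2)[of y] by (intro mult_right_mono) auto
    then show "norm (h y * cut_kernel \<gamma> \<rho> y) \<le> norm (B * cut_kernel \<gamma> \<rho> y)" by (simp add: abs_mult)
  qed
qed (use h in measurable)

text \<open>The sum of the geometric series behind \<open>nn_integral_powr_near\<close> for the
  decay exponent \<open>n + 1\<close>. It is finite for \<open>\<beta> < n + 1\<close>, that is for
  \<open>s < 1 / 2\<close>, and blows up at the endpoint; in the final estimate it occurs only in a
  term that tends to 0.\<close>

definition near_const :: "nat \<Rightarrow> real \<Rightarrow> real" where
  "near_const n \<beta> = 2 powr \<beta> / (1 - 2 powr (\<beta> - real (n + 1)))"

lemma near_const_nonneg: "\<beta> < real (n + 1) \<Longrightarrow> 0 \<le> near_const n \<beta>"
  unfolding near_const_def by (intro divide_nonneg_nonneg) (auto simp: powr_less_one less_imp_le)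

lemma
  fixes E :: "'a::euclidean_space set"
  assumes E: "E \<in> sets borel" "E \<subseteq> ball 0 \<rho>" and \<rho>: "0 < \<rho>" and M: "0 \<le> M"
    and meas: "\<And>r. 0 < r \<Longrightarrow> r \<le> \<rho> \<Longrightarrow> measure lborel (E \<inter> ball 0 r) \<le> M * r ^ (DIM('a) + 1)"
    and \<beta>: "0 \<le> \<beta>" "\<beta> < real (DIM('a) + 1)"
  shows integrable_powr_near: "integrable lborel (\<lambda>y. indicator E y * norm y powr - \<beta>)"
    and integral_powr_near_le: "(LINT y|lborel. indicator E y * norm y powr - \<beta>)
           \<le> M * near_const (DIM('a)) \<beta> * \<rho> powr (real (DIM('a) + 1) - \<beta>)"
proof -
  have 1: "(\<integral>\<^sup>+y. ennreal (indicator E y * norm y powr - \<beta>) \<partial>lborel)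
           \<le> ennreal (M * 2 powr \<beta> / (1 - 2 powr (\<beta> - real (DIM('a) + 1))) * \<rho> powr (real (DIM('a) + 1) - \<beta>))"
    by (rule nn_integral_powr_near) (use assms in \<open>auto simp: powr_realpow simp del: of_nat_add of_nat_Suc power_Suc\<close>)
  have eq: "M * 2 powr \<beta> / (1 - 2 powr (\<beta> - real (DIM('a) + 1))) * \<rho> powr (real (DIM('a) + 1) - \<beta>)
      = M * near_const (DIM('a)) \<beta> * \<rho> powr (real (DIM('a) + 1) - \<beta>)"
    by (simp add: near_const_def)
  have C: "0 \<le> M * near_const (DIM('a)) \<beta> * \<rho> powr (real (DIM('a) + 1) - \<beta>)"
    using M near_const_nonneg[OF \<beta>(2)] by simp
  have m: "(\<lambda>y. indicator E y * norm y powr - \<beta>) \<in> borel_measurable borel" using E by measurable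
  show "integrable lborel (\<lambda>y. indicator E y * norm y powr - \<beta>)"
    by (rule integral_le_of_nn_integral(1)[OF m _ 1[unfolded eq] C]) simp
  show "(LINT y|lborel. indicator E y * norm y powr - \<beta>)
           \<le> M * near_const (DIM('a)) \<beta> * \<rho> powr (real (DIM('a) + 1) - \<beta>)"
    by (rule integral_le_of_nn_integral(2)[OF m _ 1[unfolded eq] C]) simp
qed

lemma outer_potential_eq:
  fixes \<Omega> :: "'a::euclidean_space set"
  assumes "\<Omega> \<in> sets borel"
  shows "outer_potential \<beta> \<Omega> q \<epsilon> = (LINT x|lborel. indicator \<Omega> x * cut_kernel \<beta> \<epsilon> (x - q))"
proof -
  have m: "(\<lambda>x. indicator \<Omega> x * cut_kernel \<beta> \<epsilon> (x - q) :: real) \<in> borel_measurable borel"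
    using assms by measurable
  show ?thesis
    using integral_orthogonal[OF orthogonal_transformation_id m, of q]
    by (simp add: outer_potential_def)
qed

lemma outer_potential_reflect:
  fixes \<Omega> :: "'a::euclidean_space set" and Q :: "'a \<Rightarrow> 'a"
  assumes "\<Omega> \<in> sets borel" and Q: "orthogonal_transformation Q"
  shows "outer_potential \<beta> \<Omega> q \<epsilon> = (LINT y|lborel. indicator \<Omega> (q + Q y) * cut_kernel \<beta> \<epsilon> y)"
proof -
  have m: "(\<lambda>y. indicator \<Omega> (q + y) * cut_kernel \<beta> \<epsilon> y) \<in> borel_measurable borel"
    using borel_indicator_shift[OF assms(1)] by measurable
  have "(LINT y|lborel. indicator \<Omega> (q + (0 + Q y)) * cut_kernel \<beta> \<epsilon> (0 + Q y)) = outer_potential \<beta> \<Omega> q \<epsilon>"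
    unfolding outer_potential_def by (rule integral_orthogonal[OF Q m])
  moreover have "cut_kernel \<beta> \<epsilon> (Q y) = cut_kernel \<beta> \<epsilon> y" for y
    by (rule cut_kernel_cong_norm) (use Q in \<open>simp add: orthogonal_transformation_norm\<close>)
  ultimately show ?thesis by simp
qed

text \<open>Averaging over \<open>y\<close> and \<open>- y\<close> turns the indicator minus 1/2
  into \<open>(indicator \<Omega> (q + y) + indicator \<Omega> (q - y) - 1) / 2\<close>, which
  vanishes whenever exactly one of the two points lies in \<Omega>. Near 0 the averaged integrand
  therefore lives on the set measured in \<open>meas\<close>, where the kernel is integrable, and
  dominated convergence applies. Half the kernel integral is the divergent part that has to be
  removed.\<close>

lemma principal_value_converges:
  fixes \<Omega> :: "'a::euclidean_space set"
  assumes \<Omega>: "\<Omega> \<in> sets borel" and \<rho>: "0 < \<rho>" and M: "0 \<le> M"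
    and meas: "\<And>r. 0 < r \<Longrightarrow> r \<le> \<rho> \<Longrightarrow>
      measure lborel ({y \<in> ball 0 \<rho>. q + y \<in> \<Omega> \<longleftrightarrow> q - y \<in> \<Omega>} \<inter> ball 0 r) \<le> M * r ^ (DIM('a) + 1)"
    and \<beta>: "real (DIM('a)) < \<beta>" "\<beta> < real (DIM('a) + 1)"
  shows "\<exists>l. ((\<lambda>\<epsilon>. outer_potential \<beta> \<Omega> q \<epsilon> - (LINT y|lborel. cut_kernel \<beta> \<epsilon> (y::'a)) / 2) \<longlongrightarrow> l) (at_right 0)"
proof -
  define E where "E = {y \<in> ball 0 \<rho>. q + y \<in> \<Omega> \<longleftrightarrow> q - y \<in> \<Omega>}"
  have E: "E \<in> sets borel" unfolding E_def by (rule borel_sets_coincidence) (use \<Omega> in auto)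
  have intE: "integrable lborel (\<lambda>y. indicator E y * norm y powr - \<beta>)"
    by (rule integrable_powr_near[OF E _ \<rho> M]) (use meas \<beta> in \<open>auto simp: E_def\<close>)
  define F where "F y = (indicator \<Omega> (q + y) + indicator \<Omega> (q - y) - 1) / 2 * norm y powr - \<beta>" for y
  have Fm: "F \<in> borel_measurable borel"
    unfolding F_def using borel_indicator_shift[OF \<Omega>] by measurable
  have Fb: "norm (F y) \<le> indicator E y * norm y powr - \<beta> + cut_kernel \<beta> \<rho> y" for y
  proof (cases "norm y < \<rho>")
    case True
    show ?thesis
    proof (cases "y \<in> E")
      case True then show ?thesis by (auto simp: F_def indicator_def abs_mult add_nonneg_nonneg intro!: add_increasing2)
    next
      case False
      then have "F y = 0" using \<open>norm y < \<rho>\<close> by (auto simp: F_def E_def indicator_def)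
      then show ?thesis by simp
    qed
  next
    case False
    have "\<bar>F y\<bar> \<le> norm y powr - \<beta>"
      by (auto simp: F_def indicator_def abs_mult)
    also have "\<dots> = cut_kernel \<beta> \<rho> y" using False by (simp add: cut_kernel_eq)
    finally show ?thesis by (simp add: add_increasing)
  qed
  have W: "integrable lborel (\<lambda>y. indicator E y * norm y powr - \<beta> + cut_kernel \<beta> \<rho> y)"
    using intE integrable_cut_kernel[OF \<rho> \<beta>(1)] by simp
  have eq: "outer_potential \<beta> \<Omega> q \<epsilon> - (LINT y|lborel. cut_kernel \<beta> \<epsilon> (y::'a)) / 2
      = (LINT y|lborel. indicator (- ball 0 \<epsilon>) y * F y)" if \<epsilon>: "0 < \<epsilon>" for \<epsilon>
  proof -
    have o: "orthogonal_transformation (\<lambda>x::'a. - x)"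
      using orthogonal_transformation_neg[of id] orthogonal_transformation_id by (simp add: id_def)
    have i1: "integrable lborel (\<lambda>y. indicator \<Omega> (q + y) * cut_kernel \<beta> \<epsilon> y)"
      "integrable lborel (\<lambda>y. indicator \<Omega> (q - y) * cut_kernel \<beta> \<epsilon> y)"
      by (rule integrable_cut_kernel_mult[OF \<epsilon> \<beta>(1), where B=1];
          use borel_indicator_shift[OF \<Omega>] in \<open>auto simp: indicator_def\<close>)+
    have "(LINT y|lborel. indicator (- ball 0 \<epsilon>) y * F y)
       = (LINT y|lborel. (indicator \<Omega> (q + y) * cut_kernel \<beta> \<epsilon> y + indicator \<Omega> (q - y) * cut_kernel \<beta> \<epsilon> y - cut_kernel \<beta> \<epsilon> y) / 2)"
      by (intro Bochner_Integration.integral_cong) (auto simp: F_def cut_kernel_def indicator_def)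
    also have "\<dots> = (outer_potential \<beta> \<Omega> q \<epsilon> + outer_potential \<beta> \<Omega> q \<epsilon> - (LINT y|lborel. cut_kernel \<beta> \<epsilon> (y::'a))) / 2"
      using i1 integrable_cut_kernel[OF \<epsilon> \<beta>(1)] outer_potential_reflect[OF \<Omega> o, of \<beta> q \<epsilon>]
      by (simp add: outer_potential_def)
    finally show ?thesis by (simp add: field_simps)
  qed
  have "((\<lambda>\<epsilon>. LINT y|lborel. indicator (- ball 0 \<epsilon>) y * F y) \<longlongrightarrow> (LINT y|lborel. F y)) (at_right 0)"
    unfolding tendsto_at_iff_sequentially
  proof (intro allI impI)
    fix X :: "nat \<Rightarrow> real" assume X: "\<forall>i. X i \<in> {0<..} - {0}" "X \<longlonglongrightarrow> 0"
    show "((\<lambda>\<epsilon>. LINT y|lborel. indicator (- ball 0 \<epsilon>) y * F y) \<circ> X) \<longlonglongrightarrow> (LINT y|lborel. F y)"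
      unfolding comp_def
    proof (rule integral_dominated_convergence[OF _ _ W])
      show "F \<in> borel_measurable lborel" using Fm by simp
      show "(\<lambda>y. indicator (- ball 0 (X i)) y * F y) \<in> borel_measurable lborel" for i
      proof -
        have "- ball (0::'a) (X i) \<in> sets borel" by auto
        then show ?thesis using Fm by measurable
      qed
      show "AE y in lborel. (\<lambda>i. indicator (- ball 0 (X i)) y * F y) \<longlonglongrightarrow> F y"
      proof (intro AE_I2)
        fix y
        show "(\<lambda>i. indicator (- ball 0 (X i)) y * F y) \<longlonglongrightarrow> F y"
        proof (cases "y = 0")
          case True then show ?thesis by (simp add: F_def)
        next
          case False
          then have "eventually (\<lambda>i. X i < norm y) sequentially"
            using X(2) by (auto intro: order_tendstoD)
          then have "eventually (\<lambda>i. indicator (- ball 0 (X i)) y * F y = F y) sequentially"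
            by eventually_elim auto
          then show ?thesis by (rule tendsto_eventually)
        qed
      qed
      show "AE y in lborel. norm (indicator (- ball 0 (X i)) y * F y) \<le> indicator E y * norm y powr - \<beta> + cut_kernel \<beta> \<rho> y" for i
      proof (intro AE_I2)
        fix y
        have "norm (indicator (- ball 0 (X i)) y * F y) \<le> norm (F y)" by (auto simp: indicator_def)
        then show "norm (indicator (- ball 0 (X i)) y * F y) \<le> indicator E y * norm y powr - \<beta> + cut_kernel \<beta> \<rho> y"
          using Fb[of y] by linarith
      qed
    qed
  qed
  then have "((\<lambda>\<epsilon>. outer_potential \<beta> \<Omega> q \<epsilon> - (LINT y|lborel. cut_kernel \<beta> \<epsilon> (y::'a)) / 2) \<longlongrightarrow> (LINT y|lborel. F y)) (at_right 0)"
    by (rule Lim_transform_eventually) (auto simp: eq eventually_at_right_less eventually_at_filter)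
  then show ?thesis by blast
qed

text \<open>Compared is the mass seen in the shell between \<epsilon> and \<rho>, from
  \<open>p\<close> directly and from \<open>q\<close> in coordinates rotated by \<open>Q\<close>.
  The integrands cancel except where the two pictures of \<Omega> disagree. The bound does not
  depend on \<epsilon> and so survives the limit of the principal value.\<close>

lemma outer_potential_near_difference:
  fixes \<Omega> :: "'a::euclidean_space set" and Q :: "'a \<Rightarrow> 'a"
  assumes \<Omega>: "\<Omega> \<in> sets borel" and \<rho>: "0 < \<rho>" and M: "0 \<le> M"
    and Q: "orthogonal_transformation Q"
    and meas: "\<And>r. 0 < r \<Longrightarrow> r \<le> \<rho> \<Longrightarrow>
      measure lborel ({y \<in> ball 0 \<rho>. (p + y \<in> \<Omega>) \<noteq> (q + Q y \<in> \<Omega>)} \<inter> ball 0 r) \<le> M * r ^ (DIM('a) + 1)"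
    and \<beta>: "real (DIM('a)) < \<beta>" "\<beta> < real (DIM('a) + 1)" and \<epsilon>: "0 < \<epsilon>" "\<epsilon> \<le> \<rho>"
  shows "\<bar>(outer_potential \<beta> \<Omega> p \<epsilon> - outer_potential \<beta> \<Omega> p \<rho>)
     - (outer_potential \<beta> \<Omega> q \<epsilon> - outer_potential \<beta> \<Omega> q \<rho>)\<bar>
     \<le> M * near_const (DIM('a)) \<beta> * \<rho> powr (real (DIM('a) + 1) - \<beta>)"
proof -
  define E where "E = {y \<in> ball 0 \<rho>. (p + y \<in> \<Omega>) \<noteq> (q + Q y \<in> \<Omega>)}"
  have mQ: "(\<lambda>y. indicator \<Omega> (q + Q y) :: real) \<in> borel_measurable borel"
    using measurable_compose[OF borel_measurable_orthogonal[OF Q, of q], of "indicator \<Omega>" borel] \<Omega> by simp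
  have E: "E \<in> sets borel"
    unfolding E_def by (rule borel_sets_coincidence) (use \<Omega> borel_measurable_orthogonal[OF Q] in auto)
  have ineq: "E \<subseteq> ball 0 \<rho>" "0 \<le> \<beta>" using \<beta> by (auto simp: E_def)
  note intE = integrable_powr_near[OF E ineq(1) \<rho> M meas[folded E_def] ineq(2) \<beta>(2)]
  note leE = integral_powr_near_le[OF E ineq(1) \<rho> M meas[folded E_def] ineq(2) \<beta>(2)]
  have i: "integrable lborel (\<lambda>y. indicator \<Omega> (p + y) * cut_kernel \<beta> r y)"
      "integrable lborel (\<lambda>y. indicator \<Omega> (q + Q y) * cut_kernel \<beta> r y)" if "0 < r" for r
    by (rule integrable_cut_kernel_mult[OF that \<beta>(1), where B=1];
        use borel_indicator_shift[OF \<Omega>] mQ in \<open>auto simp: indicator_def\<close>)+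
  let ?D = "\<lambda>y. (indicator \<Omega> (p + y) * cut_kernel \<beta> \<epsilon> y - indicator \<Omega> (p + y) * cut_kernel \<beta> \<rho> y)
     - (indicator \<Omega> (q + Q y) * cut_kernel \<beta> \<epsilon> y - indicator \<Omega> (q + Q y) * cut_kernel \<beta> \<rho> y)"
  have "(outer_potential \<beta> \<Omega> p \<epsilon> - outer_potential \<beta> \<Omega> p \<rho>)
     - (outer_potential \<beta> \<Omega> q \<epsilon> - outer_potential \<beta> \<Omega> q \<rho>) = (LINT y|lborel. ?D y)"
    unfolding outer_potential_reflect[OF \<Omega> Q, of \<beta> q] outer_potential_def[of \<beta> \<Omega> p]
    using i[OF \<epsilon>(1)] i[OF \<rho>] by simp
  moreover have "norm (LINT y|lborel. ?D y) \<le> (LINT y|lborel. indicator E y * norm y powr - \<beta>)"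
  proof (rule Bochner_Integration.integral_norm_bound_integral)
    show "integrable lborel ?D" using i[OF \<epsilon>(1)] i[OF \<rho>] by simp
    show "norm (?D y) \<le> indicator E y * norm y powr - \<beta>" for y
      using \<epsilon> by (auto simp: E_def indicator_def cut_kernel_def)
  qed (rule intE)
  ultimately show ?thesis using leE by simp
qed

section \<open>Dependence of truncated potentials on their centre\<close>

lemma powr_neg_diff_bounds:
  fixes a b \<beta> :: real
  assumes "0 < a" "a \<le> b" "0 \<le> \<beta>"
  shows "\<beta> * b powr (- \<beta> - 1) * (b - a) \<le> a powr - \<beta> - b powr - \<beta>"
    and "a powr - \<beta> - b powr - \<beta> \<le> \<beta> * a powr (- \<beta> - 1) * (b - a)"
proof -
  \<comment> \<open>The alternative \<open>z = a\<close> covers \<open>a = b\<close>, where the mean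
    value theorem does not apply.\<close>
  have "\<exists>z. (z = a \<or> a < z \<and> z < b) \<and> b powr - \<beta> - a powr - \<beta> = (b - a) * (- \<beta> * z powr (- \<beta> - 1))"
  proof (cases "a = b")
    case False
    then have "a < b" using assms by simp
    have "\<exists>z. z > a \<and> z < b \<and> b powr - \<beta> - a powr - \<beta> = (b - a) * (- \<beta> * z powr (- \<beta> - 1))"
      by (rule MVT2[OF \<open>a < b\<close>]) (use assms in \<open>auto intro!: derivative_eq_intros\<close>)
    then show ?thesis by blast
  qed auto
  then obtain z where z: "z = a \<or> a < z \<and> z < b" "b powr - \<beta> - a powr - \<beta> = (b - a) * (- \<beta> * z powr (- \<beta> - 1))" by blast
  have eq: "a powr - \<beta> - b powr - \<beta> = \<beta> * z powr (- \<beta> - 1) * (b - a)" using z(2) by (simp add: algebra_simps)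
  have "b powr (- \<beta> - 1) \<le> z powr (- \<beta> - 1)" "z powr (- \<beta> - 1) \<le> a powr (- \<beta> - 1)"
    using z(1) assms by (auto intro!: powr_mono2')
  then show "\<beta> * b powr (- \<beta> - 1) * (b - a) \<le> a powr - \<beta> - b powr - \<beta>"
    "a powr - \<beta> - b powr - \<beta> \<le> \<beta> * a powr (- \<beta> - 1) * (b - a)"
    unfolding eq using assms by (auto intro!: mult_left_mono mult_right_mono)
qed

lemma power_diff_le:
  fixes a b :: real
  assumes "0 \<le> b" "b \<le> a" "0 < n"
  shows "a ^ n - b ^ n \<le> real n * a ^ (n - 1) * (a - b)"
proof -
  obtain m where m: "n = Suc m" using assms(3) gr0_conv_Suc by blast
  have "a ^ n - b ^ n = (a - b) * (\<Sum>p<n. a ^ p * b ^ (n - Suc p))"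
    using power_diff_sumr2[of a n b] by (simp add: mult.commute)
  also have "\<dots> \<le> (a - b) * (\<Sum>p<n. a ^ (n - 1))"
  proof (intro mult_left_mono sum_mono)
    fix p assume "p \<in> {..<n}"
    then have "a ^ p * b ^ (n - Suc p) \<le> a ^ p * a ^ (n - Suc p)" "p + (n - Suc p) = n - 1"
      using assms by (auto intro!: mult_left_mono power_mono)
    then show "a ^ p * b ^ (n - Suc p) \<le> a ^ (n - 1)" by (metis power_add)
  qed (use assms in auto)
  finally show ?thesis by (simp add: mult_ac)
qed

text \<open>First summand: the derivative of the kernel integrated outside the truncation ball.
  Second summand: the shell around the truncation sphere, in which one of the two kernels may be cut
  off and the other not.\<close>

definition shift_const :: "nat \<Rightarrow> real \<Rightarrow> real" where
  "shift_const n \<beta> = \<beta> * 2 powr (\<beta> + 1) * (unit_ball_vol n * 2 ^ n / (1 - 2 powr (n - (\<beta> + 1))))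
     + unit_ball_vol n * real n * 2 ^ n"

text \<open>For a shift of length \<open>h\<close>, the kernels differ by their derivative outside
  \<open>\<rho> + h\<close>, both vanish inside \<open>\<rho> - h\<close>, and differ by at most
  \<open>\<rho> powr - \<beta>\<close> in the shell between, whose volume is of order
  \<open>h * \<rho> ^ (n - 1)\<close>. Both contributions have the order
  \<open>h * \<rho> powr (n - \<beta> - 1)\<close>.\<close>

lemma outer_potential_shift:
  fixes \<Omega> :: "'a::euclidean_space set"
  assumes \<Omega>: "\<Omega> \<in> sets borel" and \<rho>: "0 < \<rho>" and h: "norm (p - q) \<le> \<rho> / 2"
    and \<beta>: "real (DIM('a)) < \<beta>"
  shows "\<bar>outer_potential \<beta> \<Omega> p \<rho> - outer_potential \<beta> \<Omega> q \<rho>\<bar>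
     \<le> shift_const (DIM('a)) \<beta> * norm (p - q) * \<rho> powr (real (DIM('a)) - \<beta> - 1)"
proof -
  define n where "n = DIM('a)"
  have n: "0 < n" by (simp add: n_def)
  define v where "v = p - q"
  define h where "h = norm v"
  have h: "0 \<le> h" "h \<le> \<rho> / 2" using assms by (auto simp: h_def v_def)
  have \<beta>0: "0 < \<beta>" using \<beta> by (smt (verit) of_nat_0_le_iff)
  define S where "S = ball (0::'a) (\<rho> + h) - ball 0 (\<rho> - h)"
  have Sm: "S \<in> fmeasurable lborel"
    by (rule fmeasurable_subset_ball[of _ 0 "\<rho> + h"]) (auto simp: S_def)
  define W where "W y = h * \<beta> * 2 powr (\<beta> + 1) * cut_kernel (\<beta> + 1) \<rho> y + \<rho> powr - \<beta> * indicator S y" for y :: 'a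
  have pt: "\<bar>cut_kernel \<beta> \<rho> y - cut_kernel \<beta> \<rho> (y + v)\<bar> \<le> W y" for y
  proof -
    have tri: "norm (y + v) \<le> norm y + h" "norm y \<le> norm (y + v) + h"
      using norm_triangle_ineq[of y v] norm_triangle_ineq4[of "y + v" v] by (auto simp: h_def)
    consider "norm y < \<rho> - h" | "y \<in> S" | "\<rho> + h \<le> norm y"
      by (fastforce simp: S_def not_less)
    then show ?thesis
    proof cases
      case 1
      then have "cut_kernel \<beta> \<rho> y = 0" "cut_kernel \<beta> \<rho> (y + v) = 0" using tri h by (auto intro!: cut_kernel_eq_0)
      then show ?thesis using h \<beta>0 by (simp add: W_def)
    next
      case 2
      have b: "cut_kernel \<beta> \<rho> z \<in> {0..\<rho> powr - \<beta>}" for z :: 'a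
        using \<rho> \<beta>0 by (auto simp: cut_kernel_def indicator_def intro!: powr_mono2')
      have "\<bar>cut_kernel \<beta> \<rho> y - cut_kernel \<beta> \<rho> (y + v)\<bar> \<le> \<rho> powr - \<beta>"
        using b[of y] b[of "y + v"] unfolding atLeastAtMost_iff by linarith
      also have "\<dots> \<le> W y" using 2 h \<beta>0 by (simp add: W_def)
      finally show ?thesis .
    next
      case 3
      \<comment> \<open>Since \<open>h \<le> \<rho> / 2\<close>, both distances are at least
        \<open>norm y / 2\<close>; this halving is the origin of the factor
        \<open>2 powr (\<beta> + 1)\<close>.\<close>
      define a b where "a = min (norm y) (norm (y + v))" and "b = max (norm y) (norm (y + v))"
      have ab: "norm y / 2 \<le> a" "a \<le> b" "b - a \<le> h" "0 < norm y / 2"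
        using tri h 3 \<rho> by (auto simp: a_def b_def)
      then have a0: "0 < a" by linarith
      have "\<bar>cut_kernel \<beta> \<rho> y - cut_kernel \<beta> \<rho> (y + v)\<bar> = \<bar>a powr - \<beta> - b powr - \<beta>\<bar>"
        using 3 tri h by (simp add: cut_kernel_eq a_def b_def min_def max_def abs_minus_commute)
      also have "\<dots> = a powr - \<beta> - b powr - \<beta>"
        using powr_mono2'[of "- \<beta>" a b] a0 ab \<beta>0 by auto
      also have "\<dots> \<le> \<beta> * a powr (- \<beta> - 1) * (b - a)"
        by (rule powr_neg_diff_bounds(2)[OF a0 ab(2) less_imp_le[OF \<beta>0]])
      also have "\<dots> \<le> \<beta> * (norm y / 2) powr (- \<beta> - 1) * h"
        using a0 ab \<beta>0 by (intro mult_mono mult_left_mono powr_mono2') auto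
      also have "(norm y / 2) powr (- \<beta> - 1) = 2 powr (\<beta> + 1) * norm y powr - (\<beta> + 1)"
        using ab by (simp add: powr_divide powr_minus field_simps powr_add powr_diff)
      also have "norm y powr - (\<beta> + 1) = cut_kernel (\<beta> + 1) \<rho> y" using 3 h by (simp add: cut_kernel_eq)
      finally show ?thesis by (simp add: W_def mult_ac add_increasing2)
    qed
  qed
  have intW: "integrable lborel W"
    unfolding W_def using integrable_cut_kernel[OF \<rho>, where \<gamma>="\<beta> + 1" and 'a='a] \<beta> Sm
    by (auto intro!: Bochner_Integration.integrable_add integrable_mult_right integrable_real_indicator fmeasurableD dest: fmeasurableD2 simp: less_top)
  have mS: "measure lborel S \<le> unit_ball_vol n * real n * 2 ^ n * \<rho> ^ (n - 1) * h"
  proof -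
    have "measure lborel S = unit_ball_vol n * ((\<rho> + h) ^ n - (\<rho> - h) ^ n)"
      unfolding S_def using h \<rho>
      by (subst measure_Diff) (auto simp: content_ball n_def emeasure_lborel_ball algebra_simps)
    also have "\<dots> \<le> unit_ball_vol n * (real n * (\<rho> + h) ^ (n - 1) * ((\<rho> + h) - (\<rho> - h)))"
      using h \<rho> n by (intro mult_left_mono power_diff_le) auto
    also have "\<dots> \<le> unit_ball_vol n * (real n * (2 * \<rho>) ^ (n - 1) * ((\<rho> + h) - (\<rho> - h)))"
      using h \<rho> by (intro mult_left_mono mult_right_mono power_mono) auto
    also have "\<dots> = unit_ball_vol n * real n * 2 ^ n * \<rho> ^ (n - 1) * h"
      using n by (cases n) (auto simp: power_mult_distrib)
    finally show ?thesis .
  qed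
  have i: "integrable lborel (\<lambda>y. indicator \<Omega> (p + y) * cut_kernel \<beta> \<rho> y)"
    by (rule integrable_cut_kernel_mult[OF \<rho> \<beta>, where B=1]; use borel_indicator_shift[OF \<Omega>] in \<open>auto simp: indicator_def\<close>)
  have m: "(\<lambda>y. indicator \<Omega> (q + y) * cut_kernel \<beta> \<rho> y) \<in> borel_measurable borel"
    using borel_indicator_shift[OF \<Omega>] by measurable
  have q: "outer_potential \<beta> \<Omega> q \<rho> = (LINT y|lborel. indicator \<Omega> (p + y) * cut_kernel \<beta> \<rho> (y + v))"
    using integral_orthogonal[OF orthogonal_transformation_id m, of v]
    by (simp add: outer_potential_def v_def algebra_simps)
  have "integrable lborel (\<lambda>y. indicator \<Omega> (q + y) * cut_kernel \<beta> \<rho> y)"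
    by (rule integrable_cut_kernel_mult[OF \<rho> \<beta>, where B=1]; use borel_indicator_shift[OF \<Omega>] in \<open>auto simp: indicator_def\<close>)
  then have i': "integrable lborel (\<lambda>y. indicator \<Omega> (p + y) * cut_kernel \<beta> \<rho> (y + v))"
    using integrable_orthogonal[OF orthogonal_transformation_id m, of v] by (simp add: v_def algebra_simps)
  have "outer_potential \<beta> \<Omega> p \<rho> - outer_potential \<beta> \<Omega> q \<rho>
     = (LINT y|lborel. indicator \<Omega> (p + y) * cut_kernel \<beta> \<rho> y - indicator \<Omega> (p + y) * cut_kernel \<beta> \<rho> (y + v))"
    unfolding q using i i' by (simp add: outer_potential_def)
  also have "\<bar>\<dots>\<bar> \<le> (LINT y|lborel. W y)"
  proof -
    have "norm (LINT y|lborel. indicator \<Omega> (p + y) * cut_kernel \<beta> \<rho> y - indicator \<Omega> (p + y) * cut_kernel \<beta> \<rho> (y + v)) \<le> (LINT y|lborel. W y)"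
    proof (rule Bochner_Integration.integral_norm_bound_integral[OF _ intW])
      show "norm (indicator \<Omega> (p + y) * cut_kernel \<beta> \<rho> y - indicator \<Omega> (p + y) * cut_kernel \<beta> \<rho> (y + v)) \<le> W y" for y
        using pt[of y] by (auto simp: indicator_def)
    qed (use i i' in auto)
    then show ?thesis by simp
  qed
  also have "(LINT y|lborel. W y) = h * \<beta> * 2 powr (\<beta> + 1) * (LINT y|lborel. cut_kernel (\<beta> + 1) \<rho> (y::'a)) + \<rho> powr - \<beta> * measure lborel S"
    unfolding W_def using integrable_cut_kernel[OF \<rho>, where \<gamma>="\<beta> + 1" and 'a='a] \<beta> Sm
    by (subst Bochner_Integration.integral_add) (auto intro!: integrable_mult_right integrable_real_indicator fmeasurableD dest: fmeasurableD2 simp: less_top)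
  also have "\<dots> \<le> h * \<beta> * 2 powr (\<beta> + 1) * (unit_ball_vol n * 2 ^ n / (1 - 2 powr (n - (\<beta> + 1))) * \<rho> powr (n - (\<beta> + 1)))
       + \<rho> powr - \<beta> * (unit_ball_vol n * real n * 2 ^ n * \<rho> ^ (n - 1) * h)"
    using integral_cut_kernel_le[OF \<rho>, where \<gamma>="\<beta> + 1" and 'a='a] \<beta> h \<beta>0 mS
    by (intro add_mono mult_left_mono) (auto simp: n_def)
  also have "\<dots> = shift_const n \<beta> * h * \<rho> powr (real n - \<beta> - 1)"
  proof -
    have "\<rho> powr - \<beta> * \<rho> ^ (n - 1) = \<rho> powr (real n - \<beta> - 1)"
      using \<rho> n by (simp add: powr_realpow[symmetric] powr_add[symmetric] of_nat_diff algebra_simps)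
    moreover have "\<rho> powr (n - (\<beta> + 1)) = \<rho> powr (real n - \<beta> - 1)" by (simp add: algebra_simps)
    moreover have "\<rho> powr - \<beta> * (unit_ball_vol n * real n * 2 ^ n * \<rho> ^ (n - 1) * h) = unit_ball_vol n * real n * 2 ^ n * h * (\<rho> powr - \<beta> * \<rho> ^ (n - 1))"
      by simp
    ultimately show ?thesis by (simp add: shift_const_def algebra_simps)
  qed
  finally show ?thesis by (simp add: h_def v_def n_def)
qed

section \<open>Reflections\<close>

definition reflect :: "'a::euclidean_space \<Rightarrow> real \<Rightarrow> 'a \<Rightarrow> 'a" where
  "reflect e c x = x + (2 * (c - x \<bullet> e)) *\<^sub>R e"

context
  fixes e :: "'a::euclidean_space" and c :: real
  assumes e: "norm e = 1"
begin

lemma e_inner [simp]: "e \<bullet> e = 1" using e by (simp add: dot_square_norm)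

lemma reflect_inner: "reflect e c x \<bullet> e = 2 * c - x \<bullet> e"
  by (simp add: reflect_def inner_add_left)

lemma reflect_reflect [simp]: "reflect e c (reflect e c x) = x"
  by (simp add: reflect_def inner_add_left algebra_simps flip: scaleR_add_left scaleR_left_diff_distrib)

lemma orthogonal_transformation_reflect_0: "orthogonal_transformation (reflect e 0)"
proof -
  have "linear (reflect e 0)"
    by (rule linearI) (simp_all add: reflect_def algebra_simps inner_add_left)
  moreover have "norm (reflect e 0 v) = norm v" for v
  proof -
    have "(norm (reflect e 0 v))\<^sup>2 = (norm v)\<^sup>2"
      unfolding power2_norm_eq_inner by (simp add: reflect_def inner_add_left inner_add_right inner_commute algebra_simps)
    then show ?thesis by simp
  qed
  ultimately show ?thesis by (simp add: orthogonal_transformation)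
qed

lemma reflect_affine: "reflect e c x = (2 * c) *\<^sub>R e + reflect e 0 x"
  by (simp add: reflect_def algebra_simps)

lemma reflect_diff: "reflect e c x - reflect e c y = reflect e 0 (x - y)"
  by (simp add: reflect_def algebra_simps inner_diff_left)

lemma norm_reflect_0 [simp]: "norm (reflect e 0 v) = norm v"
  using orthogonal_transformation_reflect_0 by (rule orthogonal_transformation_norm)

lemma norm_reflect_diff: "norm (reflect e c x - reflect e c y) = norm (x - y)"
  by (simp add: reflect_diff)

lemma norm_diff_reflect: "norm (x - reflect e c y) = norm (reflect e c x - y)"
  using norm_reflect_diff[of x "reflect e c y"] by simp

lemma dist_reflect_self: "norm (reflect e c x - x) = 2 * \<bar>c - x \<bullet> e\<bar>"
proof -
  have "reflect e c x - x = (2 * (c - x \<bullet> e)) *\<^sub>R e" by (simp add: reflect_def)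
  then show ?thesis using e by (simp only: norm_scaleR abs_mult)
qed

text \<open>The product form is what drives \<open>outer_potential_reflect_ge\<close>: the distance
  of \<open>a\<close> from the plane becomes the factor \<open>t\<close> there, the distance of
  \<open>x\<close> the weight of the first moment.\<close>

lemma norm_diff_reflect_square:
  "(norm (x - a))\<^sup>2 - (norm (x - reflect e c a))\<^sup>2 = 4 * (c - x \<bullet> e) * (a \<bullet> e - c)"
  unfolding power2_norm_eq_inner reflect_def
  by (simp add: inner_diff_left inner_diff_right inner_add_left inner_add_right inner_commute algebra_simps)

lemma borel_measurable_reflect: "reflect e c \<in> borel_measurable borel"
  using borel_measurable_orthogonal[OF orthogonal_transformation_reflect_0, of "(2 * c) *\<^sub>R e"]
  by (simp flip: reflect_affine)

lemma
  fixes h :: "'a \<Rightarrow> real"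
  assumes h: "h \<in> borel_measurable borel"
  shows integral_reflect: "(LINT x|lborel. h (reflect e c x)) = (LINT x|lborel. h x)"
    and integrable_reflect: "integrable lborel (\<lambda>x. h (reflect e c x)) \<longleftrightarrow> integrable lborel h"
  using integral_orthogonal[OF orthogonal_transformation_reflect_0 h, of "(2 * c) *\<^sub>R e"]
    integrable_orthogonal[OF orthogonal_transformation_reflect_0 h, of "(2 * c) *\<^sub>R e"]
  by (simp_all flip: reflect_affine)

end

section \<open>Antisymmetric integrals and the excess\<close>

definition excess :: "'a::euclidean_space \<Rightarrow> real \<Rightarrow> 'a set \<Rightarrow> 'a set" where
  "excess e c \<Omega> = {x \<in> \<Omega>. x \<bullet> e < c \<and> reflect e c x \<notin> \<Omega>}"

definition cap_reflects_into :: "'a::euclidean_space \<Rightarrow> real \<Rightarrow> 'a set \<Rightarrow> bool" where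
  "cap_reflects_into e c \<Omega> \<longleftrightarrow> (\<forall>x\<in>\<Omega>. c < x \<bullet> e \<longrightarrow> reflect e c x \<in> \<Omega>)"

lemma borel_excess:
  fixes \<Omega> :: "'a::euclidean_space set"
  assumes e: "norm e = 1" and \<Omega>: "\<Omega> \<in> sets borel"
  shows "excess e c \<Omega> \<in> sets borel"
proof -
  have "reflect e c -` \<Omega> \<in> sets borel"
    using measurable_sets_borel[OF borel_measurable_reflect[OF e] \<Omega>] .
  moreover have "open {x. x \<bullet> e < c}"
    by (intro open_Collect_less continuous_intros)
  moreover have "excess e c \<Omega> = \<Omega> \<inter> {x. x \<bullet> e < c} - reflect e c -` \<Omega>" by (auto simp: excess_def)
  ultimately show ?thesis using \<Omega> by auto
qed

text \<open>Points of \<Omega> whose mirror image also lies in \<Omega> cancel in pairs because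
  \<open>h\<close> is odd, and \<open>h\<close> vanishes on the plane. As the upper cap reflects
  into \<Omega>, all unpaired points lie below the plane and form the excess. Applied both to a
  difference of kernels and to \<open>c - x \<bullet> e\<close>, it places the curvature and the
  barycenter on the same set.\<close>

lemma integral_antisymmetric:
  fixes \<Omega> :: "'a::euclidean_space set" and h :: "'a \<Rightarrow> real"
  assumes e: "norm e = 1" and \<Omega>: "\<Omega> \<in> sets borel" and cap: "cap_reflects_into e c \<Omega>"
    and h: "h \<in> borel_measurable borel" "\<And>x. h (reflect e c x) = - h x"
    and int: "integrable lborel (\<lambda>x. indicator \<Omega> x * h x)"
  shows "(LINT x|lborel. indicator \<Omega> x * h x) = (LINT x|lborel. indicator (excess e c \<Omega>) x * h x)"
    and "integrable lborel (\<lambda>x. indicator (excess e c \<Omega>) x * h x)"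
proof -
  define L where "L = {x. x \<bullet> e < c}"
  define U where "U = {x. c < x \<bullet> e}"
  have LU: "L \<in> sets borel" "U \<in> sets borel"
    unfolding L_def U_def by (intro borel_open open_Collect_less continuous_intros)+
  have h0: "h x = 0" if "x \<notin> L" "x \<notin> U" for x
  proof -
    have "reflect e c x = x" using that by (simp add: L_def U_def reflect_def)
    then show ?thesis using h(2)[of x] by simp
  qed
  let ?f = "\<lambda>x. indicator \<Omega> x * h x"
  have fm: "?f \<in> borel_measurable borel" using \<Omega> h by measurable
  have iL: "integrable lborel (\<lambda>x. indicator L x * ?f x)" and iU: "integrable lborel (\<lambda>x. indicator U x * ?f x)"
    using integrable_real_mult_indicator[OF _ int] LU by (auto simp: mult.commute)
  have mU: "(\<lambda>x. indicator U x * ?f x) \<in> borel_measurable borel" using LU fm by measurable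
  have refU: "indicator U (reflect e c x) * ?f (reflect e c x) = - (indicator L x * (indicator \<Omega> (reflect e c x) * h x))" for x
    using e by (auto simp: indicator_def U_def L_def reflect_inner h)
  have iR: "integrable lborel (\<lambda>x. indicator L x * (indicator \<Omega> (reflect e c x) * h x))"
    using iffD2[OF integrable_reflect[OF e mU, of c] iU] unfolding refU by simp
  have R: "(LINT x|lborel. indicator L x * (indicator \<Omega> (reflect e c x) * h x)) = - (LINT x|lborel. indicator U x * ?f x)"
    using integral_reflect[OF e mU, of c] unfolding refU by simp
  \<comment> \<open>If the mirror image of a point below the plane lies in \<Omega>, it lies in the
    cap, and \<open>cap\<close> brings the point itself back into \<Omega>; so the difference of the
    two indicators is exactly that of the excess.\<close>
  have pt: "indicator L x * ?f x - indicator L x * (indicator \<Omega> (reflect e c x) * h x) = indicator (excess e c \<Omega>) x * h x" for x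
    using cap e unfolding cap_reflects_into_def excess_def indicator_def L_def
    by (cases "x \<bullet> e < c"; cases "reflect e c x \<in> \<Omega>"; use reflect_inner[OF e, of c x] reflect_reflect[OF e, of c x] in \<open>force\<close>)
  have "(LINT x|lborel. ?f x) = (LINT x|lborel. indicator L x * ?f x + indicator U x * ?f x)"
  proof (rule Bochner_Integration.integral_cong)
    show "?f x = indicator L x * ?f x + indicator U x * ?f x" for x
      using h0[of x] by (auto simp: indicator_def L_def U_def)
  qed simp
  also have "\<dots> = (LINT x|lborel. indicator L x * ?f x) - (LINT x|lborel. indicator L x * (indicator \<Omega> (reflect e c x) * h x))"
    unfolding R using iL iU by simp
  also have "\<dots> = (LINT x|lborel. indicator (excess e c \<Omega>) x * h x)"
    using iL iR by (simp flip: pt)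
  finally show "(LINT x|lborel. ?f x) = (LINT x|lborel. indicator (excess e c \<Omega>) x * h x)" .
  show "integrable lborel (\<lambda>x. indicator (excess e c \<Omega>) x * h x)"
    using Bochner_Integration.integrable_diff[OF iL iR] unfolding pt .
qed

definition excess_moment :: "'a::euclidean_space \<Rightarrow> real \<Rightarrow> 'a set \<Rightarrow> real" where
  "excess_moment e c \<Omega> = (LINT x|lborel. indicator (excess e c \<Omega>) x * (c - x \<bullet> e))"

lemma
  fixes \<Omega> :: "'a::euclidean_space set"
  assumes e: "norm e = 1" and \<Omega>: "open \<Omega>" "bounded \<Omega>" and cap: "cap_reflects_into e c \<Omega>"
  shows excess_moment_eq: "excess_moment e c \<Omega> = (LINT x|lborel. indicator \<Omega> x * (c - x \<bullet> e))"
    and integrable_excess_moment: "integrable lborel (\<lambda>x. indicator (excess e c \<Omega>) x * (c - x \<bullet> e))"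
proof -
  have b: "\<Omega> \<in> sets borel" using \<Omega> by simp
  obtain R where R: "\<And>x. x \<in> \<Omega> \<Longrightarrow> norm x \<le> R" using \<Omega>(2) bounded_iff by blast
  have "emeasure lborel \<Omega> < \<infinity>" using emeasure_bounded_finite[OF \<Omega>(2)] .
  then have iO: "integrable lborel (indicator \<Omega> :: 'a \<Rightarrow> real)" using b by (intro integrable_real_indicator) auto
  have m: "(\<lambda>x. c - x \<bullet> e) \<in> borel_measurable borel" by measurable
  have int: "integrable lborel (\<lambda>x. indicator \<Omega> x * (c - x \<bullet> e))"
  proof (rule Bochner_Integration.integrable_bound)
    show "integrable lborel (\<lambda>x. (\<bar>c\<bar> + R) * indicator \<Omega> x)" using iO by simp
    show "(\<lambda>x. indicator \<Omega> x * (c - x \<bullet> e)) \<in> borel_measurable lborel" using b by measurable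
    show "AE x in lborel. norm (indicator \<Omega> x * (c - x \<bullet> e)) \<le> norm ((\<bar>c\<bar> + R) * indicator \<Omega> x)"
    proof (intro AE_I2)
      fix x
      have "x \<in> \<Omega> \<Longrightarrow> \<bar>c - x \<bullet> e\<bar> \<le> \<bar>c\<bar> + R"
        using Cauchy_Schwarz_ineq2[of x e] R[of x] e by auto
      then show "norm (indicator \<Omega> x * (c - x \<bullet> e)) \<le> norm ((\<bar>c\<bar> + R) * indicator \<Omega> x)"
        by (auto simp: indicator_def)
    qed
  qed
  note * = integral_antisymmetric[OF e b cap m _ int, simplified reflect_inner[OF e]]
  show "excess_moment e c \<Omega> = (LINT x|lborel. indicator \<Omega> x * (c - x \<bullet> e))"
    unfolding excess_moment_def by (rule *(1)[symmetric]) simp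
  show "integrable lborel (\<lambda>x. indicator (excess e c \<Omega>) x * (c - x \<bullet> e))"
    by (rule *(2)) simp
qed

text \<open>A point of the excess at distance \<open>r\<close> from \<open>a\<close> and
  \<open>r'\<close> from its mirror image has
  \<open>r - r' \<ge> 2 * (c - x \<bullet> e) * t / r\<close> by
  \<open>norm_diff_reflect_square\<close>; the mean value theorem multiplies this by
  \<open>\<beta> * r powr (- \<beta> - 1)\<close>, and \<open>r \<le> D\<close> produces
  \<open>c0\<close>. The subtracted term pays for excess points inside the truncation ball of the
  mirror image, where the larger of the two kernels has been cut off.\<close>

lemma outer_potential_reflect_ge:
  fixes \<Omega> :: "'a::euclidean_space set"
  assumes e: "norm e = 1" and \<Omega>: "open \<Omega>" "bounded \<Omega>" and cap: "cap_reflects_into e c \<Omega>"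
    and \<beta>: "real (DIM('a)) < \<beta>"
    and D: "\<And>x. x \<in> \<Omega> \<Longrightarrow> norm (x - a) \<le> D"
    and \<rho>: "0 < \<rho>" "\<rho> \<le> a \<bullet> e - c"
  defines "t \<equiv> a \<bullet> e - c" and "c0 \<equiv> 2 * \<beta> * D powr (- \<beta> - 2)"
  shows "outer_potential \<beta> \<Omega> (reflect e c a) \<rho> - outer_potential \<beta> \<Omega> a \<rho>
    \<ge> c0 * t * excess_moment e c \<Omega>
      - (c0 * t * D + t powr - \<beta>) * measure lborel (excess e c \<Omega> \<inter> ball (reflect e c a) \<rho>)"
proof -
  have t: "0 < t" using \<rho> by (simp add: t_def)
  have \<beta>0: "0 < \<beta>" using \<beta> by (smt (verit) of_nat_0_le_iff)
  have b: "\<Omega> \<in> sets borel" using \<Omega> by simp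
  define a' where "a' = reflect e c a"
  define G where "G = excess e c \<Omega>"
  have G: "G \<in> sets borel" unfolding G_def using e b by (rule borel_excess)
  define h where "h x = cut_kernel \<beta> \<rho> (x - a') - cut_kernel \<beta> \<rho> (x - a)" for x
  have hm: "h \<in> borel_measurable borel" unfolding h_def by measurable
  have hodd: "h (reflect e c x) = - h x" for x
  proof -
    have "norm (reflect e c x - a') = norm (x - a)" unfolding a'_def by (rule norm_reflect_diff[OF e])
    moreover have "norm (reflect e c x - a) = norm (x - a')" unfolding a'_def by (rule norm_diff_reflect[OF e, symmetric])
    ultimately show ?thesis unfolding h_def by (metis cut_kernel_cong_norm minus_diff_eq)
  qed
  have i: "integrable lborel (\<lambda>x. indicator \<Omega> x * cut_kernel \<beta> \<rho> (x - q))" for q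
  proof -
    have m: "(\<lambda>x. indicator \<Omega> x * cut_kernel \<beta> \<rho> (x - q) :: real) \<in> borel_measurable borel"
      using b by measurable
    have "integrable lborel (\<lambda>y. indicator \<Omega> (q + y) * cut_kernel \<beta> \<rho> y)"
      by (rule integrable_cut_kernel_mult[OF \<rho>(1) \<beta>, where B=1]; use borel_indicator_shift[OF b] in \<open>auto simp: indicator_def\<close>)
    then show ?thesis using integrable_orthogonal[OF orthogonal_transformation_id m, of q] by simp
  qed
  have ih: "integrable lborel (\<lambda>x. indicator \<Omega> x * h x)"
    unfolding h_def using i[of a'] i[of a] by (simp add: right_diff_distrib)
  have "outer_potential \<beta> \<Omega> a' \<rho> - outer_potential \<beta> \<Omega> a \<rho> = (LINT x|lborel. indicator \<Omega> x * h x)"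
    unfolding outer_potential_eq[OF b] h_def using i[of a'] i[of a] by (simp add: right_diff_distrib)
  also have "\<dots> = (LINT x|lborel. indicator G x * h x)"
    unfolding G_def by (rule integral_antisymmetric(1)[OF e b cap hm hodd ih])
  also have "\<dots> \<ge> (LINT x|lborel. c0 * t * (indicator G x * (c - x \<bullet> e)) - (c0 * t * D + t powr - \<beta>) * indicator (G \<inter> ball a' \<rho>) x)"
  proof (rule integral_mono)
    have fm: "G \<inter> ball a' \<rho> \<in> fmeasurable lborel" using G by (intro fmeasurable_subset_ball) auto
    have "integrable lborel (indicator (G \<inter> ball a' \<rho>) :: 'a \<Rightarrow> real)"
      using fm by (intro integrable_real_indicator) (auto dest: fmeasurableD fmeasurableD2 simp: less_top)
    then show "integrable lborel (\<lambda>x. c0 * t * (indicator G x * (c - x \<bullet> e)) - (c0 * t * D + t powr - \<beta>) * indicator (G \<inter> ball a' \<rho>) x)"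
      using integrable_excess_moment[OF e \<Omega> cap] by (simp add: G_def)
    show "integrable lborel (\<lambda>x. indicator G x * h x)"
      unfolding G_def by (rule integral_antisymmetric(2)[OF e b cap hm hodd ih])
    show "c0 * t * (indicator G x * (c - x \<bullet> e)) - (c0 * t * D + t powr - \<beta>) * indicator (G \<inter> ball a' \<rho>) x \<le> indicator G x * h x" for x
    proof (cases "x \<in> G")
      case True
      then have x: "x \<in> \<Omega>" "x \<bullet> e < c" by (auto simp: G_def excess_def)
      define r r' where "r = norm (x - a)" and "r' = norm (x - a')"
      have "\<bar>(x - a) \<bullet> e\<bar> \<le> r" using Cauchy_Schwarz_ineq2[of "x - a" e] e by (simp add: r_def)
      then have rt: "t + (c - x \<bullet> e) \<le> r" by (simp add: t_def inner_diff_left)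
      have rD: "r \<le> D" using D x by (simp add: r_def)
      \<comment> \<open>The excess is below the plane and \<open>a\<close> is at height
        \<open>t \<ge> \<rho>\<close> above it, so the truncation around \<open>a\<close> itself
        never interferes.\<close>
      have r0: "0 < r" "t \<le> r" "\<rho> \<le> r" using rt t x \<rho> by (auto simp: t_def)
      have c0: "0 \<le> c0" using \<beta>0 by (simp add: c0_def)
      show ?thesis
      proof (cases "r' < \<rho>")
        case inb: True
        then have "h x = - (r powr - \<beta>)" using r0 by (simp add: h_def cut_kernel_eq_0 cut_kernel_eq r_def r'_def)
        moreover have "r powr - \<beta> \<le> t powr - \<beta>" using r0 t \<beta>0 by (intro powr_mono2') auto
        moreover have "c0 * t * (c - x \<bullet> e) \<le> c0 * t * D" using rt rD t c0 by (intro mult_left_mono) auto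
        ultimately show ?thesis using True inb by (simp add: r'_def dist_norm norm_minus_commute)
      next
        case False
        have sq: "r\<^sup>2 - r'\<^sup>2 = 4 * (c - x \<bullet> e) * t"
          unfolding r_def r'_def a'_def t_def by (rule norm_diff_reflect_square[OF e])
        have "r'\<^sup>2 \<le> r\<^sup>2" using sq x t by (smt (verit) mult_pos_pos)
        then have r'r: "r' \<le> r" using r0 by (simp add: power2_le_iff_abs_le r'_def)
        have "4 * (c - x \<bullet> e) * t = (r - r') * (r + r')" unfolding sq[symmetric] by (simp add: power2_eq_square algebra_simps)
        also have "\<dots> \<le> (r - r') * (2 * r)" using r'r by (intro mult_left_mono) auto
        finally have d: "2 * (c - x \<bullet> e) * t / r \<le> r - r'" using r0 by (simp add: field_simps)
        have "D powr (- \<beta> - 2) \<le> r powr (- \<beta> - 2)" using rD r0 \<beta>0 by (intro powr_mono2') auto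
        then have "c0 * t * (c - x \<bullet> e) \<le> 2 * \<beta> * r powr (- \<beta> - 2) * t * (c - x \<bullet> e)"
          unfolding c0_def using \<beta>0 t x by (intro mult_right_mono mult_left_mono) auto
        also have "\<dots> = \<beta> * r powr (- \<beta> - 1) * (2 * (c - x \<bullet> e) * t / r)"
          using r0 by (simp add: powr_diff power2_eq_square powr_numeral)
        also have "\<dots> \<le> \<beta> * r powr (- \<beta> - 1) * (r - r')" using d \<beta>0 by (intro mult_left_mono) auto
        also have "\<dots> \<le> r' powr - \<beta> - r powr - \<beta>"
          using False \<rho> r'r \<beta>0 by (intro powr_neg_diff_bounds) auto
        also have "\<dots> = h x" using False r0 by (simp add: h_def cut_kernel_eq r_def r'_def)
        finally show ?thesis using True False by (simp add: r'_def dist_norm norm_minus_commute)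
      qed
    qed simp
  qed
  also have "(LINT x|lborel. c0 * t * (indicator G x * (c - x \<bullet> e)) - (c0 * t * D + t powr - \<beta>) * indicator (G \<inter> ball a' \<rho>) x)
     = c0 * t * excess_moment e c \<Omega> - (c0 * t * D + t powr - \<beta>) * measure lborel (G \<inter> ball a' \<rho>)"
  proof -
    have fm: "G \<inter> ball a' \<rho> \<in> fmeasurable lborel" using G by (intro fmeasurable_subset_ball) auto
    have "integrable lborel (indicator (G \<inter> ball a' \<rho>) :: 'a \<Rightarrow> real)"
      using fm by (intro integrable_real_indicator) (auto dest: fmeasurableD fmeasurableD2 simp: less_top)
    then show ?thesis
      using integrable_excess_moment[OF e \<Omega> cap] by (simp add: G_def excess_moment_def)
  qed
  finally show ?thesis by (simp add: G_def a'_def)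
qed

section \<open>Local description of the boundary\<close>

text \<open>Extends \<open>measure_disjoint_translates\<close> beyond \<open>0 < c \<le> r\<close>:
  for a thickness above \<open>r\<close> the volume of the ball suffices, and \<open>c = 0\<close>
  follows by letting a positive thickness shrink.\<close>

lemma measure_thin_set:
  fixes E :: "'a::euclidean_space set"
  assumes E: "E \<in> sets borel" "E \<subseteq> ball a r"
    and sec: "\<And>y s. y \<in> E \<Longrightarrow> y + s *\<^sub>R \<nu> \<in> E \<Longrightarrow> \<bar>s\<bar> \<le> c"
    and \<nu>: "norm \<nu> = 1" and c: "0 \<le> c" and r: "0 < r"
  shows "measure lborel E \<le> unit_ball_vol (DIM('a)) * 3 ^ DIM('a) * r ^ (DIM('a) - 1) * c"
proof -
  define v where "v = unit_ball_vol (DIM('a)) * 3 ^ DIM('a) * r ^ (DIM('a) - 1)"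
  have v: "0 \<le> v" using r by (simp add: v_def)
  have *: "measure lborel E \<le> v * c'" if c': "c \<le> c'" "0 < c'" for c'
  proof (cases "c' \<le> r")
    case True
    show ?thesis unfolding v_def
      by (rule measure_disjoint_translates[OF E _ \<nu> c'(2) True]) (use sec c' in force)
  next
    case False
    have "measure lborel E \<le> measure lborel (ball a r)"
      using E by (intro measure_mono_fmeasurable fmeasurable_ball) auto
    also have "\<dots> = unit_ball_vol (DIM('a)) * 1 * r ^ (DIM('a) - 1) * r"
    proof -
      have "r ^ DIM('a) = r ^ (DIM('a) - 1) * r" by (metis DIM_positive Suc_pred' power_Suc2)
      then show ?thesis using r by (simp add: content_ball)
    qed
    also have "\<dots> \<le> unit_ball_vol (DIM('a)) * 3 ^ DIM('a) * r ^ (DIM('a) - 1) * c'"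
      using False r by (intro mult_mono mult_nonneg_nonneg zero_le_power one_le_power unit_ball_vol_nonneg) simp_all
    finally show ?thesis by (simp add: v_def)
  qed
  have "measure lborel E \<le> v * c + z" if z: "0 < z" for z
  proof -
    have "measure lborel E \<le> v * (c + z / (v + 1))" using z v c by (intro *) (auto intro!: add_nonneg_pos)
    also have "\<dots> \<le> v * c + z" using v z by (simp add: field_simps)
    finally show ?thesis .
  qed
  then have "measure lborel E \<le> v * c" by (rule field_le_epsilon)
  then show ?thesis by (simp only: v_def)
qed

text \<open>The norm of a matrix is here the Euclidean norm of its entries, so the estimate is
  Cauchy-Schwarz in each row.\<close>

lemma norm_matrix_vector_mult_le:
  fixes M :: "real^'n^'m"
  shows "norm (M *v v) \<le> norm M * norm v"
proof -
  have "(norm (M *v v))\<^sup>2 = (\<Sum>i\<in>UNIV. ((M $ i) \<bullet> v)\<^sup>2)"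
    by (simp add: norm_vec_def L2_set_def sum_nonneg matrix_vector_mul_component)
  also have "\<dots> \<le> (\<Sum>i\<in>UNIV. (norm (M $ i))\<^sup>2 * (norm v)\<^sup>2)"
  proof (intro sum_mono)
    fix i
    have "\<bar>(M $ i) \<bullet> v\<bar> \<le> norm (M $ i) * norm v" by (rule Cauchy_Schwarz_ineq2)
    then have "\<bar>(M $ i) \<bullet> v\<bar>\<^sup>2 \<le> (norm (M $ i) * norm v)\<^sup>2" by (intro power_mono) auto
    then show "((M $ i) \<bullet> v)\<^sup>2 \<le> (norm (M $ i))\<^sup>2 * (norm v)\<^sup>2" by (simp add: power_mult_distrib)
  qed
  also have "\<dots> = (norm M * norm v)\<^sup>2"
    by (simp add: norm_vec_def[of M] L2_set_def sum_nonneg power_mult_distrib sum_distrib_right)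
  finally show ?thesis by (rule power2_le_imp_le) simp
qed

text \<open>The graph is encoded by a defining function \<open>g\<close>, the signed height over it
  in direction \<nu>, with gradient \<open>G\<close> and Hessian \<open>A\<close>. The normalization
  \<open>g_shift\<close> gives slope exactly 1 along \<nu>; it yields both
  \<open>1 \<le> norm (G x)\<close> and the thinness of the slabs where \<open>g\<close> is small.
  The bound \<open>\<alpha> \<le> 1\<close> lets Lipschitz errors be absorbed into Hoelder errors at
  distances up to 1.\<close>

locale C2_graph =
  fixes \<Omega> :: "(real^'n) set" and p :: "real^'n" and r :: real and \<nu> :: "real^'n"
    and g :: "real^'n \<Rightarrow> real" and G :: "real^'n \<Rightarrow> real^'n" and A :: "real^'n \<Rightarrow> real^'n^'n"
    and K \<alpha> :: real
  assumes \<Omega>_open: "open \<Omega>" and r_pos: "0 < r" and norm_\<nu>: "norm \<nu> = 1"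
    and mem_iff: "\<And>x. x \<in> ball p r \<Longrightarrow> x \<in> \<Omega> \<longleftrightarrow> g x < 0"
    and g_shift: "\<And>x s. g (x + s *\<^sub>R \<nu>) = g x + s"
    and deriv_g: "\<And>x. x \<in> ball p r \<Longrightarrow> (g has_derivative (\<lambda>h. G x \<bullet> h)) (at x)"
    and deriv_G: "\<And>x. x \<in> ball p r \<Longrightarrow> (G has_derivative (\<lambda>h. A x *v h)) (at x)"
    and Hoelder: "\<And>x y. x \<in> ball p r \<Longrightarrow> y \<in> ball p r \<Longrightarrow> norm (A x - A y) \<le> K * norm (x - y) powr \<alpha>"
    and K: "0 \<le> K" and \<alpha>: "0 < \<alpha>" "\<alpha> \<le> 1"
begin

definition MA :: real where "MA = norm (A p) + K * r powr \<alpha>"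

lemma MA_nonneg: "0 \<le> MA" using K by (simp add: MA_def)

lemma A_bound: "x \<in> ball p r \<Longrightarrow> norm (A x) \<le> MA"
proof -
  assume x: "x \<in> ball p r"
  have "norm (A x) \<le> norm (A p) + norm (A x - A p)" using norm_triangle_ineq[of "A p" "A x - A p"] by simp
  also have "norm (A x - A p) \<le> K * norm (x - p) powr \<alpha>" using Hoelder x r_pos by simp
  also have "\<dots> \<le> K * r powr \<alpha>" using x K \<alpha>
    by (intro mult_left_mono powr_mono2) (auto simp: dist_norm norm_minus_commute)
  finally show ?thesis by (simp add: MA_def)
qed

lemma G_\<nu>: "x \<in> ball p r \<Longrightarrow> G x \<bullet> \<nu> = 1"
proof -
  assume x: "x \<in> ball p r"
  have "((\<lambda>s. g (x + s *\<^sub>R \<nu>)) has_derivative (\<lambda>h. G x \<bullet> (h *\<^sub>R \<nu>))) (at 0)"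
    by (rule has_derivative_compose[where g=g]) (use deriv_g[OF x] in \<open>auto intro!: derivative_eq_intros\<close>)
  then have "((\<lambda>s. g x + s) has_derivative (\<lambda>h. G x \<bullet> (h *\<^sub>R \<nu>))) (at (0::real))" by (simp add: g_shift)
  moreover have "((\<lambda>s. g x + s) has_derivative (\<lambda>h. h)) (at (0::real))" by (auto intro!: derivative_eq_intros)
  ultimately have "(\<lambda>h. G x \<bullet> (h *\<^sub>R \<nu>)) = (\<lambda>h::real. h)" by (rule has_derivative_unique)
  from fun_cong[OF this, of 1] show ?thesis by simp
qed

lemma norm_G_ge: "x \<in> ball p r \<Longrightarrow> 1 \<le> norm (G x)"
  using G_\<nu>[of x] Cauchy_Schwarz_ineq2[of "G x" \<nu>] norm_\<nu> by simp

lemma G_Lipschitz: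
  assumes "x \<in> ball p r" "y \<in> ball p r"
  shows "norm (G x - G y) \<le> MA * norm (x - y)"
proof (rule differentiable_bound[OF convex_ball[of p r] _ _ assms])
  fix z assume z: "z \<in> ball p r"
  show "(G has_derivative (\<lambda>h. A z *v h)) (at z within ball p r)"
    using deriv_G[OF z] by (rule has_derivative_at_withinI)
  show "onorm (\<lambda>h. A z *v h) \<le> MA"
  proof (rule onorm_le)
    fix h show "norm (A z *v h) \<le> MA * norm h"
      using norm_matrix_vector_mult_le[of "A z" h] A_bound[OF z] by (meson mult_right_mono norm_ge_zero order_trans)
  qed
qed

lemma norm_G_le: "x \<in> ball p r \<Longrightarrow> norm (G x) \<le> norm (G p) + MA * r"
proof -
  assume x: "x \<in> ball p r"
  have "norm (G x) \<le> norm (G p) + norm (G x - G p)" using norm_triangle_ineq[of "G p" "G x - G p"] by simp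
  also have "norm (G x - G p) \<le> MA * norm (x - p)" using G_Lipschitz x r_pos by simp
  also have "\<dots> \<le> MA * r" using x MA_nonneg by (intro mult_left_mono) (auto simp: dist_norm norm_minus_commute)
  finally show ?thesis by simp
qed

lemma taylor_G:
  assumes x: "x \<in> ball p r" "x + y \<in> ball p r"
  shows "norm (G (x + y) - G x - A x *v y) \<le> K * norm y powr \<alpha> * norm y"
proof -
  define f where "f z = G z - A x *v z" for z
  have seg: "closed_segment x (x + y) \<subseteq> ball p r" using x by (simp add: closed_segment_subset)
  have "norm (f (x + y) - f x) \<le> K * norm y powr \<alpha> * norm (x + y - x)"
  proof (rule differentiable_bound[OF convex_closed_segment[of x "x + y"]])
    fix z assume z: "z \<in> closed_segment x (x + y)"
    then have zb: "z \<in> ball p r" using seg by blast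
    have zx: "norm (z - x) \<le> norm y" using segment_bound(1)[OF z] by simp
    have "(f has_derivative (\<lambda>h. A z *v h - A x *v h)) (at z)"
      unfolding f_def using deriv_G[OF zb]
      by (intro has_derivative_diff bounded_linear.has_derivative[OF matrix_vector_mul_bounded_linear]) auto
    then show "(f has_derivative (\<lambda>h. A z *v h - A x *v h)) (at z within closed_segment x (x + y))"
      by (rule has_derivative_at_withinI)
    show "onorm (\<lambda>h. A z *v h - A x *v h) \<le> K * norm y powr \<alpha>"
    proof (rule onorm_le)
      fix h
      have "norm (A z *v h - A x *v h) \<le> norm (A z - A x) * norm h"
        using norm_matrix_vector_mult_le[of "A z - A x" h] by (simp add: matrix_vector_mult_diff_rdistrib)
      also have "\<dots> \<le> K * norm (z - x) powr \<alpha> * norm h" using Hoelder[OF zb x(1)] by (intro mult_right_mono) auto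
      also have "\<dots> \<le> K * norm y powr \<alpha> * norm h" using zx K \<alpha>
        by (intro mult_right_mono mult_left_mono powr_mono2) auto
      finally show "norm (A z *v h - A x *v h) \<le> K * norm y powr \<alpha> * norm h" .
    qed
  qed auto
  then show ?thesis by (simp add: f_def matrix_vector_right_distrib algebra_simps)
qed

definition quad :: "real^'n \<Rightarrow> real^'n \<Rightarrow> real" where
  "quad x y = (A x *v y) \<bullet> y / 2"

lemma quad_bound: "x \<in> ball p r \<Longrightarrow> \<bar>quad x y\<bar> \<le> MA / 2 * (norm y)\<^sup>2"
proof -
  assume x: "x \<in> ball p r"
  have "\<bar>(A x *v y) \<bullet> y\<bar> \<le> norm (A x *v y) * norm y" by (rule Cauchy_Schwarz_ineq2)
  also have "\<dots> \<le> norm (A x) * norm y * norm y" by (intro mult_right_mono norm_matrix_vector_mult_le) auto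
  also have "\<dots> \<le> MA * norm y * norm y" using A_bound[OF x] by (intro mult_right_mono) auto
  finally show ?thesis by (simp add: quad_def power2_eq_square)
qed

text \<open>Mean value inequality along the segment for \<open>g\<close> minus its second order
  polynomial; the derivative of that difference is the remainder of \<open>taylor_G\<close> paired
  with \<open>y\<close>. Only the order \<open>2 + \<alpha>\<close> of the remainder matters later,
  not its constant.\<close>

lemma taylor:
  assumes x: "x \<in> ball p r" "x + y \<in> ball p r"
  shows "\<bar>g (x + y) - g x - G x \<bullet> y - quad x y\<bar> \<le> K * norm y powr \<alpha> * (norm y)\<^sup>2"
proof -
  define f where "f t = g (x + t *\<^sub>R y) - t * (G x \<bullet> y) - t\<^sup>2 * quad x y" for t :: real
  have seg: "x + t *\<^sub>R y \<in> ball p r" if "t \<in> {0..1}" for t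
  proof -
    have "closed_segment x (x + y) \<subseteq> ball p r" using x by (simp add: closed_segment_subset)
    moreover have "x + t *\<^sub>R y \<in> closed_segment x (x + y)"
      using that by (auto simp: in_segment algebra_simps intro!: exI[of _ t])
    ultimately show ?thesis by blast
  qed
  have "norm (f 1 - f 0) \<le> K * norm y powr \<alpha> * (norm y)\<^sup>2 * norm (1 - 0::real)"
  proof (rule differentiable_bound[of "{0..1}"])
    fix t :: real assume t: "t \<in> {0..1}"
    have d1: "((\<lambda>t. g (x + t *\<^sub>R y)) has_derivative (\<lambda>h. G (x + t *\<^sub>R y) \<bullet> (h *\<^sub>R y))) (at t)"
      by (rule has_derivative_compose[where g=g]) (use deriv_g[OF seg[OF t]] in \<open>auto intro!: derivative_eq_intros\<close>)
    have d2: "((\<lambda>t. t * (G x \<bullet> y)) has_derivative (\<lambda>h. h * (G x \<bullet> y))) (at t)"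
      "((\<lambda>t. t\<^sup>2 * quad x y) has_derivative (\<lambda>h. h * (2 * t * quad x y))) (at t)"
      by (auto intro!: derivative_eq_intros)
    have "(\<lambda>h. G (x + t *\<^sub>R y) \<bullet> (h *\<^sub>R y) - h * (G x \<bullet> y) - h * (2 * t * quad x y))
        = (\<lambda>h. h * ((G (x + t *\<^sub>R y) - G x - A x *v (t *\<^sub>R y)) \<bullet> y))"
      by (rule ext) (simp add: quad_def inner_diff_left matrix_vector_mult_scaleR algebra_simps)
    then have "(f has_derivative (\<lambda>h. h * ((G (x + t *\<^sub>R y) - G x - A x *v (t *\<^sub>R y)) \<bullet> y))) (at t)"
      using has_derivative_diff[OF has_derivative_diff[OF d1 d2(1)] d2(2)] by (simp add: f_def[abs_def])
    then show "(f has_derivative (\<lambda>h. h * ((G (x + t *\<^sub>R y) - G x - A x *v (t *\<^sub>R y)) \<bullet> y))) (at t within {0..1})"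
      by (rule has_derivative_at_withinI)
    show "onorm (\<lambda>h. h * ((G (x + t *\<^sub>R y) - G x - A x *v (t *\<^sub>R y)) \<bullet> y)) \<le> K * norm y powr \<alpha> * (norm y)\<^sup>2"
    proof (rule onorm_le)
      fix h :: real
      have ty: "norm (t *\<^sub>R y) \<le> norm y" using t by (simp add: mult_left_le_one_le)
      have "\<bar>(G (x + t *\<^sub>R y) - G x - A x *v (t *\<^sub>R y)) \<bullet> y\<bar> \<le> norm (G (x + t *\<^sub>R y) - G x - A x *v (t *\<^sub>R y)) * norm y"
        by (rule Cauchy_Schwarz_ineq2)
      also have "\<dots> \<le> (K * norm (t *\<^sub>R y) powr \<alpha> * norm (t *\<^sub>R y)) * norm y"
        by (intro mult_right_mono taylor_G x seg t) auto
      also have "\<dots> \<le> (K * norm y powr \<alpha> * norm y) * norm y"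
        using ty K \<alpha> by (intro mult_right_mono mult_mono mult_left_mono powr_mono2) auto
      finally have "\<bar>h\<bar> * \<bar>(G (x + t *\<^sub>R y) - G x - A x *v (t *\<^sub>R y)) \<bullet> y\<bar> \<le> \<bar>h\<bar> * (K * norm y powr \<alpha> * norm y * norm y)"
        by (rule mult_left_mono) simp
      then show "norm (h * ((G (x + t *\<^sub>R y) - G x - A x *v (t *\<^sub>R y)) \<bullet> y)) \<le> K * norm y powr \<alpha> * (norm y)\<^sup>2 * norm h"
        by (simp add: abs_mult power2_eq_square mult_ac)
    qed
  qed auto
  then show ?thesis by (simp add: f_def)
qed

lemma continuous_on_g: "continuous_on (ball p r) g"
  by (meson deriv_g has_derivative_continuous continuous_at_imp_continuous_on)

text \<open>A zero of \<open>g\<close> is approached by points of \<Omega> along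
  \<open>- \<nu>\<close>, where \<open>g\<close> becomes negative; a positive value of
  \<open>g\<close> persists in a neighbourhood.\<close>

lemma frontier_iff:
  assumes x: "x \<in> ball p r"
  shows "x \<in> frontier \<Omega> \<longleftrightarrow> g x = 0"
proof
  assume fr: "x \<in> frontier \<Omega>"
  then have "x \<notin> \<Omega>" using \<Omega>_open by (simp add: frontier_def interior_open)
  then have "\<not> g x < 0" using mem_iff[OF x] by simp
  moreover have "\<not> 0 < g x"
  proof
    assume "0 < g x"
    have "open (ball p r \<inter> g -` {0<..})"
      by (rule continuous_open_preimage[OF continuous_on_g]) auto
    moreover have "x \<in> ball p r \<inter> g -` {0<..}" using x \<open>0 < g x\<close> by simp
    moreover have "(ball p r \<inter> g -` {0<..}) \<inter> \<Omega> = {}" using mem_iff by force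
    ultimately have "x \<notin> closure \<Omega>" by (meson open_Int_closure_eq_empty disjoint_iff)
    then show False using fr by (simp add: frontier_def)
  qed
  ultimately show "g x = 0" by linarith
next
  assume g0: "g x = 0"
  have "x \<notin> \<Omega>" using mem_iff[OF x] g0 by simp
  moreover have "x \<in> closure \<Omega>"
    unfolding closure_approachable
  proof (intro allI impI)
    fix e :: real assume e: "0 < e"
    obtain d where d: "0 < d" "ball x d \<subseteq> ball p r" using x open_ball openE by blast
    define s where "s = min e d / 2"
    have s: "0 < s" "s < e" "s < d" using e d by (auto simp: s_def)
    have "x + (- s) *\<^sub>R \<nu> \<in> ball x d" using s norm_\<nu> by (simp add: dist_norm)
    then have "x + (- s) *\<^sub>R \<nu> \<in> ball p r" using d by blast
    then have "x + (- s) *\<^sub>R \<nu> \<in> \<Omega>" using mem_iff g_shift[of x "- s"] g0 s by simp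
    moreover have "dist (x + (- s) *\<^sub>R \<nu>) x < e" using s norm_\<nu> by (simp add: dist_norm)
    ultimately show "\<exists>y\<in>\<Omega>. dist y x < e" by blast
  qed
  ultimately show "x \<in> frontier \<Omega>" using \<Omega>_open by (simp add: frontier_def interior_open)
qed

definition slab_const :: real where "slab_const = 2 * unit_ball_vol CARD('n) * 3 ^ CARD('n)"

lemma slab_const_nonneg: "0 \<le> slab_const" by (simp add: slab_const_def)

text \<open>Along a line parallel to \<nu> the value of \<open>g\<close> moves with unit speed, so
  the line meets the slab in a set of diameter at most \<open>2 * c\<close>; hence the 2 in
  \<open>slab_const\<close>. The offset \<open>q\<close> allows \<open>E\<close> to be given in
  coordinates centred at a boundary point.\<close>

lemma measure_slab_le:
  assumes E: "E \<in> sets borel" "E \<subseteq> ball a d" and g: "\<And>x. x \<in> E \<Longrightarrow> \<bar>g (q + x)\<bar> \<le> c"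
    and c: "0 \<le> c" and d: "0 < d"
  shows "measure lborel E \<le> slab_const * d ^ (CARD('n) - 1) * c"
proof -
  have "measure lborel E \<le> unit_ball_vol DIM(real^'n) * 3 ^ DIM(real^'n) * d ^ (DIM(real^'n) - 1) * (2 * c)"
  proof (rule measure_thin_set[OF E _ norm_\<nu>])
    fix y s assume y: "y \<in> E" "y + s *\<^sub>R \<nu> \<in> E"
    then have "\<bar>g (q + y)\<bar> \<le> c" "\<bar>g (q + y) + s\<bar> \<le> c"
      using g[of y] g[of "y + s *\<^sub>R \<nu>"] g_shift[of "q + y" s] by (auto simp: add.assoc)
    then show "\<bar>s\<bar> \<le> 2 * c" by linarith
  qed (use c d in auto)
  then show ?thesis by (simp add: slab_const_def mult_ac)
qed

text \<open>The values \<open>g (p + y)\<close> and \<open>g (p - y)\<close> have opposite linear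
  parts. If both points lie in \<Omega> or both outside, the values have the same sign, and their
  sum, which is quadratic in \<open>y\<close>, bounds each of them. So the bad set within radius
  \<open>d\<close> has thickness of order \<open>d ^ 2\<close> and measure of order
  \<open>d ^ (n + 1)\<close>.\<close>

lemma principal_value_converges_center:
  assumes p0: "g p = 0" and \<beta>: "real CARD('n) < \<beta>" "\<beta> < real (CARD('n) + 1)"
  shows "\<exists>l. ((\<lambda>\<epsilon>. outer_potential \<beta> \<Omega> p \<epsilon> - (LINT y|lborel. cut_kernel \<beta> \<epsilon> (y::real^'n)) / 2) \<longlongrightarrow> l) (at_right 0)"
proof -
  \<comment> \<open>Hessian bound plus Taylor remainder, once for \<open>y\<close> and once for
    \<open>- y\<close>.\<close>
  define C where "C = 2 * (MA / 2 + K * r powr \<alpha>)"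
  have C: "0 \<le> C" using MA_nonneg K by (simp add: C_def)
  have b: "\<Omega> \<in> sets borel" using \<Omega>_open by simp
  have key: "\<bar>g (p + y)\<bar> \<le> C * (norm y)\<^sup>2" if y: "norm y < r" "p + y \<in> \<Omega> \<longleftrightarrow> p - y \<in> \<Omega>" for y
  proof -
    have in_b: "p + y \<in> ball p r" "p + - y \<in> ball p r" using y by (auto simp: dist_norm)
    have le: "K * norm y powr \<alpha> * (norm y)\<^sup>2 \<le> K * r powr \<alpha> * (norm y)\<^sup>2"
      using y K \<alpha> by (intro mult_right_mono mult_left_mono powr_mono2) auto
    have pb: "p \<in> ball p r" using r_pos by simp
    have C2: "C / 2 * (norm y)\<^sup>2 = MA / 2 * (norm y)\<^sup>2 + K * r powr \<alpha> * (norm y)\<^sup>2"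
      by (simp add: C_def algebra_simps)
    have "\<bar>g (p + y) - G p \<bullet> y\<bar> \<le> C / 2 * (norm y)\<^sup>2"
      using taylor[OF pb in_b(1)] le quad_bound[OF pb, of y] p0 C2 by linarith
    moreover have "\<bar>g (p - y) + G p \<bullet> y\<bar> \<le> C / 2 * (norm y)\<^sup>2"
    proof -
      have "\<bar>g (p - y) + G p \<bullet> y - quad p (- y)\<bar> \<le> K * norm y powr \<alpha> * (norm y)\<^sup>2"
        using taylor[OF pb in_b(2)] p0 by simp
      moreover have "\<bar>quad p (- y)\<bar> \<le> MA / 2 * (norm y)\<^sup>2" using quad_bound[OF pb, of "- y"] by simp
      ultimately show ?thesis using le C2 by linarith
    qed
    moreover have "(g (p + y) < 0) \<longleftrightarrow> (g (p - y) < 0)"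
      using mem_iff[OF in_b(1)] mem_iff[OF in_b(2)] y(2) by simp
    ultimately show ?thesis by linarith
  qed
  show ?thesis
  proof (rule principal_value_converges[OF b r_pos, where M="slab_const * C"])
    show "0 \<le> slab_const * C" using C slab_const_nonneg by simp
    fix d :: real assume d: "0 < d" "d \<le> r"
    define E where "E = {y \<in> ball 0 r. p + y \<in> \<Omega> \<longleftrightarrow> p - y \<in> \<Omega>} \<inter> ball 0 d"
    have Em: "E \<in> sets borel"
      unfolding E_def by (intro sets.Int borel_sets_coincidence) (use b in auto)
    have "measure lborel E \<le> slab_const * d ^ (CARD('n) - 1) * (C * d\<^sup>2)"
    proof (rule measure_slab_le[where q=p and a=0, OF Em])
      show "\<bar>g (p + x)\<bar> \<le> C * d\<^sup>2" if "x \<in> E" for x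
      proof -
        have "\<bar>g (p + x)\<bar> \<le> C * (norm x)\<^sup>2" using that by (intro key) (auto simp: E_def)
        also have "\<dots> \<le> C * d\<^sup>2" using that C by (intro mult_left_mono power_mono) (auto simp: E_def)
        finally show ?thesis .
      qed
    qed (use C d in \<open>auto simp: E_def\<close>)
    also have "\<dots> = slab_const * C * d ^ (DIM(real^'n) + 1)"
    proof -
      have "d ^ (CARD('n) - 1) * d\<^sup>2 = d ^ (CARD('n) - 1 + 2)" by (rule power_add[symmetric])
      also have "CARD('n) - 1 + 2 = CARD('n) + 1" using zero_less_card_finite[where 'a='n] by linarith
      finally show ?thesis by (simp add: mult_ac)
    qed
    finally show "measure lborel ({y \<in> ball 0 r. p + y \<in> \<Omega> \<longleftrightarrow> p - y \<in> \<Omega>} \<inter> ball 0 d) \<le> slab_const * C * d ^ (DIM(real^'n) + 1)"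
      by (simp add: E_def)
  qed (use \<beta> in auto)
qed

end

lemma C2_graph_exists:
  fixes \<Omega> :: "(real^'n) set"
  assumes \<Omega>: "open \<Omega>" "C2_Hoelder_boundary \<alpha> \<Omega>" "0 < \<alpha>" "\<alpha> \<le> 1" and p: "p \<in> frontier \<Omega>"
  obtains r \<nu> g G A K where "C2_graph \<Omega> p r \<nu> g G A K \<alpha>"
proof -
  obtain r \<nu> \<phi> where r: "0 < r" "norm \<nu> = 1"
    and C2: "C2_Hoelder_on \<alpha> (ball p r) (\<lambda>x. \<phi> (x - (x \<bullet> \<nu>) *\<^sub>R \<nu>))"
    and eq: "\<Omega> \<inter> ball p r = {x \<in> ball p r. x \<bullet> \<nu> < \<phi> (x - (x \<bullet> \<nu>) *\<^sub>R \<nu>)}"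
    using \<Omega>(2) p unfolding C2_Hoelder_boundary_def by blast
  define f where "f x = \<phi> (x - (x \<bullet> \<nu>) *\<^sub>R \<nu>)" for x
  obtain G A K where d: "\<And>x. x \<in> ball p r \<Longrightarrow> (f has_derivative (\<lambda>h. G x \<bullet> h)) (at x)"
      "\<And>x. x \<in> ball p r \<Longrightarrow> (G has_derivative (\<lambda>h. A x *v h)) (at x)"
      "\<And>x y. x \<in> ball p r \<Longrightarrow> y \<in> ball p r \<Longrightarrow> norm (A x - A y) \<le> K * norm (x - y) powr \<alpha>"
    using C2 unfolding C2_Hoelder_on_def f_def[abs_def] by blast
  define g where "g x = x \<bullet> \<nu> - f x" for x
  \<comment> \<open>The definition of the boundary class puts no sign on the Hoelder constant; the
    absolute value supplies \<open>0 \<le> K\<close>.\<close>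
  have "C2_graph \<Omega> p r \<nu> g (\<lambda>x. \<nu> - G x) (\<lambda>x. - A x) \<bar>K\<bar> \<alpha>"
  proof
    show "x \<in> \<Omega> \<longleftrightarrow> g x < 0" if "x \<in> ball p r" for x
      using eq[THEN eqset_imp_iff, of x] that by (simp add: g_def f_def)
    show "g (x + s *\<^sub>R \<nu>) = g x + s" for x s
    proof -
      have "\<nu> \<bullet> \<nu> = 1" using r by (simp add: dot_square_norm)
      then show ?thesis by (simp add: g_def f_def inner_add_left algebra_simps)
    qed
    show "(g has_derivative (\<lambda>h. (\<nu> - G x) \<bullet> h)) (at x)" if "x \<in> ball p r" for x
    proof -
      have "((\<lambda>x. x \<bullet> \<nu> - f x) has_derivative (\<lambda>h. h \<bullet> \<nu> - G x \<bullet> h)) (at x)"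
        by (intro has_derivative_diff d(1)[OF that] bounded_linear_imp_has_derivative bounded_linear_inner_left)
      moreover have "(\<lambda>h. h \<bullet> \<nu> - G x \<bullet> h) = (\<lambda>h. (\<nu> - G x) \<bullet> h)"
        by (rule ext) (metis inner_commute inner_diff_left)
      ultimately show ?thesis by (simp add: g_def[abs_def])
    qed
    show "((\<lambda>x. \<nu> - G x) has_derivative (\<lambda>h. - A x *v h)) (at x)" if "x \<in> ball p r" for x
      by (rule has_derivative_eq_rhs, rule has_derivative_diff, rule has_derivative_const, rule d(2)[OF that])
         (auto simp: matrix_vector_mult_def sum_negf vec_eq_iff)
    show "norm (- A x - - A y) \<le> \<bar>K\<bar> * norm (x - y) powr \<alpha>" if "x \<in> ball p r" "y \<in> ball p r" for x y
    proof -
      have "norm (- A x - - A y) = norm (A x - A y)" by (simp add: norm_minus_commute)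
      also have "\<dots> \<le> K * norm (x - y) powr \<alpha>" by (rule d(3)[OF that])
      also have "\<dots> \<le> \<bar>K\<bar> * norm (x - y) powr \<alpha>" by (intro mult_right_mono) auto
      finally show ?thesis .
    qed
  qed (use \<Omega> r in auto)
  then show ?thesis by (rule that)
qed

section \<open>Nonlocal mean curvature and potentials\<close>

lemma sphere_area_pos: "0 < sphere_area d"
  by (simp add: sphere_area_def)

text \<open>Off the truncation ball the numerator is \<open>1 - 2 * indicator \<Omega>\<close>, so
  the truncated integral is -2 times the regularized potential. Convergence is assumed because
  \<open>Lim\<close> carries information only when the limit exists.\<close>

lemma nonlocal_mean_curvature_eq:
  fixes \<Omega> :: "(real^'n) set"
  assumes \<Omega>: "\<Omega> \<in> sets borel" and s: "0 < s" and \<beta>: "\<beta> = real CARD('n) + 2 * s"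
    and lim: "((\<lambda>\<epsilon>. outer_potential \<beta> \<Omega> p \<epsilon> - (LINT y|lborel. cut_kernel \<beta> \<epsilon> (y::real^'n)) / 2) \<longlongrightarrow> l) (at_right 0)"
  shows "nonlocal_mean_curvature s \<Omega> p = - 2 * l / sphere_area (CARD('n) - 2)"
proof -
  have \<beta>n: "real DIM(real^'n) < \<beta>" using \<beta> s by simp
  define f where "f \<epsilon> = (LINT x:- ball p \<epsilon>|lebesgue.
       (indicator (- \<Omega>) x - indicator \<Omega> x) / norm (x - p) powr (real CARD('n) + 2 * s))" for \<epsilon> :: real
  have eq: "f \<epsilon> = - 2 * (outer_potential \<beta> \<Omega> p \<epsilon> - (LINT y|lborel. cut_kernel \<beta> \<epsilon> (y::real^'n)) / 2)" if \<epsilon>: "0 < \<epsilon>" for \<epsilon>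
  proof -
    define h where "h x = (1 - 2 * indicator \<Omega> x) * cut_kernel \<beta> \<epsilon> (x - p)" for x
    have hm: "h \<in> borel_measurable borel" unfolding h_def using \<Omega> by measurable
    have i: "integrable lborel (\<lambda>y. indicator \<Omega> (p + y) * cut_kernel \<beta> \<epsilon> y)"
      by (rule integrable_cut_kernel_mult[OF \<epsilon> \<beta>n, where B=1]; use borel_indicator_shift[OF \<Omega>] in \<open>auto simp: indicator_def\<close>)
    have pw: "1 / z powr (real CARD('n) + 2 * s) = z powr - \<beta>" for z :: real
      unfolding \<beta> by (rule powr_minus_divide[symmetric])
    have "f \<epsilon> = (LINT x|lebesgue. h x)"
      unfolding f_def set_lebesgue_integral_def
      by (rule Bochner_Integration.integral_cong)
         (auto simp: h_def cut_kernel_def indicator_def pw dist_norm norm_minus_commute)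
    also have "\<dots> = (LINT x|lborel. h x)" using hm by (intro integral_completion) simp
    also have "\<dots> = (LINT y|lborel. h (p + y))"
      using integral_orthogonal[OF orthogonal_transformation_id hm, of p] by simp
    also have "\<dots> = (LINT y|lborel. cut_kernel \<beta> \<epsilon> y - 2 * (indicator \<Omega> (p + y) * cut_kernel \<beta> \<epsilon> y))"
      by (intro Bochner_Integration.integral_cong) (auto simp: h_def algebra_simps)
    also have "\<dots> = (LINT y|lborel. cut_kernel \<beta> \<epsilon> (y::real^'n)) - 2 * outer_potential \<beta> \<Omega> p \<epsilon>"
      using i integrable_cut_kernel[OF \<epsilon> \<beta>n] by (simp add: outer_potential_def)
    finally show ?thesis by simp
  qed
  have "((\<lambda>\<epsilon>. - 2 * (outer_potential \<beta> \<Omega> p \<epsilon> - (LINT y|lborel. cut_kernel \<beta> \<epsilon> (y::real^'n)) / 2)) \<longlongrightarrow> - 2 * l) (at_right 0)"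
    by (intro tendsto_intros lim)
  then have "(f \<longlongrightarrow> - 2 * l) (at_right 0)"
    by (rule Lim_transform_eventually) (auto simp: eq eventually_at_filter)
  then have "Lim (at_right 0) f = - 2 * l" by (intro tendsto_Lim) auto
  then show ?thesis unfolding nonlocal_mean_curvature_def f_def by simp
qed

lemma principal_value_converges_frontier:
  fixes \<Omega> :: "(real^'n) set"
  assumes \<Omega>: "open \<Omega>" "C2_Hoelder_boundary \<alpha> \<Omega>" "0 < \<alpha>" "\<alpha> \<le> 1" and p: "p \<in> frontier \<Omega>"
    and \<beta>: "real CARD('n) < \<beta>" "\<beta> < real (CARD('n) + 1)"
  shows "\<exists>l. ((\<lambda>\<epsilon>. outer_potential \<beta> \<Omega> p \<epsilon> - (LINT y|lborel. cut_kernel \<beta> \<epsilon> (y::real^'n)) / 2) \<longlongrightarrow> l) (at_right 0)"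
proof -
  obtain r \<nu> g G A K where "C2_graph \<Omega> p r \<nu> g G A K \<alpha>"
    using C2_graph_exists[OF \<Omega> p] .
  then interpret C2_graph \<Omega> p r \<nu> g G A K \<alpha> .
  have "g p = 0" using frontier_iff[of p] p r_pos by simp
  then show ?thesis using \<beta> by (rule principal_value_converges_center)
qed

text \<open>The divergent kernel integrals at \<open>p\<close> and \<open>q\<close> are the same
  number and cancel, so the difference of the truncated potentials converges to
  \<open>sphere_area (CARD('n) - 2) / 2\<close> times the difference of the curvatures. The lower
  bound \<open>f\<close> may depend on \<epsilon>, as it does in
  \<open>reflected_pair_excess_bound\<close>.\<close>

lemma potential_difference_bound:
  fixes \<Omega> :: "(real^'n) set"
  assumes \<Omega>: "open \<Omega>" "C2_Hoelder_boundary \<alpha> \<Omega>" "\<alpha> \<le> 1" and s: "0 < s" "2 * s < \<alpha>"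
    and p: "p \<in> frontier \<Omega>" and q: "q \<in> frontier \<Omega>"
    and H: "\<bar>nonlocal_mean_curvature s \<Omega> p - nonlocal_mean_curvature s \<Omega> q\<bar> \<le> \<delta> * norm (p - q)"
    and ev: "eventually (\<lambda>\<epsilon>. f \<epsilon> \<le> outer_potential (real CARD('n) + 2 * s) \<Omega> q \<epsilon> - outer_potential (real CARD('n) + 2 * s) \<Omega> p \<epsilon>) (at_right 0)"
    and f: "(f \<longlongrightarrow> B) (at_right 0)"
  shows "B \<le> sphere_area (CARD('n) - 2) / 2 * \<delta> * norm (p - q)"
proof -
  define \<omega> where "\<omega> = sphere_area (CARD('n) - 2)"
  have \<omega>: "0 < \<omega>" unfolding \<omega>_def by (rule sphere_area_pos)
  define \<beta> where "\<beta> = real CARD('n) + 2 * s"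
  have \<beta>: "real CARD('n) < \<beta>" "\<beta> < real (CARD('n) + 1)" using s \<Omega> by (auto simp: \<beta>_def)
  have b: "\<Omega> \<in> sets borel" using \<Omega> by simp
  have \<alpha>: "0 < \<alpha>" using s by linarith
  obtain l where l: "((\<lambda>\<epsilon>. outer_potential \<beta> \<Omega> p \<epsilon> - (LINT y|lborel. cut_kernel \<beta> \<epsilon> (y::real^'n)) / 2) \<longlongrightarrow> l) (at_right 0)"
    using principal_value_converges_frontier[OF \<Omega>(1,2) \<alpha> \<Omega>(3) p \<beta>] by blast
  obtain m where m: "((\<lambda>\<epsilon>. outer_potential \<beta> \<Omega> q \<epsilon> - (LINT y|lborel. cut_kernel \<beta> \<epsilon> (y::real^'n)) / 2) \<longlongrightarrow> m) (at_right 0)"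
    using principal_value_converges_frontier[OF \<Omega>(1,2) \<alpha> \<Omega>(3) q \<beta>] by blast
  have "((\<lambda>\<epsilon>. outer_potential \<beta> \<Omega> q \<epsilon> - outer_potential \<beta> \<Omega> p \<epsilon>) \<longlongrightarrow> m - l) (at_right 0)"
    using tendsto_diff[OF m l] by simp
  then have "B \<le> m - l"
    by (intro tendsto_le[OF _ _ f]) (use ev in \<open>auto simp: \<beta>_def\<close>)
  moreover have "nonlocal_mean_curvature s \<Omega> p - nonlocal_mean_curvature s \<Omega> q = 2 * (m - l) / \<omega>"
    unfolding nonlocal_mean_curvature_eq[OF b s(1) \<beta>_def l] nonlocal_mean_curvature_eq[OF b s(1) \<beta>_def m] \<omega>_def
    by (simp add: diff_divide_distrib)
  then have "2 * (m - l) / \<omega> \<le> \<delta> * norm (p - q)" using H by linarith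
  then have "m - l \<le> \<omega> / 2 * \<delta> * norm (p - q)" using \<omega> by (simp add: field_simps)
  ultimately show ?thesis by (simp add: \<omega>_def)
qed

section \<open>Comparison of the domain near two boundary points\<close>

lemma rotation_between_unit_vectors:
  fixes u v :: "'a::euclidean_space"
  assumes u: "norm u = 1" and v: "norm v = 1"
  shows "\<exists>Q. orthogonal_transformation Q \<and> Q u = v \<and> (\<forall>x. norm (Q x - x) \<le> 8 * norm (u - v) * norm x)"
proof (cases "u + v = 0")
  case True
  then have v': "v = - u" by (simp add: eq_neg_iff_add_eq_0 add.commute)
  have uu: "u \<bullet> u = 1" using u by (simp add: dot_square_norm)
  have n: "norm (u - v) = 2"
  proof -
    have "u - v = 2 *\<^sub>R u" using v' by (simp add: scaleR_2)
    then show ?thesis using u by simp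
  qed
  have "norm (reflect u 0 x - x) \<le> 8 * norm (u - v) * norm x" for x
    using norm_triangle_ineq4[of "reflect u 0 x" x] norm_ge_zero[of x]
    unfolding n norm_reflect_0[OF u] by linarith
  moreover have "reflect u 0 u = v" using v' uu by (simp add: reflect_def algebra_simps scaleR_2)
  ultimately show ?thesis using orthogonal_transformation_reflect_0[OF u] by blast
next
  case False
  \<comment> \<open>\<open>Q\<close> is the reflection along \<open>u\<close> followed by the one
    along the bisector \<open>m\<close>: it takes \<open>u\<close> to \<open>- u\<close> and then to
    \<open>v\<close>. If \<open>norm (u - v) \<le> 1\<close>, then
    \<open>norm (m - u) \<le> 2 * norm (u - v)\<close>, so the two reflections almost undo each
    other; otherwise the trivial bound \<open>2 * norm x\<close> is enough.\<close>
  define k where "k = norm (u + v)"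
  have k: "0 < k" using False by (simp add: k_def)
  define m where "m = (1 / k) *\<^sub>R (u + v)"
  have m: "norm m = 1" using k by (simp add: m_def k_def)
  have uu: "u \<bullet> u = 1" "v \<bullet> v = 1" using u v by (auto simp: dot_square_norm)
  have k2: "k * k = 2 * (1 + u \<bullet> v)"
  proof -
    have "k * k = (u + v) \<bullet> (u + v)" unfolding k_def by (simp add: power2_norm_eq_inner flip: power2_eq_square)
    then show ?thesis by (simp add: inner_add_left inner_add_right uu inner_commute)
  qed
  define Q where "Q = reflect m 0 \<circ> reflect u 0"
  have Q: "orthogonal_transformation Q"
    unfolding Q_def by (intro orthogonal_transformation_compose orthogonal_transformation_reflect_0 u m)
  have "Q u = v"
  proof -
    have "reflect u 0 u = - u" using uu by (simp add: reflect_def algebra_simps scaleR_2)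
    moreover have "reflect m 0 (- u) = - u + (2 * (u \<bullet> m)) *\<^sub>R m" by (simp add: reflect_def)
    moreover have "(2 * (u \<bullet> m)) *\<^sub>R m = u + v"
    proof -
      have "(2 * (u \<bullet> m)) *\<^sub>R m = (2 * (1 + u \<bullet> v) / (k * k)) *\<^sub>R (u + v)"
        using k by (simp add: m_def inner_add_right uu)
      also have "\<dots> = u + v" using k2 k by (metis divide_self_if less_numeral_extra(3) mult_eq_0_iff scaleR_one)
      finally show ?thesis .
    qed
    ultimately show ?thesis by (simp add: Q_def)
  qed
  moreover have "norm (Q x - x) \<le> 8 * norm (u - v) * norm x" for x
  proof (cases "norm (u - v) \<le> 1")
    case True
    have "\<bar>2 - k\<bar> \<le> norm (u - v)"
    proof -
      have "2 = norm (2 *\<^sub>R u)" using u by simp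
      moreover have "2 *\<^sub>R u - (u + v) = u - v" by (simp add: scaleR_2)
      ultimately show ?thesis unfolding k_def by (metis norm_triangle_ineq3)
    qed
    then have k1: "1 \<le> k" using True by linarith
    have "k *\<^sub>R (m - u) = (v - u) + (2 - k) *\<^sub>R u" using k by (simp add: m_def algebra_simps scaleR_2)
    then have "k * norm (m - u) = norm ((v - u) + (2 - k) *\<^sub>R u)" using k by (metis norm_scaleR abs_of_pos)
    also have "\<dots> \<le> norm (v - u) + \<bar>2 - k\<bar>" using norm_triangle_ineq[of "v - u" "(2 - k) *\<^sub>R u"] u by simp
    also have "\<dots> \<le> 2 * norm (u - v)" using \<open>\<bar>2 - k\<bar> \<le> _\<close> by (simp add: norm_minus_commute)
    finally have "k * norm (m - u) \<le> 2 * norm (u - v)" .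
    moreover have "1 * norm (m - u) \<le> k * norm (m - u)" using k1 by (intro mult_right_mono) auto
    ultimately have mu: "norm (m - u) \<le> 2 * norm (u - v)" by linarith
    have "norm (Q x - x) = norm (reflect m 0 (Q x) - reflect m 0 x)" using norm_reflect_diff[OF m, of 0] by simp
    also have "\<dots> = norm (reflect u 0 x - reflect m 0 x)" by (simp add: Q_def m)
    also have "reflect u 0 x - reflect m 0 x = 2 *\<^sub>R ((x \<bullet> m) *\<^sub>R (m - u) + (x \<bullet> (m - u)) *\<^sub>R u)"
      by (simp add: reflect_def algebra_simps inner_diff_right)
    also have "norm \<dots> \<le> 2 * (\<bar>x \<bullet> m\<bar> * norm (m - u) + \<bar>x \<bullet> (m - u)\<bar>)"
      using norm_triangle_ineq[of "(x \<bullet> m) *\<^sub>R (m - u)" "(x \<bullet> (m - u)) *\<^sub>R u"] u by simp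
    also have "\<dots> \<le> 2 * (norm x * norm (m - u) + norm x * norm (m - u))"
      using Cauchy_Schwarz_ineq2[of x m] Cauchy_Schwarz_ineq2[of x "m - u"] m
      by (intro mult_left_mono add_mono mult_right_mono) auto
    also have "\<dots> \<le> 2 * (norm x * (2 * norm (u - v)) + norm x * (2 * norm (u - v)))"
      using mu by (intro mult_left_mono add_mono) auto
    finally show ?thesis by (simp add: mult_ac)
  next
    case False
    have "norm (Q x - x) \<le> 2 * norm x"
      using norm_triangle_ineq4[of "Q x" x] Q by (simp add: orthogonal_transformation_norm)
    also have "2 * norm x \<le> 8 * norm (u - v) * norm x" using False by (intro mult_right_mono) auto
    finally show ?thesis .
  qed
  ultimately show ?thesis using Q by blast
qed

lemma norm_normalize_diff_le:
  fixes a b :: "'a::real_inner"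
  assumes "1 \<le> norm a" "1 \<le> norm b"
  shows "norm ((1 / norm a) *\<^sub>R a - (1 / norm b) *\<^sub>R b) \<le> 2 * norm (a - b)"
    and "\<bar>1 / norm a - 1 / norm b\<bar> \<le> norm (a - b)"
proof -
  have pos: "0 < norm a" "0 < norm b" using assms by auto
  have "\<bar>1 / norm a - 1 / norm b\<bar> = \<bar>norm b - norm a\<bar> / (norm a * norm b)"
  proof -
    have "1 / norm a - 1 / norm b = (norm b - norm a) / (norm a * norm b)" using pos by (simp add: field_simps)
    then show ?thesis by (simp add: abs_mult)
  qed
  also have "\<dots> \<le> norm (a - b) / (norm a * norm b)"
    using norm_triangle_ineq3[of b a] by (intro divide_right_mono) (auto simp: norm_minus_commute)
  finally have 1: "\<bar>1 / norm a - 1 / norm b\<bar> \<le> norm (a - b) / (norm a * norm b)" .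
  have "1 * 1 \<le> norm a * norm b" using assms by (intro mult_mono) auto
  then have "norm (a - b) / (norm a * norm b) \<le> norm (a - b) / 1" by (intro divide_left_mono) (use pos in auto)
  then show "\<bar>1 / norm a - 1 / norm b\<bar> \<le> norm (a - b)" using 1 by simp
  have "(1 / norm a) *\<^sub>R a - (1 / norm b) *\<^sub>R b = (1 / norm a) *\<^sub>R (a - b) + (1 / norm a - 1 / norm b) *\<^sub>R b"
    by (simp add: algebra_simps)
  then have "norm ((1 / norm a) *\<^sub>R a - (1 / norm b) *\<^sub>R b) \<le> 1 / norm a * norm (a - b) + \<bar>1 / norm a - 1 / norm b\<bar> * norm b"
    using norm_triangle_ineq[of "(1 / norm a) *\<^sub>R (a - b)" "(1 / norm a - 1 / norm b) *\<^sub>R b"] by simp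
  also have "\<dots> \<le> 1 / norm a * norm (a - b) + norm (a - b) / (norm a * norm b) * norm b"
    using 1 by (intro add_left_mono mult_right_mono) auto
  also have "\<dots> = 2 * (norm (a - b) / norm a)" using pos by simp
  also have "\<dots> \<le> 2 * (norm (a - b) / 1)" using assms pos by (intro mult_left_mono divide_left_mono) auto
  finally show "norm ((1 / norm a) *\<^sub>R a - (1 / norm b) *\<^sub>R b) \<le> 2 * norm (a - b)" by simp
qed

context C2_graph
begin

text \<open>After rotating the normal at \<open>a\<close> to the normal at \<open>b\<close>, the boundary near \<open>a\<close> and the one near
  \<open>b\<close> differ only through their Hessians.\<close>

lemma near_difference_le:
  "\<exists>C\<ge>0. \<forall>a b \<rho> \<epsilon>. a \<in> ball p (r / 2) \<longrightarrow> b \<in> ball p (r / 2) \<longrightarrow> g a = 0 \<longrightarrow> g b = 0 \<longrightarrow>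
     0 < \<rho> \<longrightarrow> \<rho> \<le> norm (a - b) \<longrightarrow> norm (a - b) \<le> min 1 (r / 2) \<longrightarrow> 0 < \<epsilon> \<longrightarrow> \<epsilon> \<le> \<rho> \<longrightarrow>
     (\<forall>\<beta>. real CARD('n) < \<beta> \<longrightarrow> \<beta> < real (CARD('n) + 1) \<longrightarrow>
      \<bar>(outer_potential \<beta> \<Omega> a \<epsilon> - outer_potential \<beta> \<Omega> a \<rho>)
       - (outer_potential \<beta> \<Omega> b \<epsilon> - outer_potential \<beta> \<Omega> b \<rho>)\<bar>
       \<le> C * norm (a - b) powr \<alpha> * near_const CARD('n) \<beta> * \<rho> powr (real (CARD('n) + 1) - \<beta>))"
proof -
  define \<Gamma> where "\<Gamma> = norm (G p) + MA * r"
  \<comment> \<open>One summand for each discrepancy after division by the lengths of the gradients: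
    the different lengths, the different Hessians, the rotation in each of the two slots of the
    Hessian at \<open>b\<close>, and two Taylor remainders.\<close>
  define C1 where "C1 = MA * MA + K + 2 * (MA * (16 * MA)) + 2 * K"
  define C where "C = slab_const * (\<Gamma> * C1)"
  have \<Gamma>: "0 \<le> \<Gamma>" using MA_nonneg r_pos by (simp add: \<Gamma>_def)
  have C1: "0 \<le> C1" using MA_nonneg K by (simp add: C1_def)
  have C: "0 \<le> C" using \<Gamma> C1 slab_const_nonneg by (simp add: C_def)
  have main: "\<bar>(outer_potential \<beta> \<Omega> a \<epsilon> - outer_potential \<beta> \<Omega> a \<rho>)
       - (outer_potential \<beta> \<Omega> b \<epsilon> - outer_potential \<beta> \<Omega> b \<rho>)\<bar>
       \<le> C * norm (a - b) powr \<alpha> * near_const CARD('n) \<beta> * \<rho> powr (real (CARD('n) + 1) - \<beta>)"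
    if ab: "a \<in> ball p (r / 2)" "b \<in> ball p (r / 2)" "g a = 0" "g b = 0"
      and \<rho>: "0 < \<rho>" "\<rho> \<le> norm (a - b)" and d1: "norm (a - b) \<le> min 1 (r / 2)" and \<epsilon>: "0 < \<epsilon>" "\<epsilon> \<le> \<rho>"
      and \<beta>: "real CARD('n) < \<beta>" "\<beta> < real (CARD('n) + 1)" for a b \<rho> \<epsilon> \<beta>
  proof -
    define d where "d = norm (a - b)"
    have d: "0 < d" "d \<le> 1" "d \<le> r / 2" "\<rho> \<le> d" using \<rho> d1 by (auto simp: d_def)
    have d\<alpha>: "d \<le> d powr \<alpha>"
    proof -
      have "d powr 1 \<le> d powr \<alpha>" using d \<alpha> by (intro powr_mono') auto
      then show ?thesis using d by simp
    qed
    have inb: "a \<in> ball p r" "b \<in> ball p r" using ab r_pos by auto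
    have inb': "a + y \<in> ball p r" "b + y \<in> ball p r" if "norm y < \<rho>" for y
    proof -
      have "dist p (a + y) \<le> dist p a + norm y" "dist p (b + y) \<le> dist p b + norm y"
        using dist_triangle[of p "a + y" a] dist_triangle[of p "b + y" b] by (auto simp: dist_norm)
      then show "a + y \<in> ball p r" "b + y \<in> ball p r" using ab that d by auto
    qed
    define \<gamma>a \<gamma>b where "\<gamma>a = norm (G a)" and "\<gamma>b = norm (G b)"
    have \<gamma>: "1 \<le> \<gamma>a" "1 \<le> \<gamma>b" "\<gamma>a \<le> \<Gamma>" "\<gamma>b \<le> \<Gamma>"
      using norm_G_ge inb norm_G_le by (auto simp: \<gamma>a_def \<gamma>b_def \<Gamma>_def)
    \<comment> \<open>Dividing \<open>g\<close> by the length of its gradient makes the linear parts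
      at \<open>a\<close> and \<open>b\<close> the unit normals \<open>u\<close> and
      \<open>v\<close>; since \<open>Q u = v\<close>, these agree once the coordinates at
      \<open>b\<close> are rotated, and only second order terms are left.\<close>
    define u v where "u = (1 / \<gamma>a) *\<^sub>R G a" and "v = (1 / \<gamma>b) *\<^sub>R G b"
    have uv: "norm u = 1" "norm v = 1" using \<gamma> by (auto simp: u_def v_def \<gamma>a_def \<gamma>b_def)
    have GL: "norm (G a - G b) \<le> MA * d" using G_Lipschitz[OF inb] by (simp add: d_def)
    have uvd: "norm (u - v) \<le> 2 * (MA * d)" and igd: "\<bar>1 / \<gamma>a - 1 / \<gamma>b\<bar> \<le> MA * d"
      using norm_normalize_diff_le[of "G a" "G b"] \<gamma> GL by (auto simp: u_def v_def \<gamma>a_def \<gamma>b_def)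
    obtain Q where Q: "orthogonal_transformation Q" "Q u = v" "\<And>x. norm (Q x - x) \<le> 8 * norm (u - v) * norm x"
      using rotation_between_unit_vectors[OF uv] by blast
    have nQ: "norm (Q y) = norm y" for y using Q(1) by (rule orthogonal_transformation_norm)
    have Qd: "norm (Q y - y) \<le> 16 * MA * d * norm y" for y
    proof -
      have "8 * norm (u - v) * norm y \<le> 8 * (2 * (MA * d)) * norm y" using uvd by (intro mult_right_mono mult_left_mono) auto
      then show ?thesis using Q(3)[of y] by (simp add: mult_ac)
    qed
    have quad_diff: "\<bar>quad a y / \<gamma>a - quad b (Q y) / \<gamma>b\<bar> \<le> (MA * MA + K + 2 * (MA * (16 * MA))) * d powr \<alpha> * (norm y)\<^sup>2" for y
    proof -
      have cs: "\<bar>(M *v x) \<bullet> z\<bar> \<le> norm M * norm x * norm z" for M :: "real^'n^'n" and x z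
        using Cauchy_Schwarz_ineq2[of "M *v x" z] mult_right_mono[OF norm_matrix_vector_mult_le[of M x], of "norm z"] by simp
      \<comment> \<open>Telescoping: change the normalization, then the Hessian, then its two
        arguments one at a time.\<close>
      have e: "(A a *v y) \<bullet> y / \<gamma>a - (A b *v Q y) \<bullet> Q y / \<gamma>b
        = (1 / \<gamma>a - 1 / \<gamma>b) * ((A a *v y) \<bullet> y) + (1 / \<gamma>b) * (((A a - A b) *v y) \<bullet> y)
         - (1 / \<gamma>b) * ((A b *v (Q y - y)) \<bullet> y) - (1 / \<gamma>b) * ((A b *v Q y) \<bullet> (Q y - y))"
        by (simp add: matrix_vector_mult_diff_rdistrib matrix_vector_mult_diff_distrib inner_diff_left inner_diff_right
            diff_divide_distrib algebra_simps)
      have n2: "(norm y)\<^sup>2 = norm y * norm y" by (simp add: power2_eq_square)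
      have ig: "\<bar>1 / \<gamma>b\<bar> \<le> 1" using \<gamma> by simp
      have t1: "\<bar>(1 / \<gamma>a - 1 / \<gamma>b) * ((A a *v y) \<bullet> y)\<bar> \<le> MA * MA * d * (norm y)\<^sup>2"
      proof -
        have "\<bar>(A a *v y) \<bullet> y\<bar> \<le> MA * norm y * norm y"
          using cs[of "A a" y y] A_bound[OF inb(1)] by (meson mult_right_mono norm_ge_zero order_trans)
        then have "\<bar>1 / \<gamma>a - 1 / \<gamma>b\<bar> * \<bar>(A a *v y) \<bullet> y\<bar> \<le> (MA * d) * (MA * norm y * norm y)"
          using igd MA_nonneg d by (intro mult_mono) auto
        then show ?thesis by (simp add: abs_mult n2 mult_ac)
      qed
      have scale: "\<bar>(1 / \<gamma>b) * z\<bar> \<le> B" if "\<bar>z\<bar> \<le> B" for z B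
      proof -
        have "\<bar>1 / \<gamma>b\<bar> * \<bar>z\<bar> \<le> 1 * B" using ig that by (intro mult_mono) auto
        then show ?thesis by (simp add: abs_mult)
      qed
      have t2: "\<bar>(1 / \<gamma>b) * (((A a - A b) *v y) \<bullet> y)\<bar> \<le> K * d powr \<alpha> * (norm y)\<^sup>2"
      proof (rule scale)
        have "\<bar>((A a - A b) *v y) \<bullet> y\<bar> \<le> norm (A a - A b) * norm y * norm y" by (rule cs)
        also have "\<dots> \<le> K * d powr \<alpha> * norm y * norm y"
          using Hoelder[OF inb] by (intro mult_right_mono) (auto simp: d_def)
        finally show "\<bar>((A a - A b) *v y) \<bullet> y\<bar> \<le> K * d powr \<alpha> * (norm y)\<^sup>2" by (simp add: n2 mult_ac)
      qed
      have t3: "\<bar>(1 / \<gamma>b) * ((A b *v (Q y - y)) \<bullet> y)\<bar> \<le> MA * (16 * MA) * d * (norm y)\<^sup>2"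
      proof (rule scale)
        have "\<bar>(A b *v (Q y - y)) \<bullet> y\<bar> \<le> norm (A b) * norm (Q y - y) * norm y" by (rule cs)
        also have "\<dots> \<le> MA * (16 * MA * d * norm y) * norm y"
          using A_bound[OF inb(2)] Qd[of y] MA_nonneg by (intro mult_right_mono mult_mono) auto
        finally show "\<bar>(A b *v (Q y - y)) \<bullet> y\<bar> \<le> MA * (16 * MA) * d * (norm y)\<^sup>2" by (simp add: n2 mult_ac)
      qed
      have t4: "\<bar>(1 / \<gamma>b) * ((A b *v Q y) \<bullet> (Q y - y))\<bar> \<le> MA * (16 * MA) * d * (norm y)\<^sup>2"
      proof (rule scale)
        have "\<bar>(A b *v Q y) \<bullet> (Q y - y)\<bar> \<le> norm (A b) * norm (Q y) * norm (Q y - y)" by (rule cs)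
        also have "\<dots> \<le> MA * norm y * (16 * MA * d * norm y)"
          unfolding nQ using A_bound[OF inb(2)] Qd[of y] MA_nonneg by (intro mult_right_mono mult_mono) auto
        finally show "\<bar>(A b *v Q y) \<bullet> (Q y - y)\<bar> \<le> MA * (16 * MA) * d * (norm y)\<^sup>2" by (simp add: n2 mult_ac)
      qed
      have dd: "c * d * (norm y)\<^sup>2 \<le> c * d powr \<alpha> * (norm y)\<^sup>2" if "0 \<le> c" for c
        using that d\<alpha> by (intro mult_right_mono mult_left_mono) auto
      have "0 \<le> MA * MA" "0 \<le> MA * (16 * MA)" using MA_nonneg by auto
      note dd1 = dd[OF this(1)] and dd2 = dd[OF this(2)]
      have "\<bar>(A a *v y) \<bullet> y / \<gamma>a - (A b *v Q y) \<bullet> Q y / \<gamma>b\<bar>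
         \<le> MA * MA * d powr \<alpha> * (norm y)\<^sup>2 + K * d powr \<alpha> * (norm y)\<^sup>2 + 2 * (MA * (16 * MA) * d powr \<alpha> * (norm y)\<^sup>2)"
        unfolding e using t1 t2 t3 t4 dd1 dd2 by linarith
      also have "\<dots> = (MA * MA + K + 2 * (MA * (16 * MA))) * d powr \<alpha> * (norm y)\<^sup>2" by (simp add: algebra_simps)
      finally have "\<bar>(A a *v y) \<bullet> y / \<gamma>a - (A b *v Q y) \<bullet> Q y / \<gamma>b\<bar> \<le> (MA * MA + K + 2 * (MA * (16 * MA))) * d powr \<alpha> * (norm y)\<^sup>2" .
      moreover have "quad a y / \<gamma>a - quad b (Q y) / \<gamma>b = ((A a *v y) \<bullet> y / \<gamma>a - (A b *v Q y) \<bullet> Q y / \<gamma>b) / 2"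
        by (simp add: quad_def diff_divide_distrib)
      then have "\<bar>quad a y / \<gamma>a - quad b (Q y) / \<gamma>b\<bar> \<le> \<bar>(A a *v y) \<bullet> y / \<gamma>a - (A b *v Q y) \<bullet> Q y / \<gamma>b\<bar>"
        by (simp only: abs_divide) simp
      ultimately show ?thesis by (rule order_trans[rotated])
    qed
    have key: "\<bar>g (a + y)\<bar> \<le> \<Gamma> * C1 * d powr \<alpha> * (norm y)\<^sup>2"
      if y: "norm y < \<rho>" "(a + y \<in> \<Omega>) \<noteq> (b + Q y \<in> \<Omega>)" for y
    proof -
      have ib: "a + y \<in> ball p r" "b + Q y \<in> ball p r" using inb' y nQ by auto
      have le: "K * norm y powr \<alpha> * (norm y)\<^sup>2 \<le> K * d powr \<alpha> * (norm y)\<^sup>2"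
        using y d K \<alpha> by (intro mult_right_mono mult_left_mono powr_mono2) auto
      have ta: "\<bar>g (a + y) - G a \<bullet> y - quad a y\<bar> \<le> K * d powr \<alpha> * (norm y)\<^sup>2"
        using taylor[OF inb(1) ib(1)] le ab by simp
      have tb: "\<bar>g (b + Q y) - G b \<bullet> Q y - quad b (Q y)\<bar> \<le> K * d powr \<alpha> * (norm y)\<^sup>2"
        using taylor[OF inb(2) ib(2)] le ab nQ by simp
      define L where "L = u \<bullet> y"
      have La: "G a \<bullet> y / \<gamma>a = L" by (simp add: L_def u_def)
      have Lb: "G b \<bullet> Q y / \<gamma>b = L"
      proof -
        have "G b \<bullet> Q y / \<gamma>b = v \<bullet> Q y" by (simp add: v_def)
        also have "\<dots> = L" using Q(1,2) by (metis L_def orthogonal_transformation_def)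
        finally show ?thesis .
      qed
      have div: "\<bar>z / c\<bar> \<le> B" if "\<bar>z\<bar> \<le> B" "1 \<le> c" for z c B :: real
      proof -
        have "\<bar>z / c\<bar> \<le> \<bar>z\<bar> / 1" using that by (simp add: divide_le_eq mult_le_cancel_left1)
        then show ?thesis using that by simp
      qed
      have ta': "\<bar>g (a + y) / \<gamma>a - L - quad a y / \<gamma>a\<bar> \<le> K * d powr \<alpha> * (norm y)\<^sup>2"
        using div[OF ta \<gamma>(1)] La by (simp add: diff_divide_distrib)
      have tb': "\<bar>g (b + Q y) / \<gamma>b - L - quad b (Q y) / \<gamma>b\<bar> \<le> K * d powr \<alpha> * (norm y)\<^sup>2"
        using div[OF tb \<gamma>(2)] Lb by (simp add: diff_divide_distrib)
      have "\<bar>g (a + y) / \<gamma>a - g (b + Q y) / \<gamma>b\<bar> \<le> (MA * MA + K + 2 * (MA * (16 * MA))) * d powr \<alpha> * (norm y)\<^sup>2 + 2 * (K * d powr \<alpha> * (norm y)\<^sup>2)"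
        using ta' tb' quad_diff[of y] by linarith
      also have "\<dots> = C1 * d powr \<alpha> * (norm y)\<^sup>2" by (simp add: C1_def algebra_simps)
      finally have "\<bar>g (a + y) / \<gamma>a - g (b + Q y) / \<gamma>b\<bar> \<le> C1 * d powr \<alpha> * (norm y)\<^sup>2" .
      \<comment> \<open>If exactly one of two numbers is negative, each is bounded by their
        distance; this turns the disagreement of the two pictures into thinness.\<close>
      moreover have "(g (a + y) / \<gamma>a < 0) \<noteq> (g (b + Q y) / \<gamma>b < 0)"
        using mem_iff[OF ib(1)] mem_iff[OF ib(2)] y(2) \<gamma> by (simp add: divide_less_0_iff)
      ultimately have "\<bar>g (a + y) / \<gamma>a\<bar> \<le> C1 * d powr \<alpha> * (norm y)\<^sup>2" by linarith
      then have "\<bar>g (a + y)\<bar> \<le> \<gamma>a * (C1 * d powr \<alpha> * (norm y)\<^sup>2)" using \<gamma> by (simp add: field_simps abs_mult)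
      also have "\<dots> \<le> \<Gamma> * (C1 * d powr \<alpha> * (norm y)\<^sup>2)" using \<gamma> C1 by (intro mult_right_mono) auto
      finally show ?thesis by (simp add: mult_ac)
    qed
    have b: "\<Omega> \<in> sets borel" using \<Omega>_open by simp
    have "\<bar>(outer_potential \<beta> \<Omega> a \<epsilon> - outer_potential \<beta> \<Omega> a \<rho>)
       - (outer_potential \<beta> \<Omega> b \<epsilon> - outer_potential \<beta> \<Omega> b \<rho>)\<bar>
       \<le> (C * d powr \<alpha>) * near_const (DIM(real^'n)) \<beta> * \<rho> powr (real (DIM(real^'n) + 1) - \<beta>)"
    proof (rule outer_potential_near_difference[OF b \<rho>(1) _ Q(1)])
      show "0 \<le> C * d powr \<alpha>" using C by simp
      fix d' :: real assume d': "0 < d'" "d' \<le> \<rho>"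
      define E where "E = {y \<in> ball 0 \<rho>. (a + y \<in> \<Omega>) \<noteq> (b + Q y \<in> \<Omega>)} \<inter> ball 0 d'"
      have Em: "E \<in> sets borel"
        unfolding E_def by (intro sets.Int borel_sets_coincidence) (use b borel_measurable_orthogonal[OF Q(1)] in auto)
      have "measure lborel E \<le> slab_const * d' ^ (CARD('n) - 1) * (\<Gamma> * C1 * d powr \<alpha> * d'\<^sup>2)"
      proof (rule measure_slab_le[where q=a and a=0, OF Em])
        show "\<bar>g (a + x)\<bar> \<le> \<Gamma> * C1 * d powr \<alpha> * d'\<^sup>2" if "x \<in> E" for x
        proof -
          have "\<bar>g (a + x)\<bar> \<le> \<Gamma> * C1 * d powr \<alpha> * (norm x)\<^sup>2" using that by (intro key) (auto simp: E_def)
          also have "\<dots> \<le> \<Gamma> * C1 * d powr \<alpha> * d'\<^sup>2" using that C1 \<Gamma> by (intro mult_left_mono power_mono) (auto simp: E_def)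
          finally show ?thesis .
        qed
      qed (use C1 \<Gamma> d' in \<open>auto simp: E_def\<close>)
      also have "\<dots> = C * d powr \<alpha> * d' ^ (DIM(real^'n) + 1)"
      proof -
        have "d' ^ (CARD('n) - 1) * d'\<^sup>2 = d' ^ (CARD('n) - 1 + 2)" by (rule power_add[symmetric])
        also have "CARD('n) - 1 + 2 = CARD('n) + 1" using zero_less_card_finite[where 'a='n] by linarith
        finally show ?thesis by (simp add: C_def mult_ac)
      qed
      finally show "measure lborel ({y \<in> ball 0 \<rho>. (a + y \<in> \<Omega>) \<noteq> (b + Q y \<in> \<Omega>)} \<inter> ball 0 d') \<le> C * d powr \<alpha> * d' ^ (DIM(real^'n) + 1)"
        by (simp add: E_def)
    qed (use \<beta> \<epsilon> in auto)
    then show ?thesis by (simp add: d_def)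
  qed
  show ?thesis
    by (rule exI[of _ C]) (use C main in blast)
qed

end

section \<open>Boundary points where the plane is orthogonal to the boundary\<close>

context C2_graph
begin

definition normal :: "real^'n" where "normal = (1 / norm (G p)) *\<^sub>R G p"

text \<open>Polarization of \<open>quad\<close>: the cross term in \<open>quad p (y + z)\<close>. It
  is symmetrized since the locale does not state that \<open>A p\<close> is a symmetric
  matrix.\<close>

definition bil :: "real^'n \<Rightarrow> real^'n \<Rightarrow> real" where
  "bil y z = ((A p *v y) \<bullet> z + (A p *v z) \<bullet> y) / 2"

lemma p_in_ball: "p \<in> ball p r" using r_pos by simp

lemma norm_Gp: "1 \<le> norm (G p)" using norm_G_ge[OF p_in_ball] .

lemma Gp_nonzero: "G p \<noteq> 0" using norm_Gp by (metis norm_zero not_one_le_zero)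

lemma norm_normal: "norm normal = 1" using Gp_nonzero by (simp add: normal_def)

lemma Gp_inner: "G p \<bullet> y = norm (G p) * (normal \<bullet> y)"
  using Gp_nonzero by (simp add: normal_def)

lemma quad_add: "quad p (y + z) = quad p y + quad p z + bil y z"
  by (simp add: quad_def bil_def matrix_vector_right_distrib inner_add_left inner_add_right add_divide_distrib)

lemma quad_scale: "quad p (t *\<^sub>R y) = t\<^sup>2 * quad p y"
  by (simp add: quad_def matrix_vector_mult_scaleR power2_eq_square)

lemma quad_minus: "quad p (- y) = quad p y"
  using quad_scale[of "-1" y] by simp

lemma bil_scale: "bil y (t *\<^sub>R z) = t * bil y z" "bil (t *\<^sub>R y) z = t * bil y z"
  by (simp_all add: bil_def matrix_vector_mult_scaleR algebra_simps)

lemma bil_minus: "bil y (- z) = - bil y z"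
  using bil_scale(1)[of y "-1" z] by simp

lemma bil_add_left: "bil (x + y) z = bil x z + bil y z"
  by (simp add: bil_def matrix_vector_right_distrib inner_add_left inner_add_right algebra_simps add_divide_distrib)

lemma bil_bound: "\<bar>bil y z\<bar> \<le> MA * norm y * norm z"
proof -
  have cs: "\<bar>(A p *v x) \<bullet> z\<bar> \<le> MA * norm x * norm z" for x z
  proof -
    have "\<bar>(A p *v x) \<bullet> z\<bar> \<le> norm (A p *v x) * norm z" by (rule Cauchy_Schwarz_ineq2)
    also have "\<dots> \<le> (norm (A p) * norm x) * norm z" by (intro mult_right_mono norm_matrix_vector_mult_le) auto
    also have "\<dots> \<le> MA * norm x * norm z" using A_bound[OF p_in_ball] by (intro mult_right_mono) auto
    finally show ?thesis .
  qed
  show ?thesis using cs[of y z] cs[of z y] unfolding bil_def by (simp add: mult_ac)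
qed

text \<open>For tangential \<open>u\<close> the linear part of \<open>g\<close> sees only the
  displacement along \<open>normal\<close>, which is quadratic in \<tau> and so enters at the same
  order as the Hessian. The sign of the limit tells on which side of the boundary the parabola runs
  for small \<tau>.\<close>

lemma expansion:
  assumes p0: "g p = 0" and u: "normal \<bullet> u = 0"
  shows "((\<lambda>\<tau>. g (p + \<tau> *\<^sub>R u + (\<kappa> * \<tau>\<^sup>2) *\<^sub>R normal) / \<tau>\<^sup>2) \<longlongrightarrow> norm (G p) * \<kappa> + quad p u) (at_right 0)"
proof -
  define v where "v \<tau> = u + (\<kappa> * \<tau>) *\<^sub>R normal" for \<tau>
  have v_lim: "(v \<longlongrightarrow> u) (at_right 0)"
  proof -
    have "((\<lambda>\<tau>. u + (\<kappa> * \<tau>) *\<^sub>R normal) \<longlongrightarrow> u + (\<kappa> * 0) *\<^sub>R normal) (at_right 0)" by (intro tendsto_intros)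
    then show ?thesis by (simp add: v_def[abs_def])
  qed
  have tv_lim: "((\<lambda>\<tau>. \<tau> *\<^sub>R v \<tau>) \<longlongrightarrow> 0) (at_right 0)"
    using tendsto_scaleR[OF tendsto_ident_at v_lim] by simp
  have q_lim: "((\<lambda>\<tau>. quad p (v \<tau>)) \<longlongrightarrow> quad p u) (at_right 0)"
  proof -
    have "((\<lambda>\<tau>. A p *v v \<tau>) \<longlongrightarrow> A p *v u) (at_right 0)"
      by (intro bounded_linear.tendsto[OF matrix_vector_mul_bounded_linear] v_lim)
    then show ?thesis unfolding quad_def by (intro tendsto_intros v_lim) auto
  qed
  define E where "E \<tau> = K * norm (\<tau> *\<^sub>R v \<tau>) powr \<alpha> * (norm (v \<tau>))\<^sup>2" for \<tau>
  have n_lim: "((\<lambda>\<tau>. norm (\<tau> *\<^sub>R v \<tau>) powr \<alpha>) \<longlongrightarrow> 0) (at_right 0)"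
    by (rule tendsto_zero_powrI) (use tendsto_norm_zero[OF tv_lim] \<alpha> in auto)
  have "((\<lambda>\<tau>. K * norm (\<tau> *\<^sub>R v \<tau>) powr \<alpha> * (norm (v \<tau>))\<^sup>2) \<longlongrightarrow> K * 0 * (norm u)\<^sup>2) (at_right 0)"
    by (intro tendsto_intros n_lim v_lim)
  then have E_lim: "(E \<longlongrightarrow> 0) (at_right 0)" by (simp add: E_def[abs_def])
  have ev1: "eventually (\<lambda>\<tau>. norm (\<tau> *\<^sub>R v \<tau>) < r) (at_right 0)"
    using order_tendstoD(2)[OF tendsto_norm_zero[OF tv_lim] r_pos] .
  have ev2: "eventually (\<lambda>\<tau>::real. 0 < \<tau>) (at_right 0)" by (simp add: eventually_at_filter)
  have "((\<lambda>\<tau>. g (p + \<tau> *\<^sub>R u + (\<kappa> * \<tau>\<^sup>2) *\<^sub>R normal) / \<tau>\<^sup>2 - (norm (G p) * \<kappa> + quad p (v \<tau>))) \<longlongrightarrow> 0) (at_right 0)"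
  proof (rule Lim_null_comparison[OF _ E_lim])
    show "eventually (\<lambda>\<tau>. norm (g (p + \<tau> *\<^sub>R u + (\<kappa> * \<tau>\<^sup>2) *\<^sub>R normal) / \<tau>\<^sup>2 - (norm (G p) * \<kappa> + quad p (v \<tau>))) \<le> E \<tau>) (at_right 0)"
      using ev1 ev2
    proof eventually_elim
      case (elim \<tau>)
      define y where "y = \<tau> *\<^sub>R v \<tau>"
      have eq: "p + \<tau> *\<^sub>R u + (\<kappa> * \<tau>\<^sup>2) *\<^sub>R normal = p + y"
        by (simp add: y_def v_def algebra_simps power2_eq_square)
      have "p + y \<in> ball p r" using elim by (simp add: y_def dist_norm)
      from taylor[OF p_in_ball this] have T: "\<bar>g (p + y) - G p \<bullet> y - quad p y\<bar> \<le> K * norm y powr \<alpha> * (norm y)\<^sup>2"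
        using p0 by simp
      have "G p \<bullet> y = \<tau>\<^sup>2 * (norm (G p) * \<kappa>)"
        using u norm_normal by (simp add: Gp_inner y_def v_def inner_add_right dot_square_norm power2_eq_square)
      moreover have "quad p y = \<tau>\<^sup>2 * quad p (v \<tau>)" by (simp add: y_def quad_scale)
      moreover have "K * norm y powr \<alpha> * (norm y)\<^sup>2 = \<tau>\<^sup>2 * E \<tau>" by (simp add: E_def y_def power_mult_distrib)
      ultimately have "\<bar>g (p + y) - \<tau>\<^sup>2 * (norm (G p) * \<kappa> + quad p (v \<tau>))\<bar> \<le> \<tau>\<^sup>2 * E \<tau>"
        using T by (simp add: algebra_simps)
      moreover have "g (p + y) / \<tau>\<^sup>2 - (norm (G p) * \<kappa> + quad p (v \<tau>)) = (g (p + y) - \<tau>\<^sup>2 * (norm (G p) * \<kappa> + quad p (v \<tau>))) / \<tau>\<^sup>2"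
        using elim by (simp add: field_simps)
      ultimately have "\<bar>g (p + y) / \<tau>\<^sup>2 - (norm (G p) * \<kappa> + quad p (v \<tau>))\<bar> \<le> E \<tau>"
        using elim by (simp add: field_simps)
      then show ?case by (simp only: eq real_norm_def)
    qed
  qed
  from tendsto_add[OF this tendsto_add[OF tendsto_const[of "norm (G p) * \<kappa>"] q_lim]]
  show ?thesis by simp
qed

text \<open>Intermediate value theorem in the curvature \<sigma> of a parabola: \<open>g\<close>
  divided by \<open>t\<^sup>2\<close> is \<open>norm (G p) * \<sigma> + quad p u\<close> up to
  \<open>C * t powr \<alpha>\<close>, with slope at least 1 in \<sigma>, so it changes sign within
  that distance of \<open>- quad p u / norm (G p)\<close>. The rate matters: \<open>quad\<close> is
  even, so the points found in the directions \<open>e\<close> and \<open>- e\<close> have heights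
  along \<open>normal\<close> that differ only by order
  \<open>t powr (\<alpha> + 2)\<close>.\<close>

lemma boundary_point_near_tangent:
  assumes p0: "g p = 0" and u: "normal \<bullet> u = 0" "norm u = 1"
  shows "\<exists>C\<ge>0. \<exists>t0>0. \<forall>t. 0 < t \<longrightarrow> t < t0 \<longrightarrow>
     (\<exists>\<sigma>. \<bar>\<sigma> + quad p u / norm (G p)\<bar> \<le> C * t powr \<alpha> \<and> g (p + t *\<^sub>R u + (\<sigma> * t\<^sup>2) *\<^sub>R normal) = 0)"
proof -
  define \<gamma> where "\<gamma> = norm (G p)"
  have \<gamma>: "1 \<le> \<gamma>" using norm_Gp by (simp add: \<gamma>_def)
  \<comment> \<open>\<open>S\<close> bounds every \<sigma> in a window of radius at most 1 around
    the expected value, \<open>V\<close> bounds the corresponding \<open>v\<close>, and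
    \<open>t0\<close> makes the window that small and keeps the parabola in the ball.\<close>
  define S where "S = \<bar>quad p u / \<gamma>\<bar> + 1"
  have S: "1 \<le> S" by (simp add: S_def)
  define V where "V = 1 + S"
  define C where "C = K * V powr \<alpha> * V\<^sup>2 + MA * S + MA * S\<^sup>2"
  have C: "0 \<le> C" using K MA_nonneg S by (simp add: C_def)
  define t0 where "t0 = min (min 1 (r / V)) ((1 / (C + 1)) powr (1 / \<alpha>))"
  have t0: "0 < t0" using r_pos S C by (simp add: t0_def V_def)
  have main: "\<exists>\<sigma>. \<bar>\<sigma> + quad p u / \<gamma>\<bar> \<le> C * t powr \<alpha> \<and> g (p + t *\<^sub>R u + (\<sigma> * t\<^sup>2) *\<^sub>R normal) = 0"
    if t: "0 < t" "t < t0" for t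
  proof -
    have t1: "t \<le> 1" "t * V < r" using t S by (auto simp: t0_def V_def field_simps)
    have ta: "t \<le> t powr \<alpha>"
      using powr_mono'[of \<alpha> 1 t] t t1 \<alpha> by simp
    have tC: "C * t powr \<alpha> \<le> 1"
    proof -
      have "t powr \<alpha> \<le> ((1 / (C + 1)) powr (1 / \<alpha>)) powr \<alpha>" using t \<alpha> by (intro powr_mono2) (auto simp: t0_def)
      also have "\<dots> = 1 / (C + 1)" using \<alpha> C by (simp add: powr_powr)
      finally have "C * t powr \<alpha> \<le> C * (1 / (C + 1))" using C by (intro mult_left_mono) auto
      also have "\<dots> \<le> 1" using C by (simp add: field_simps)
      finally show ?thesis .
    qed
    have est: "p + t *\<^sub>R u + (\<sigma> * t\<^sup>2) *\<^sub>R normal \<in> ball p r"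
      "\<bar>g (p + t *\<^sub>R u + (\<sigma> * t\<^sup>2) *\<^sub>R normal) - t\<^sup>2 * (\<gamma> * \<sigma> + quad p u)\<bar> \<le> t\<^sup>2 * (C * t powr \<alpha>)"
      if \<sigma>: "\<bar>\<sigma>\<bar> \<le> S" for \<sigma>
    proof -
      define v where "v = u + (\<sigma> * t) *\<^sub>R normal"
      define y where "y = t *\<^sub>R v"
      have eq: "p + t *\<^sub>R u + (\<sigma> * t\<^sup>2) *\<^sub>R normal = p + y"
        by (simp add: y_def v_def algebra_simps power2_eq_square)
      have \<sigma>t: "\<bar>\<sigma> * t\<bar> \<le> S * t" using \<sigma> t by (simp add: abs_mult mult_right_mono)
      also have "S * t \<le> S * 1" using t1 S by (intro mult_left_mono) auto
      finally have vV: "norm v \<le> V"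
        using norm_triangle_ineq[of u "(\<sigma> * t) *\<^sub>R normal"] norm_normal u by (simp add: v_def V_def)
      have "norm y = t * norm v" using t by (simp add: y_def)
      also have "\<dots> \<le> t * V" using vV t by (intro mult_left_mono) auto
      finally have yV: "norm y \<le> t * V" .
      then have inb: "p + y \<in> ball p r" using t1 by (simp add: dist_norm)
      then show "p + t *\<^sub>R u + (\<sigma> * t\<^sup>2) *\<^sub>R normal \<in> ball p r" by (simp only: eq)
      have T: "\<bar>g (p + y) - G p \<bullet> y - quad p y\<bar> \<le> K * norm y powr \<alpha> * (norm y)\<^sup>2"
        using taylor[OF p_in_ball inb] p0 by simp
      have "K * norm y powr \<alpha> * (norm y)\<^sup>2 \<le> K * (t * V) powr \<alpha> * (t * V)\<^sup>2"
        using yV K \<alpha> by (intro mult_mono mult_left_mono powr_mono2 power_mono) auto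
      also have "\<dots> = t\<^sup>2 * (K * V powr \<alpha> * V\<^sup>2 * t powr \<alpha>)"
        using t S by (simp add: powr_mult power_mult_distrib V_def mult_ac)
      finally have T1: "K * norm y powr \<alpha> * (norm y)\<^sup>2 \<le> t\<^sup>2 * (K * V powr \<alpha> * V\<^sup>2 * t powr \<alpha>)" .
      have Gy: "G p \<bullet> y = t\<^sup>2 * (\<gamma> * \<sigma>)"
        using u norm_normal by (simp add: Gp_inner y_def v_def inner_add_right dot_square_norm power2_eq_square \<gamma>_def)
      have qy: "quad p y = t\<^sup>2 * (quad p u + ((\<sigma> * t)\<^sup>2 * quad p normal + (\<sigma> * t) * bil u normal))"
        by (simp add: y_def v_def quad_scale quad_add bil_scale)
      have b1: "\<bar>(\<sigma> * t)\<^sup>2 * quad p normal\<bar> \<le> MA * S\<^sup>2 * t powr \<alpha>"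
      proof -
        have "\<bar>quad p normal\<bar> \<le> MA" using quad_bound[OF p_in_ball, of normal] norm_normal MA_nonneg by simp
        moreover have "(\<sigma> * t)\<^sup>2 \<le> S\<^sup>2 * t powr \<alpha>"
        proof -
          have "(\<sigma> * t)\<^sup>2 \<le> (S * t)\<^sup>2" using \<sigma>t by (metis abs_ge_zero power2_abs power_mono)
          also have "\<dots> = S\<^sup>2 * (t * t)" by (simp add: power2_eq_square)
          also have "\<dots> \<le> S\<^sup>2 * (t * 1)" using t t1 by (intro mult_left_mono) auto
          also have "\<dots> \<le> S\<^sup>2 * t powr \<alpha>" using ta by (intro mult_left_mono) auto
          finally show ?thesis .
        qed
        ultimately have "(\<sigma> * t)\<^sup>2 * \<bar>quad p normal\<bar> \<le> (S\<^sup>2 * t powr \<alpha>) * MA" by (intro mult_mono) auto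
        then show ?thesis by (simp add: abs_mult mult_ac)
      qed
      have b2: "\<bar>(\<sigma> * t) * bil u normal\<bar> \<le> MA * S * t powr \<alpha>"
      proof -
        have "\<bar>bil u normal\<bar> \<le> MA" using bil_bound[of u normal] norm_normal u by simp
        moreover have "\<bar>\<sigma> * t\<bar> \<le> S * t powr \<alpha>" using \<sigma>t ta S by (smt (verit) mult_left_mono)
        ultimately have "\<bar>\<sigma> * t\<bar> * \<bar>bil u normal\<bar> \<le> (S * t powr \<alpha>) * MA" by (intro mult_mono) auto
        then show ?thesis by (simp add: abs_mult mult_ac)
      qed
      have "\<bar>t\<^sup>2 * ((\<sigma> * t)\<^sup>2 * quad p normal + (\<sigma> * t) * bil u normal)\<bar> \<le> t\<^sup>2 * (MA * S\<^sup>2 * t powr \<alpha> + MA * S * t powr \<alpha>)"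
        unfolding abs_mult using b1 b2 by (intro mult_mono) auto
      then have "\<bar>g (p + y) - t\<^sup>2 * (\<gamma> * \<sigma> + quad p u)\<bar> \<le> t\<^sup>2 * (K * V powr \<alpha> * V\<^sup>2 * t powr \<alpha>) + t\<^sup>2 * (MA * S\<^sup>2 * t powr \<alpha> + MA * S * t powr \<alpha>)"
        using T T1 unfolding Gy qy by (simp only: distrib_left)
      also have "\<dots> = t\<^sup>2 * (C * t powr \<alpha>)" by (simp add: C_def algebra_simps)
      finally show "\<bar>g (p + t *\<^sub>R u + (\<sigma> * t\<^sup>2) *\<^sub>R normal) - t\<^sup>2 * (\<gamma> * \<sigma> + quad p u)\<bar> \<le> t\<^sup>2 * (C * t powr \<alpha>)"
        by (simp only: eq)
    qed
    define \<kappa> where "\<kappa> = quad p u / \<gamma>"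
    have \<gamma>\<kappa>: "\<gamma> * \<kappa> = quad p u" using \<gamma> by (simp add: \<kappa>_def)
    define w where "w = C * t powr \<alpha>"
    have w: "0 \<le> w" "w \<le> 1" using tC C by (auto simp: w_def)
    have inS: "\<bar>\<sigma>\<bar> \<le> S" if "\<sigma> \<in> {- \<kappa> - w..- \<kappa> + w}" for \<sigma>
      using that w unfolding S_def \<kappa>_def[symmetric] atLeastAtMost_iff by linarith
    let ?f = "\<lambda>\<sigma>. g (p + t *\<^sub>R u + (\<sigma> * t\<^sup>2) *\<^sub>R normal)"
    have wg: "w \<le> \<gamma> * w" using \<gamma> w by (simp add: mult_le_cancel_right1)
    have lo: "?f (- \<kappa> - w) \<le> 0"
    proof -
      have "?f (- \<kappa> - w) \<le> t\<^sup>2 * (\<gamma> * (- \<kappa> - w) + quad p u) + t\<^sup>2 * w"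
        using est(2)[OF inS, of "- \<kappa> - w"] w by (simp add: w_def abs_le_iff)
      also have "\<dots> = t\<^sup>2 * (w - \<gamma> * w)" using \<gamma>\<kappa> by (simp add: algebra_simps)
      also have "\<dots> \<le> 0" using wg by (intro mult_nonneg_nonpos) auto
      finally show ?thesis .
    qed
    have hi: "0 \<le> ?f (- \<kappa> + w)"
    proof -
      have "0 \<le> t\<^sup>2 * (\<gamma> * w - w)" using wg by simp
      also have "\<dots> = t\<^sup>2 * (\<gamma> * (- \<kappa> + w) + quad p u) - t\<^sup>2 * w" using \<gamma>\<kappa> by (simp add: algebra_simps)
      also have "\<dots> \<le> ?f (- \<kappa> + w)"
        using est(2)[OF inS, of "- \<kappa> + w"] w by (simp add: w_def abs_le_iff)
      finally show ?thesis .
    qed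
    have "continuous_on {- \<kappa> - w..- \<kappa> + w} ?f"
      by (rule continuous_on_compose2[OF continuous_on_g]) (use est(1)[OF inS] in \<open>auto intro!: continuous_intros\<close>)
    then obtain \<sigma> where "- \<kappa> - w \<le> \<sigma>" "\<sigma> \<le> - \<kappa> + w" "?f \<sigma> = 0"
      using IVT'[of ?f "- \<kappa> - w" 0 "- \<kappa> + w"] lo hi w by auto
    then show ?thesis by (intro exI[of _ \<sigma>]) (auto simp: w_def \<kappa>_def abs_le_iff)
  qed
  show ?thesis using C t0 main unfolding \<gamma>_def by blast
qed

context
  fixes e :: "real^'n" and c :: real
  assumes p0: "g p = 0" and e: "norm e = 1" and tangent: "G p \<bullet> e = 0"
    and c: "c = p \<bullet> e" and cap: "cap_reflects_into e c \<Omega>"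
begin

lemma normal_e: "normal \<bullet> e = 0"
  using tangent norm_Gp by (simp add: normal_def)

text \<open>The parabolas at \<open>p\<close> in the directions \<open>w + e\<close> and
  \<open>w - e\<close> with a common curvature \<kappa> are mirror images. If the inequality failed,
  the \<kappa> halfway between their critical values would put the upper one inside \<Omega> and its
  mirror image outside, against \<open>cap\<close>.\<close>

lemma quad_cap_le:
  assumes w: "normal \<bullet> w = 0" "w \<bullet> e = 0"
  shows "quad p (w - e) \<le> quad p (w + e)"
proof (rule ccontr)
  assume neg: "\<not> ?thesis"
  define \<gamma> where "\<gamma> = norm (G p)"
  have \<gamma>: "1 \<le> \<gamma>" using norm_Gp by (simp add: \<gamma>_def)
  define \<kappa> where "\<kappa> = - (quad p (w + e) + quad p (w - e)) / (2 * \<gamma>)"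
  have \<gamma>\<kappa>: "\<gamma> * \<kappa> = - (quad p (w + e) + quad p (w - e)) / 2" using \<gamma> by (simp add: \<kappa>_def)
  have n: "normal \<bullet> (w + e) = 0" "normal \<bullet> (w - e) = 0" using w normal_e by (auto simp: inner_add_right inner_diff_right)
  let ?x = "\<lambda>\<tau>. p + \<tau> *\<^sub>R (w + e) + (\<kappa> * \<tau>\<^sup>2) *\<^sub>R normal"
  let ?y = "\<lambda>\<tau>. p + \<tau> *\<^sub>R (w - e) + (\<kappa> * \<tau>\<^sup>2) *\<^sub>R normal"
  have l1: "((\<lambda>\<tau>. g (?x \<tau>) / \<tau>\<^sup>2) \<longlongrightarrow> (quad p (w + e) - quad p (w - e)) / 2) (at_right 0)"
    using expansion[OF p0 n(1), of \<kappa>] \<gamma>\<kappa> by (simp add: \<gamma>_def[symmetric] field_simps)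
  have l2: "((\<lambda>\<tau>. g (?y \<tau>) / \<tau>\<^sup>2) \<longlongrightarrow> (quad p (w - e) - quad p (w + e)) / 2) (at_right 0)"
    using expansion[OF p0 n(2), of \<kappa>] \<gamma>\<kappa> by (simp add: \<gamma>_def[symmetric] field_simps)
  have "((\<lambda>\<tau>. ?x \<tau>) \<longlongrightarrow> p + 0 *\<^sub>R (w + e) + (\<kappa> * 0\<^sup>2) *\<^sub>R normal) (at_right 0)" by (intro tendsto_intros)
  then have x: "eventually (\<lambda>\<tau>. ?x \<tau> \<in> ball p r) (at_right 0)"
    using p_in_ball by (intro topological_tendstoD) auto
  have "((\<lambda>\<tau>. ?y \<tau>) \<longlongrightarrow> p + 0 *\<^sub>R (w - e) + (\<kappa> * 0\<^sup>2) *\<^sub>R normal) (at_right 0)" by (intro tendsto_intros)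
  then have y: "eventually (\<lambda>\<tau>. ?y \<tau> \<in> ball p r) (at_right 0)"
    using p_in_ball by (intro topological_tendstoD) auto
  have "eventually (\<lambda>\<tau>. g (?x \<tau>) / \<tau>\<^sup>2 < 0 \<and> 0 < g (?y \<tau>) / \<tau>\<^sup>2 \<and> ?x \<tau> \<in> ball p r \<and> ?y \<tau> \<in> ball p r \<and> 0 < \<tau>) (at_right 0)"
    using order_tendstoD(2)[OF l1, of 0] order_tendstoD(1)[OF l2, of 0] neg x y
    by (intro eventually_conj) (auto simp: eventually_at_filter)
  then obtain \<tau> where \<tau>: "g (?x \<tau>) / \<tau>\<^sup>2 < 0" "0 < g (?y \<tau>) / \<tau>\<^sup>2" "?x \<tau> \<in> ball p r" "?y \<tau> \<in> ball p r" "0 < \<tau>"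
    using eventually_happens'[of "at_right (0::real)"] by fastforce
  have "g (?x \<tau>) < 0" "0 < g (?y \<tau>)" using \<tau> by (auto simp: divide_less_0_iff zero_less_divide_iff)
  then have "?x \<tau> \<in> \<Omega>" "?y \<tau> \<notin> \<Omega>" using mem_iff \<tau> by auto
  moreover have xe: "?x \<tau> \<bullet> e = c + \<tau>"
    using w normal_e e by (simp add: inner_add_left c dot_square_norm)
  moreover have "reflect e c (?x \<tau>) = ?y \<tau>"
    unfolding reflect_def xe by (simp add: vec_eq_iff algebra_simps)
  ultimately show False using cap \<tau>(5) unfolding cap_reflects_into_def by force
qed

text \<open>\<open>quad_cap_le\<close> for \<open>w\<close> and for \<open>- w\<close> gives both
  signs. So the Hessian does not couple \<open>e\<close> with the other tangential directions: to
  second order the boundary at \<open>p\<close> is symmetric about the plane.\<close>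

lemma bil_tangent:
  assumes w: "normal \<bullet> w = 0" "w \<bullet> e = 0"
  shows "bil w e = 0"
proof -
  have w': "normal \<bullet> (- w) = 0" "(- w) \<bullet> e = 0" using w by auto
  have "bil w (- e) \<le> bil w e" using quad_cap_le[OF w] quad_add[of w "- e"] quad_add[of w e] quad_minus[of e] by simp
  moreover have "bil (- w) (- e) \<le> bil (- w) e"
    using quad_cap_le[OF w'] quad_add[of "- w" "- e"] quad_add[of "- w" e] quad_minus[of e] by simp
  moreover have "bil (- w) z = - bil w z" for z using bil_scale(2)[of "-1" w z] by simp
  ultimately show ?thesis by (simp add: bil_minus)
qed

text \<open>For \<open>x\<close> in the excess, \<open>g\<close> is negative at \<open>x\<close> and
  not at its mirror image. The linear parts at the two points agree because the normal is parallel
  to the plane, and the quadratic parts agree up to third order by \<open>bil_tangent\<close>. So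
  the two values differ by order \<open>2 + \<alpha>\<close>, and \<open>g x\<close> is itself that
  small.\<close>

lemma excess_thin:
  "\<exists>C\<ge>0. \<forall>t x. 0 < t \<longrightarrow> t \<le> 1 \<longrightarrow> 2 * t < r \<longrightarrow> x \<in> excess e c \<Omega> \<longrightarrow> norm (x - p) \<le> 2 * t \<longrightarrow>
     \<bar>g x\<bar> \<le> C * (t powr \<alpha> * t\<^sup>2)"
proof -
  define Y where "Y = 2 * MA + 4 * (K * r powr \<alpha>)"
  have Y: "0 \<le> Y" using MA_nonneg K by (simp add: Y_def)
  define C where "C = 16 * K + 4 * MA * Y"
  have C: "0 \<le> C" using Y MA_nonneg K by (simp add: C_def)
  have "\<bar>g x\<bar> \<le> C * (t powr \<alpha> * t\<^sup>2)"
    if t: "0 < t" "t \<le> 1" "2 * t < r" and x: "x \<in> excess e c \<Omega>" "norm (x - p) \<le> 2 * t" for t x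
  proof -
    have ta: "t \<le> t powr \<alpha>" using powr_mono'[of \<alpha> 1 t] t \<alpha> by simp
    define y where "y = x - p"
    define y' where "y' = reflect e 0 y"
    have ny: "norm y \<le> 2 * t" "norm y' \<le> 2 * t" using x(2) e by (auto simp: y_def y'_def)
    have x': "reflect e c x = p + y'"
      by (simp add: y'_def y_def reflect_def c inner_diff_left algebra_simps)
    have inb: "p + y \<in> ball p r" "p + y' \<in> ball p r" using ny t by (auto simp: dist_norm)
    have gs: "g (p + y) < 0" "0 \<le> g (p + y')"
      using x(1) mem_iff[OF inb(1)] mem_iff[OF inb(2)] by (auto simp: excess_def x' y_def)
    define ye where "ye = y \<bullet> e"
    define z where "z = y - ye *\<^sub>R e"
    have ee: "e \<bullet> e = 1" using e by (simp add: dot_square_norm)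
    have ze: "z \<bullet> e = 0" using ee by (simp add: z_def ye_def inner_diff_left)
    have yz: "y = z + ye *\<^sub>R e" "y' = z + (- ye) *\<^sub>R e"
      by (simp_all add: vec_eq_iff z_def y'_def reflect_def ye_def algebra_simps)
    have ye: "\<bar>ye\<bar> \<le> 2 * t" using Cauchy_Schwarz_ineq2[of y e] e ny by (simp add: ye_def)
    have Gy': "G p \<bullet> y' = G p \<bullet> y" using tangent by (simp add: yz inner_add_right inner_diff_right)
    have rem: "K * norm v powr \<alpha> * (norm v)\<^sup>2 \<le> 8 * K * (t powr \<alpha> * t\<^sup>2)"
        "K * norm v powr \<alpha> * (norm v)\<^sup>2 \<le> 4 * (K * r powr \<alpha>) * t\<^sup>2" if v: "norm v \<le> 2 * t" for v :: "real^'n"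
    proof -
      have "K * norm v powr \<alpha> * (norm v)\<^sup>2 \<le> K * (2 * t) powr \<alpha> * (2 * t)\<^sup>2"
        using v K \<alpha> by (intro mult_mono mult_left_mono powr_mono2 power_mono) auto
      also have "\<dots> = K * (2 powr \<alpha> * (4 * (t powr \<alpha> * t\<^sup>2)))" using t by (simp add: powr_mult power_mult_distrib)
      also have "\<dots> \<le> K * (2 * (4 * (t powr \<alpha> * t\<^sup>2)))"
        using K powr_mono[of \<alpha> 1 2] \<alpha> by (intro mult_left_mono mult_right_mono) auto
      finally show "K * norm v powr \<alpha> * (norm v)\<^sup>2 \<le> 8 * K * (t powr \<alpha> * t\<^sup>2)" by simp
      have "K * norm v powr \<alpha> * (norm v)\<^sup>2 \<le> K * r powr \<alpha> * (2 * t)\<^sup>2"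
        using v t K \<alpha> by (intro mult_mono mult_left_mono powr_mono2 power_mono) auto
      then show "K * norm v powr \<alpha> * (norm v)\<^sup>2 \<le> 4 * (K * r powr \<alpha>) * t\<^sup>2" by (simp add: power_mult_distrib)
    qed
    have T: "\<bar>g (p + y) - G p \<bullet> y - quad p y\<bar> \<le> K * norm y powr \<alpha> * (norm y)\<^sup>2"
      "\<bar>g (p + y') - G p \<bullet> y - quad p y'\<bar> \<le> K * norm y' powr \<alpha> * (norm y')\<^sup>2"
      using taylor[OF p_in_ball inb(1)] taylor[OF p_in_ball inb(2)] p0 Gy' by auto
    have qb: "\<bar>quad p v\<bar> \<le> 2 * MA * t\<^sup>2" if "norm v \<le> 2 * t" for v
    proof -
      have "\<bar>quad p v\<bar> \<le> MA / 2 * (norm v)\<^sup>2" by (rule quad_bound[OF p_in_ball])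
      also have "\<dots> \<le> MA / 2 * (2 * t)\<^sup>2" using that MA_nonneg by (intro mult_left_mono power_mono) auto
      finally show ?thesis by (simp add: power_mult_distrib mult_ac)
    qed
    have Yt: "Y * t\<^sup>2 = 2 * MA * t\<^sup>2 + 4 * (K * r powr \<alpha>) * t\<^sup>2" by (simp add: Y_def algebra_simps)
    \<comment> \<open>A first, cruder use of the sign change: \<open>y\<close> is tangential up to
      order \<open>t\<^sup>2\<close>. It is needed because \<open>bil_tangent\<close> controls
      tangential vectors only.\<close>
    have "\<bar>G p \<bullet> y\<bar> \<le> Y * t\<^sup>2"
      using T gs qb[OF ny(1)] qb[OF ny(2)] rem(2)[OF ny(1)] rem(2)[OF ny(2)] Yt by linarith
    moreover have "\<bar>normal \<bullet> y\<bar> \<le> \<bar>G p \<bullet> y\<bar>"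
      unfolding Gp_inner using norm_Gp by (simp add: abs_mult mult_le_cancel_right1)
    ultimately have yN: "\<bar>normal \<bullet> y\<bar> \<le> Y * t\<^sup>2" by linarith
    have zN: "normal \<bullet> z = normal \<bullet> y" using normal_e by (simp add: z_def inner_diff_right)
    define w where "w = z - (normal \<bullet> y) *\<^sub>R normal"
    have w: "normal \<bullet> w = 0" "w \<bullet> e = 0"
      using zN norm_normal normal_e ze by (auto simp: w_def inner_diff_right inner_diff_left dot_square_norm)
    have "bil z e = (normal \<bullet> y) * bil normal e"
    proof -
      have "z = w + (normal \<bullet> y) *\<^sub>R normal" by (simp add: w_def)
      then show ?thesis using bil_tangent[OF w] by (simp add: bil_add_left bil_scale)
    qed
    then have bz: "\<bar>bil z e\<bar> \<le> Y * t\<^sup>2 * MA"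
    proof -
      have "\<bar>normal \<bullet> y\<bar> * \<bar>bil normal e\<bar> \<le> Y * t\<^sup>2 * MA"
        using yN bil_bound[of normal e] norm_normal e Y by (intro mult_mono) auto
      then show ?thesis using \<open>bil z e = _\<close> by (simp add: abs_mult)
    qed
    \<comment> \<open>Only the mixed term changes sign under the reflection, and just the normal
      component of \<open>z\<close> contributes to it.\<close>
    have "quad p y - quad p y' = 2 * (ye * bil z e)"
      unfolding yz quad_add by (simp add: bil_scale quad_scale quad_minus bil_minus)
    moreover have "\<bar>ye * bil z e\<bar> \<le> (2 * t) * (Y * t\<^sup>2 * MA)"
      unfolding abs_mult using ye bz t by (intro mult_mono) auto
    moreover have "(2 * t) * (Y * t\<^sup>2 * MA) \<le> (2 * t powr \<alpha>) * (Y * t\<^sup>2 * MA)"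
      using ta Y MA_nonneg by (intro mult_right_mono) auto
    ultimately have "\<bar>quad p y - quad p y'\<bar> \<le> 4 * MA * Y * (t powr \<alpha> * t\<^sup>2)" by (simp add: mult_ac)
    then have "\<bar>g (p + y)\<bar> \<le> 4 * MA * Y * (t powr \<alpha> * t\<^sup>2) + 8 * K * (t powr \<alpha> * t\<^sup>2) + 8 * K * (t powr \<alpha> * t\<^sup>2)"
      using T gs rem(1)[OF ny(1)] rem(1)[OF ny(2)] by linarith
    also have "\<dots> = C * (t powr \<alpha> * t\<^sup>2)" by (simp add: C_def algebra_simps)
    finally show ?thesis by (simp add: y_def)
  qed
  then show ?thesis using C by blast
qed

end

end

section \<open>The difference quotient at a point of tangency\<close>

lemma eventually_small_mult:
  fixes m k :: real
  assumes "0 < m"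
  shows "eventually (\<lambda>t. t * k < m) (at_right 0)"
proof -
  have "((\<lambda>t. t * k) \<longlongrightarrow> 0 * k) (at_right 0)" by (intro tendsto_intros)
  then show ?thesis using assms by (intro order_tendstoD(2)) auto
qed

context C2_graph
begin

text \<open>Let \<open>a\<close> and \<open>b\<close> be boundary points at heights \<open>t\<close>
  and \<open>- t\<close>, and \<open>a'\<close> the mirror image of \<open>a\<close>. At truncation
  radius \<rho>, \<open>outer_potential_reflect_ge\<close> leads from \<open>a\<close> to
  \<open>a'\<close> with the gain \<open>c0 * t * I\<close>, and
  \<open>outer_potential_shift\<close> leads on to \<open>b\<close>;
  \<open>near_difference_le\<close> then takes the radius to 0. The Lipschitz bound over
  \<open>norm (a - b)\<close>, about \<open>2 * t\<close>, is divided by \<open>t\<close>, and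
  \<open>t\<close> tends to 0.\<close>

lemma tangent_plane_excess_bound:
  assumes p0: "g p = 0" and e: "norm e = 1" and tangent: "G p \<bullet> e = 0"
    and c: "c = p \<bullet> e" and cap: "cap_reflects_into e c \<Omega>"
    and bnd: "bounded \<Omega>" and C2b: "C2_Hoelder_boundary \<alpha> \<Omega>" and s: "0 < s" "2 * s < \<alpha>"
    and H: "\<And>x y. x \<in> frontier \<Omega> \<Longrightarrow> y \<in> frontier \<Omega> \<Longrightarrow>
      \<bar>nonlocal_mean_curvature s \<Omega> x - nonlocal_mean_curvature s \<Omega> y\<bar> \<le> \<delta> * norm (x - y)"
    and \<delta>: "0 \<le> \<delta>" and D: "\<And>x a. x \<in> \<Omega> \<Longrightarrow> a \<in> frontier \<Omega> \<Longrightarrow> norm (x - a) \<le> D" and D0: "0 \<le> D"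
    and \<beta>_def: "\<beta> = real CARD('n) + 2 * s"
  shows "2 * \<beta> * D powr (- \<beta> - 2) * excess_moment e c \<Omega> \<le> sphere_area (CARD('n) - 2) * \<delta>"
proof -
  define n where "n = CARD('n)"
  have n: "0 < n" by (simp add: n_def)
  define c0 where "c0 = 2 * \<beta> * D powr (- \<beta> - 2)"
  define I where "I = excess_moment e c \<Omega>"
  define \<omega> where "\<omega> = sphere_area (CARD('n) - 2)"
  have \<omega>: "0 < \<omega>" unfolding \<omega>_def by (rule sphere_area_pos)
  have \<beta>: "real CARD('n) < \<beta>" "\<beta> < real (CARD('n) + 1)" using s \<alpha> by (auto simp: \<beta>_def)
  have c00: "0 \<le> c0" using \<beta> by (simp add: c0_def)
  define \<theta> where "\<theta> = \<alpha> - 2 * s"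
  have \<theta>: "0 < \<theta>" using s by (simp add: \<theta>_def)
  have b: "\<Omega> \<in> sets borel" using \<Omega>_open by simp
  have ee: "e \<bullet> e = 1" using e by (simp add: dot_square_norm)
  have Ne: "normal \<bullet> e = 0" "normal \<bullet> (- e) = 0" using tangent Gp_nonzero by (auto simp: normal_def)
  have nme: "norm (- e) = 1" using e by simp
  define q0 where "q0 = quad p e / norm (G p)"
  obtain C1 t1 where C1: "0 \<le> C1" "0 < t1" "\<And>t. 0 < t \<Longrightarrow> t < t1 \<Longrightarrow>
     \<exists>\<sigma>. \<bar>\<sigma> + q0\<bar> \<le> C1 * t powr \<alpha> \<and> g (p + t *\<^sub>R e + (\<sigma> * t\<^sup>2) *\<^sub>R normal) = 0"
    using boundary_point_near_tangent[OF p0 Ne(1) e] unfolding q0_def by blast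
  obtain C1' t1' where C1': "0 \<le> C1'" "0 < t1'" "\<And>t. 0 < t \<Longrightarrow> t < t1' \<Longrightarrow>
     \<exists>\<sigma>. \<bar>\<sigma> + q0\<bar> \<le> C1' * t powr \<alpha> \<and> g (p + t *\<^sub>R (- e) + (\<sigma> * t\<^sup>2) *\<^sub>R normal) = 0"
    using boundary_point_near_tangent[OF p0 Ne(2) nme] unfolding q0_def quad_minus by blast
  obtain Cn where Cn: "0 \<le> Cn" "\<And>a b \<rho> \<epsilon>. a \<in> ball p (r / 2) \<Longrightarrow> b \<in> ball p (r / 2) \<Longrightarrow> g a = 0 \<Longrightarrow> g b = 0 \<Longrightarrow>
     0 < \<rho> \<Longrightarrow> \<rho> \<le> norm (a - b) \<Longrightarrow> norm (a - b) \<le> min 1 (r / 2) \<Longrightarrow> 0 < \<epsilon> \<Longrightarrow> \<epsilon> \<le> \<rho> \<Longrightarrow>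
      \<bar>(outer_potential \<beta> \<Omega> a \<epsilon> - outer_potential \<beta> \<Omega> a \<rho>)
       - (outer_potential \<beta> \<Omega> b \<epsilon> - outer_potential \<beta> \<Omega> b \<rho>)\<bar>
       \<le> Cn * norm (a - b) powr \<alpha> * near_const n \<beta> * \<rho> powr (real (n + 1) - \<beta>)"
    using near_difference_le \<beta> unfolding n_def by meson
  obtain C2 where C2: "0 \<le> C2" "\<And>t x. 0 < t \<Longrightarrow> t \<le> 1 \<Longrightarrow> 2 * t < r \<Longrightarrow> x \<in> excess e c \<Omega> \<Longrightarrow> norm (x - p) \<le> 2 * t \<Longrightarrow>
     \<bar>g x\<bar> \<le> C2 * (t powr \<alpha> * t\<^sup>2)"
    using excess_thin[OF p0 e tangent c cap] by blast
  define W where "W = C1 + C1'"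
  define V where "V = 2 + W"
  define S where "S = \<bar>q0\<bar> + W"
  have WVS: "0 \<le> W" "0 \<le> S" "0 < V" using C1 C1' by (auto simp: W_def S_def V_def)
  define NC where "NC = near_const n \<beta>"
  have NC: "0 \<le> NC" unfolding NC_def n_def using \<beta> by (intro near_const_nonneg) simp
  define Sh where "Sh = \<bar>shift_const n \<beta>\<bar>"
  \<comment> \<open>\<open>P1\<close> is the error of the singular part, \<open>P2\<close> that of
    moving \<open>a'\<close> to \<open>b\<close>, \<open>P3\<close> that of the excess in the
    truncation ball around \<open>a'\<close>; the first summand of \<open>P\<close> stems from the
    difference between \<open>norm (a - b)\<close> and \<open>2 * t\<close>.\<close>
  define P1 where "P1 = Cn * V powr \<alpha> * NC * 2 powr - (1 - 2 * s)"
  define P2 where "P2 = Sh * W * 2 powr (1 + 2 * s)"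
  define P3 where "P3 = (c0 * D + 1) * (slab_const * C2 * (1 / 2) ^ (n - 1))"
  have P3: "0 \<le> P3" using c00 D0 C2 slab_const_nonneg by (simp add: P3_def)
  define P where "P = \<omega> / 2 * \<delta> * W + P1 + P2 + P3"
  have ineq: "c0 * I \<le> \<omega> * \<delta> + P * t powr \<theta>"
    if t: "0 < t" "t < t1" "t < t1'" "t \<le> 1" "2 * t < r" "t * (1 + S) < r / 2" "t * V < min 1 (r / 2)"
      "t * W < 1 / 4" "t * S < 1 / 2" for t
  proof -
    obtain \<sigma> where \<sigma>: "\<bar>\<sigma> + q0\<bar> \<le> C1 * t powr \<alpha>" "g (p + t *\<^sub>R e + (\<sigma> * t\<^sup>2) *\<^sub>R normal) = 0"
      using C1(3)[OF t(1,2)] by blast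
    obtain \<sigma>' where \<sigma>': "\<bar>\<sigma>' + q0\<bar> \<le> C1' * t powr \<alpha>" "g (p + t *\<^sub>R (- e) + (\<sigma>' * t\<^sup>2) *\<^sub>R normal) = 0"
      using C1'(3)[OF t(1,3)] by blast
    define a where "a = p + t *\<^sub>R e + (\<sigma> * t\<^sup>2) *\<^sub>R normal"
    define b where "b = p + t *\<^sub>R (- e) + (\<sigma>' * t\<^sup>2) *\<^sub>R normal"
    define a' where "a' = reflect e c a"
    \<comment> \<open>The singular part favours a small radius, the shift a large one; a radius
      proportional to \<open>t\<close> gives both errors the order
      \<open>t * t powr \<theta>\<close>. The factor 1/2 satisfies \<open>\<rho> \<le> t\<close> and
      keeps the ball around \<open>a'\<close> within distance \<open>2 * t\<close> of
      \<open>p\<close>.\<close>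
    define \<rho> where "\<rho> = t / 2"
    have \<rho>: "0 < \<rho>" using t by (simp add: \<rho>_def)
    have \<rho>_powr: "\<rho> powr x = t powr x * 2 powr - x" for x
      using t by (simp add: \<rho>_def powr_divide powr_minus_divide)
    have t\<alpha>: "t powr \<alpha> \<le> 1" "0 \<le> t powr \<alpha>" using t \<alpha> powr_le1[of \<alpha> t] by auto
    have C1t: "C1 * t powr \<alpha> \<le> C1" "C1' * t powr \<alpha> \<le> C1'"
      using t\<alpha> C1 C1' by (auto simp: mult_left_le)
    have \<sigma>S: "\<bar>\<sigma>\<bar> \<le> S" "\<bar>\<sigma>'\<bar> \<le> S"
      using \<sigma>(1) \<sigma>'(1) C1t C1(1) C1'(1) unfolding S_def W_def by linarith+
    have \<sigma>W: "\<bar>\<sigma> - \<sigma>'\<bar> \<le> W * t powr \<alpha>"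
      using \<sigma>(1) \<sigma>'(1) unfolding W_def distrib_right by linarith
    have t2: "t\<^sup>2 = t * t" by (simp add: power2_eq_square)
    have St: "\<bar>z * t\<^sup>2\<bar> \<le> t * (t * S)" if "\<bar>z\<bar> \<le> S" for z
      unfolding abs_mult t2 using mult_right_mono[OF that, of "t * t"] t by (simp add: mult_ac)
    have ap: "norm (a - p) \<le> t + t * (t * S)"
      using norm_triangle_ineq[of "t *\<^sub>R e" "(\<sigma> * t\<^sup>2) *\<^sub>R normal"] St[OF \<sigma>S(1)] e norm_normal t
      by (simp add: a_def add.assoc)
    have bp: "norm (b - p) \<le> t + t * (t * S)"
      using norm_triangle_ineq[of "t *\<^sub>R (- e)" "(\<sigma>' * t\<^sup>2) *\<^sub>R normal"] St[OF \<sigma>S(2)] e norm_normal t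
      by (simp add: b_def add.assoc)
    have tS: "t * (t * S) \<le> t * S" using t WVS by (intro mult_left_le_one_le) auto
    have abin: "a \<in> ball p (r / 2)" "b \<in> ball p (r / 2)"
      using ap bp tS t(6) by (auto simp: dist_norm norm_minus_commute distrib_left)
    have ga: "g a = 0" "g b = 0" using \<sigma>(2) \<sigma>'(2) by (auto simp: a_def b_def)
    have abr: "a \<in> ball p r" "b \<in> ball p r" using abin r_pos by auto
    have fr: "a \<in> frontier \<Omega>" "b \<in> frontier \<Omega>" using frontier_iff abr ga by auto
    have ae: "a \<bullet> e = c + t" using Ne ee by (simp add: a_def c inner_add_left)
    have a'_eq: "a' = p - t *\<^sub>R e + (\<sigma> * t\<^sup>2) *\<^sub>R normal"
      unfolding a'_def reflect_def ae by (simp add: a_def vec_eq_iff algebra_simps)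
    define h where "h = norm (a' - b)"
    have h_eq: "h = \<bar>\<sigma> - \<sigma>'\<bar> * t\<^sup>2"
    proof -
      have "a' - b = ((\<sigma> - \<sigma>') * t\<^sup>2) *\<^sub>R normal" by (simp add: a'_eq b_def algebra_simps)
      then show ?thesis using norm_normal by (simp add: h_def abs_mult)
    qed
    \<comment> \<open>Both \<sigma> and \<sigma>' approach \<open>- q0\<close>, which gains the
      factor \<open>t powr \<alpha>\<close> over the obvious order \<open>t\<^sup>2\<close>.\<close>
    have hW: "h \<le> W * t powr \<alpha> * t\<^sup>2" unfolding h_eq using \<sigma>W by (intro mult_right_mono) auto
    have hWt: "h \<le> t * (t * W)"
    proof -
      have "W * t powr \<alpha> * t\<^sup>2 \<le> W * 1 * t\<^sup>2" using t\<alpha> WVS by (intro mult_right_mono mult_left_mono) auto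
      then show ?thesis using hW by (simp add: t2 mult_ac)
    qed
    have tW: "t * (t * W) \<le> t * W" "t * (t * W) \<le> t * (1 / 4)"
      using t WVS by (auto intro: mult_left_le_one_le mult_left_mono)
    have h4: "h \<le> \<rho> / 2" using hWt tW t unfolding \<rho>_def by linarith
    have aa': "norm (a - a') = 2 * t"
      using dist_reflect_self[OF e, of c a] t unfolding a'_def ae by (simp add: norm_minus_commute)
    have ab_le: "norm (a - b) \<le> 2 * t + h"
      using norm_triangle_ineq[of "a - a'" "a' - b"] aa' by (simp add: h_def)
    have ab_V: "norm (a - b) \<le> t * V" using ab_le hWt tW by (simp add: V_def algebra_simps)
    have ab_ge: "2 * t \<le> norm (a - b)"
    proof -
      have "b \<bullet> e = c - t" using Ne ee by (simp add: b_def c inner_add_left inner_diff_left)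
      then have "(a - b) \<bullet> e = 2 * t" using ae by (simp add: inner_diff_left)
      then show ?thesis using Cauchy_Schwarz_ineq2[of "a - b" e] e t by simp
    qed
    have near: "outer_potential \<beta> \<Omega> b \<rho> - outer_potential \<beta> \<Omega> a \<rho> - t * (P1 * t powr \<theta>)
        \<le> outer_potential \<beta> \<Omega> b \<epsilon> - outer_potential \<beta> \<Omega> a \<epsilon>" if \<epsilon>: "0 < \<epsilon>" "\<epsilon> \<le> \<rho>" for \<epsilon>
    proof -
      have "\<bar>(outer_potential \<beta> \<Omega> a \<epsilon> - outer_potential \<beta> \<Omega> a \<rho>)
       - (outer_potential \<beta> \<Omega> b \<epsilon> - outer_potential \<beta> \<Omega> b \<rho>)\<bar>
       \<le> Cn * norm (a - b) powr \<alpha> * near_const n \<beta> * \<rho> powr (real (n + 1) - \<beta>)"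
        by (rule Cn(2)[OF abin ga \<rho> _ _ \<epsilon>]) (use ab_ge ab_V t in \<open>auto simp: \<rho>_def\<close>)
      also have "\<dots> \<le> Cn * (t * V) powr \<alpha> * near_const n \<beta> * \<rho> powr (real (n + 1) - \<beta>)"
        using ab_V Cn NC \<alpha> by (intro mult_right_mono mult_left_mono powr_mono2) (auto simp: NC_def)
      also have "\<dots> = t * (P1 * t powr \<theta>)"
      proof -
        have "\<rho> powr (real (n + 1) - \<beta>) = t powr (1 - 2 * s) * 2 powr - (1 - 2 * s)"
          using \<rho>_powr[of "1 - 2 * s"] by (simp add: \<beta>_def n_def)
        moreover have "t powr \<alpha> * t powr (1 - 2 * s) = t * t powr \<theta>"
          using t by (simp add: powr_mult_base powr_add[symmetric] \<theta>_def algebra_simps)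
        ultimately show ?thesis using t WVS by (simp add: P1_def NC_def powr_mult mult_ac)
      qed
      finally show ?thesis by linarith
    qed
    have shift: "outer_potential \<beta> \<Omega> a' \<rho> - t * (P2 * t powr \<theta>) \<le> outer_potential \<beta> \<Omega> b \<rho>"
    proof -
      have "\<bar>outer_potential \<beta> \<Omega> a' \<rho> - outer_potential \<beta> \<Omega> b \<rho>\<bar>
          \<le> shift_const (DIM(real^'n)) \<beta> * norm (a' - b) * \<rho> powr (real (DIM(real^'n)) - \<beta> - 1)"
        by (rule outer_potential_shift[OF \<open>\<Omega> \<in> sets borel\<close> \<rho>]) (use h4 \<beta> in \<open>auto simp: h_def\<close>)
      also have "\<dots> = shift_const n \<beta> * (h * \<rho> powr (real n - \<beta> - 1))" by (simp add: n_def h_def)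
      also have "\<dots> \<le> Sh * (W * t powr \<alpha> * t\<^sup>2 * \<rho> powr (real n - \<beta> - 1))"
        unfolding Sh_def using hW WVS by (intro mult_mono mult_right_mono) (auto simp: h_def)
      also have "\<dots> = t * (P2 * t powr \<theta>)"
      proof -
        have "\<rho> powr (real n - \<beta> - 1) = t powr (- 1 - 2 * s) * 2 powr (1 + 2 * s)"
        proof -
          have "real n - \<beta> - 1 = - 1 - 2 * s" "- (- 1 - 2 * s) = 1 + 2 * s" by (simp_all add: \<beta>_def n_def)
          then show ?thesis using \<rho>_powr[of "- 1 - 2 * s"] by (simp only:)
        qed
        moreover have "t powr \<alpha> * t\<^sup>2 * t powr (- 1 - 2 * s) = t * t powr \<theta>"
        proof -
          have "t powr \<alpha> * t\<^sup>2 * t powr (- 1 - 2 * s) = t powr (\<alpha> + 2 + (- 1 - 2 * s))"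
          proof -
            have "t\<^sup>2 = t powr 2" using t by simp
            then show ?thesis by (simp only: powr_add)
          qed
          also have "\<dots> = t powr (1 + \<theta>)" by (simp add: \<theta>_def algebra_simps)
          finally show ?thesis using t by (simp add: powr_add)
        qed
        ultimately show ?thesis by (simp add: P2_def mult_ac)
      qed
      finally show ?thesis by linarith
    qed
    \<comment> \<open>By \<open>excess_thin\<close> the excess within this ball lies in a slab of
      thickness of order \<open>t powr (\<alpha> + 2)\<close>; the crude volume of the ball would
      not be small enough against \<open>t powr - \<beta>\<close>.\<close>
    have meas: "measure lborel (excess e c \<Omega> \<inter> ball a' \<rho>) \<le> slab_const * \<rho> ^ (n - 1) * (C2 * (t powr \<alpha> * t\<^sup>2))"
      unfolding n_def
    proof (rule measure_slab_le[where q=0 and a=a'])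
      show "excess e c \<Omega> \<inter> ball a' \<rho> \<in> sets borel" using borel_excess[OF e \<open>\<Omega> \<in> sets borel\<close>] by auto
      fix x assume x: "x \<in> excess e c \<Omega> \<inter> ball a' \<rho>"
      have "norm (a' - p) \<le> t + t * (t * S)"
        using norm_triangle_ineq[of "- (t *\<^sub>R e)" "(\<sigma> * t\<^sup>2) *\<^sub>R normal"] St[OF \<sigma>S(1)] e norm_normal t
        by (simp add: a'_eq)
      moreover have "t * (t * S) \<le> t * (1 / 2)" using t by (intro mult_left_mono) auto
      moreover have "norm (x - p) \<le> norm (x - a') + norm (a' - p)"
        using norm_triangle_ineq[of "x - a'" "a' - p"] by simp
      moreover have "norm (x - a') \<le> t / 2" using x by (simp add: dist_norm norm_minus_commute \<rho>_def)
      ultimately have "norm (x - p) \<le> 2 * t" by linarith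
      then show "\<bar>g (0 + x)\<bar> \<le> C2 * (t powr \<alpha> * t\<^sup>2)" using C2(2)[OF t(1,4,5)] x by simp
    qed (use C2 \<rho> in auto)
    have ref: "outer_potential \<beta> \<Omega> a' \<rho> - outer_potential \<beta> \<Omega> a \<rho> \<ge> c0 * t * I - t * (P3 * t powr \<theta>)"
    proof -
      have tt: "a \<bullet> e - c = t" using ae by simp
      have "outer_potential \<beta> \<Omega> a' \<rho> - outer_potential \<beta> \<Omega> a \<rho>
         \<ge> c0 * t * I - (c0 * t * D + t powr - \<beta>) * measure lborel (excess e c \<Omega> \<inter> ball a' \<rho>)"
        using outer_potential_reflect_ge[OF e \<Omega>_open bnd cap, of \<beta> a D \<rho>] \<beta> D fr \<rho> t
        unfolding tt a'_def I_def c0_def by (simp add: \<rho>_def)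
      moreover have "(c0 * t * D + t powr - \<beta>) * measure lborel (excess e c \<Omega> \<inter> ball a' \<rho>) \<le> t * (P3 * t powr \<theta>)"
      proof -
        have "(c0 * t * D + t powr - \<beta>) * measure lborel (excess e c \<Omega> \<inter> ball a' \<rho>)
           \<le> (c0 * t * D + t powr - \<beta>) * (slab_const * \<rho> ^ (n - 1) * (C2 * (t powr \<alpha> * t\<^sup>2)))"
          using meas c00 D0 t by (intro mult_left_mono) auto
        also have "\<dots> = (slab_const * C2 * (1 / 2) ^ (n - 1)) * ((c0 * D * t + t powr - \<beta>) * (t ^ (n - 1) * t powr \<alpha> * t\<^sup>2))"
          by (simp add: \<rho>_def power_divide mult_ac)
        also have "\<dots> \<le> (slab_const * C2 * (1 / 2) ^ (n - 1)) * ((c0 * D + 1) * (t * t powr \<theta>))"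
        proof (rule mult_left_mono)
          have e1: "t ^ (n - 1) * t powr \<alpha> * t\<^sup>2 = t powr (real n + 1 + \<alpha>)"
          proof -
            have "t ^ (n - 1) * t powr \<alpha> * t\<^sup>2 = t powr (real (n - 1)) * t powr \<alpha> * t powr 2"
              using t by (simp add: powr_realpow)
            also have "\<dots> = t powr (real (n - 1) + \<alpha> + 2)" by (simp add: powr_add)
            also have "real (n - 1) + \<alpha> + 2 = real n + 1 + \<alpha>" using n by (simp add: of_nat_diff)
            finally show ?thesis .
          qed
          have e2: "t powr - \<beta> * t powr (real n + 1 + \<alpha>) = t * t powr \<theta>"
          proof -
            have "t powr - \<beta> * t powr (real n + 1 + \<alpha>) = t powr (1 + \<theta>)"
              by (simp add: powr_add[symmetric] \<beta>_def n_def \<theta>_def algebra_simps)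
            then show ?thesis using t by (simp add: powr_add)
          qed
          have "t * t powr (real n + 1 + \<alpha>) \<le> t * t powr \<theta>"
            using t s by (intro mult_left_mono powr_mono') (auto simp: \<theta>_def)
          then have "c0 * D * (t * t powr (real n + 1 + \<alpha>)) \<le> c0 * D * (t * t powr \<theta>)"
            by (rule mult_left_mono[OF _ mult_nonneg_nonneg[OF c00 D0]])
          then show "(c0 * D * t + t powr - \<beta>) * (t ^ (n - 1) * t powr \<alpha> * t\<^sup>2) \<le> (c0 * D + 1) * (t * t powr \<theta>)"
            unfolding e1 distrib_right e2 by (simp add: mult_ac)
        qed (use slab_const_nonneg C2 in auto)
        also have "\<dots> = t * (P3 * t powr \<theta>)" by (simp add: P3_def mult_ac)
        finally show ?thesis .
      qed
      ultimately show ?thesis by linarith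
    qed
    define B where "B = c0 * t * I - t * (P3 * t powr \<theta>) - t * (P2 * t powr \<theta>) - t * (P1 * t powr \<theta>)"
    have "B \<le> sphere_area (CARD('n) - 2) / 2 * \<delta> * norm (a - b)"
    proof (rule potential_difference_bound[OF \<Omega>_open C2b \<alpha>(2) s fr])
      show "\<bar>nonlocal_mean_curvature s \<Omega> a - nonlocal_mean_curvature s \<Omega> b\<bar> \<le> \<delta> * norm (a - b)"
        using H fr by blast
      show "((\<lambda>\<epsilon>. B) \<longlongrightarrow> B) (at_right 0)" by simp
      have "eventually (\<lambda>\<epsilon>. 0 < \<epsilon> \<and> \<epsilon> \<le> \<rho>) (at_right 0)"
        using \<rho> by (auto simp: eventually_at_right[OF \<rho>] intro!: exI[of _ \<rho>])
      then show "eventually (\<lambda>\<epsilon>. B \<le> outer_potential (real CARD('n) + 2 * s) \<Omega> b \<epsilon> - outer_potential (real CARD('n) + 2 * s) \<Omega> a \<epsilon>) (at_right 0)"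
        unfolding \<beta>_def[symmetric]
      proof eventually_elim
        case (elim \<epsilon>)
        then show ?case using near[of \<epsilon>] shift ref unfolding B_def by linarith
      qed
    qed
    also have "\<dots> \<le> \<omega> / 2 * \<delta> * (2 * t + W * t powr \<alpha> * t\<^sup>2)"
      unfolding \<omega>_def[symmetric] using ab_le hW \<omega> \<delta> by (intro mult_left_mono) auto
    finally have fin: "B \<le> \<omega> / 2 * \<delta> * (2 * t + W * t powr \<alpha> * t\<^sup>2)" .
    have "t powr \<alpha> * t \<le> t powr \<theta>"
    proof -
      have "t powr \<alpha> * t \<le> t powr \<alpha> * 1" using t by (intro mult_left_mono) auto
      also have "\<dots> \<le> t powr \<theta>" using t s by (auto intro!: powr_mono' simp: \<theta>_def)
      finally show ?thesis .
    qed
    then have "\<omega> / 2 * \<delta> * W * (t powr \<alpha> * t) \<le> \<omega> / 2 * \<delta> * W * t powr \<theta>"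
      using \<omega> \<delta> WVS by (intro mult_left_mono) auto
    moreover have "t * (c0 * I - P3 * t powr \<theta> - P2 * t powr \<theta> - P1 * t powr \<theta>) \<le> t * (\<omega> * \<delta> + \<omega> / 2 * \<delta> * W * (t powr \<alpha> * t))"
      using fin unfolding B_def t2 by (simp add: algebra_simps)
    then have "c0 * I - P3 * t powr \<theta> - P2 * t powr \<theta> - P1 * t powr \<theta> \<le> \<omega> * \<delta> + \<omega> / 2 * \<delta> * W * (t powr \<alpha> * t)"
      using t by (simp only: mult_le_cancel_left_pos)
    ultimately show ?thesis unfolding P_def distrib_right by linarith
  qed
  have "eventually (\<lambda>t. c0 * I \<le> \<omega> * \<delta> + P * t powr \<theta>) (at_right 0)"
  proof -
    have "eventually (\<lambda>t::real. 0 < t) (at_right 0)" by (simp add: eventually_at_filter)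
    moreover have "eventually (\<lambda>t. t * 1 < t1) (at_right 0)" "eventually (\<lambda>t. t * 1 < t1') (at_right 0)"
      "eventually (\<lambda>t::real. t * 1 < 1) (at_right 0)" "eventually (\<lambda>t. t * 2 < r) (at_right 0)"
      "eventually (\<lambda>t. t * (1 + S) < r / 2) (at_right 0)" "eventually (\<lambda>t. t * V < min 1 (r / 2)) (at_right 0)"
      "eventually (\<lambda>t. t * W < 1 / 4) (at_right 0)" "eventually (\<lambda>t. t * S < 1 / 2) (at_right 0)"
      by (rule eventually_small_mult, use C1(2) C1'(2) r_pos in simp)+
    ultimately show ?thesis
      by eventually_elim (intro ineq, auto)
  qed
  moreover have "((\<lambda>t. \<omega> * \<delta> + P * t powr \<theta>) \<longlongrightarrow> \<omega> * \<delta> + P * 0) (at_right 0)"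
  proof -
    have "((\<lambda>t::real. t powr \<theta>) \<longlongrightarrow> 0) (at_right 0)"
      by (rule tendsto_zero_powrI) (use \<theta> in \<open>auto intro: tendsto_intros simp: eventually_at_filter\<close>)
    then show ?thesis by (intro tendsto_intros)
  qed
  \<comment> \<open>In the limit \<open>P\<close> disappears, and with it every constant of the
    chart as well as \<open>near_const\<close>.\<close>
  ultimately have "c0 * I \<le> \<omega> * \<delta> + P * 0" by (intro tendsto_lowerbound) auto
  then show ?thesis by (simp add: c0_def I_def \<omega>_def)
qed

end

text \<open>Here \<open>a\<close> and its mirror image stay at the fixed distance
  \<open>2 * t\<close> and only the truncation radius tends to 0, so the excess inside the
  truncation ball costs no more than \<open>M * \<epsilon> ^ n\<close>. The regularity of the
  boundary enters through the existence of the principal values.\<close>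

lemma reflected_pair_excess_bound:
  fixes \<Omega> :: "(real^'n) set"
  assumes \<Omega>: "open \<Omega>" "bounded \<Omega>" "C2_Hoelder_boundary \<alpha> \<Omega>" "\<alpha> \<le> 1" and s: "0 < s" "2 * s < \<alpha>"
    and e: "norm e = 1" and cap: "cap_reflects_into e c \<Omega>"
    and a: "a \<in> frontier \<Omega>" "reflect e c a \<in> frontier \<Omega>" "c < a \<bullet> e"
    and H: "\<And>x y. x \<in> frontier \<Omega> \<Longrightarrow> y \<in> frontier \<Omega> \<Longrightarrow>
      \<bar>nonlocal_mean_curvature s \<Omega> x - nonlocal_mean_curvature s \<Omega> y\<bar> \<le> \<delta> * norm (x - y)"
    and D: "\<And>x a. x \<in> \<Omega> \<Longrightarrow> a \<in> frontier \<Omega> \<Longrightarrow> norm (x - a) \<le> D" and D0: "0 \<le> D"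
    and \<beta>_def: "\<beta> = real CARD('n) + 2 * s"
  shows "2 * \<beta> * D powr (- \<beta> - 2) * excess_moment e c \<Omega> \<le> sphere_area (CARD('n) - 2) * \<delta>"
proof -
  define n where "n = CARD('n)"
  have n: "0 < n" by (simp add: n_def)
  define c0 where "c0 = 2 * \<beta> * D powr (- \<beta> - 2)"
  define I where "I = excess_moment e c \<Omega>"
  define \<omega> where "\<omega> = sphere_area (CARD('n) - 2)"
  have \<beta>: "real CARD('n) < \<beta>" using s by (auto simp: \<beta>_def)
  have c00: "0 \<le> c0" using \<beta> by (simp add: c0_def)
  define t where "t = a \<bullet> e - c"
  have t: "0 < t" using a by (simp add: t_def)
  define a' where "a' = reflect e c a"
  define M where "M = (c0 * t * D + t powr - \<beta>) * unit_ball_vol n"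
  have M: "0 \<le> M" using c00 t D0 by (simp add: M_def)
  have "c0 * t * I \<le> sphere_area (CARD('n) - 2) / 2 * \<delta> * norm (a - a')"
  proof (rule potential_difference_bound[OF \<Omega>(1,3,4) s a(1)])
    show "a' \<in> frontier \<Omega>" using a by (simp add: a'_def)
    then show "\<bar>nonlocal_mean_curvature s \<Omega> a - nonlocal_mean_curvature s \<Omega> a'\<bar> \<le> \<delta> * norm (a - a')"
      using H a by blast
    have "((\<lambda>\<epsilon>. c0 * t * I - M * \<epsilon> ^ n) \<longlongrightarrow> c0 * t * I - M * 0 ^ n) (at_right 0)" by (intro tendsto_intros)
    then show "((\<lambda>\<epsilon>. c0 * t * I - M * \<epsilon> ^ n) \<longlongrightarrow> c0 * t * I) (at_right 0)" by (simp add: zero_power[OF n])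
    have "eventually (\<lambda>\<epsilon>. 0 < \<epsilon> \<and> \<epsilon> \<le> t) (at_right 0)"
      using t by (auto simp: eventually_at_right[OF t] intro!: exI[of _ t])
    then show "eventually (\<lambda>\<epsilon>. c0 * t * I - M * \<epsilon> ^ n \<le> outer_potential (real CARD('n) + 2 * s) \<Omega> a' \<epsilon> - outer_potential (real CARD('n) + 2 * s) \<Omega> a \<epsilon>) (at_right 0)"
      unfolding \<beta>_def[symmetric]
    proof eventually_elim
      case (elim \<epsilon>)
      have "measure lborel (excess e c \<Omega> \<inter> ball a' \<epsilon>) \<le> measure lborel (ball a' \<epsilon>)"
        using borel_excess[OF e] \<Omega> by (intro measure_mono_fmeasurable fmeasurable_ball) auto
      also have "\<dots> = unit_ball_vol n * \<epsilon> ^ n" using elim by (simp add: content_ball n_def)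
      finally have "(c0 * t * D + t powr - \<beta>) * measure lborel (excess e c \<Omega> \<inter> ball a' \<epsilon>) \<le> (c0 * t * D + t powr - \<beta>) * (unit_ball_vol n * \<epsilon> ^ n)"
        using c00 t D0 by (intro mult_left_mono) auto
      also have "\<dots> = M * \<epsilon> ^ n" by (simp add: M_def)
      finally show ?case
        using outer_potential_reflect_ge[OF e \<Omega>(1,2) cap, of \<beta> a D \<epsilon>] \<beta> D a elim
        unfolding a'_def I_def c0_def t_def by simp
    qed
  qed
  also have "norm (a - a') = 2 * t"
    using dist_reflect_self[OF e, of c a] t unfolding a'_def t_def by (simp add: norm_minus_commute)
  finally have "t * (c0 * I) \<le> t * (\<omega> * \<delta>)" by (simp add: \<omega>_def mult_ac)
  then show ?thesis using t by (simp add: c0_def I_def \<omega>_def)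
qed

section \<open>The critical plane and the barycenter\<close>

lemma exit_point:
  fixes \<Omega> :: "'a::euclidean_space set"
  assumes \<Omega>: "open \<Omega>" and x: "x \<in> \<Omega>" and T: "0 \<le> T" "x + T *\<^sub>R v \<notin> \<Omega>"
  obtains \<tau> where "0 < \<tau>" "\<tau> \<le> T" "x + \<tau> *\<^sub>R v \<in> frontier \<Omega>"
proof -
  have "closed_segment x (x + T *\<^sub>R v) \<inter> frontier \<Omega> \<noteq> {}"
    by (rule connected_Int_frontier) (use x T in auto)
  then obtain y where y: "y \<in> closed_segment x (x + T *\<^sub>R v)" "y \<in> frontier \<Omega>" by blast
  then obtain u where u: "0 \<le> u" "u \<le> 1" "y = (1 - u) *\<^sub>R x + u *\<^sub>R (x + T *\<^sub>R v)" by (auto simp: in_segment)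
  have yeq: "y = x + (u * T) *\<^sub>R v" using u(3) by (simp add: algebra_simps)
  have "u * T \<noteq> 0"
  proof
    assume "u * T = 0"
    then have "y = x" using yeq by simp
    then show False using y(2) x \<Omega> by (simp add: frontier_def interior_open)
  qed
  then have "0 < u * T" using u T by (simp add: less_le)
  moreover have "u * T \<le> T" using u T by (simp add: mult_left_le_one_le)
  ultimately show ?thesis using that yeq y(2) by blast
qed

lemma exit_point_ray:
  fixes \<Omega> :: "'a::euclidean_space set"
  assumes \<Omega>: "open \<Omega>" "bounded \<Omega>" and x: "x \<in> \<Omega>" and v: "norm v = 1"
  obtains \<tau> where "0 < \<tau>" "x + \<tau> *\<^sub>R v \<in> frontier \<Omega>"
proof -
  obtain R where R: "\<And>x. x \<in> \<Omega> \<Longrightarrow> norm x \<le> R" using \<Omega>(2) bounded_iff by blast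
  have R0: "0 \<le> R" using R[OF x] norm_ge_zero order_trans by blast
  have "R < norm (x + (2 * R + 1) *\<^sub>R v)"
    using norm_triangle_ineq2[of "(2 * R + 1) *\<^sub>R v" "- x"] R[OF x] R0 v by (simp add: add.commute)
  then have "x + (2 * R + 1) *\<^sub>R v \<notin> \<Omega>" using R by force
  then show ?thesis using exit_point[OF \<Omega>(1) x, of "2 * R + 1" v] R0 that by force
qed

definition boundary_pairs :: "'a::euclidean_space set \<Rightarrow> 'a \<Rightarrow> ('a \<times> 'a) set" where
  "boundary_pairs \<Omega> e = {(x, y). x \<in> frontier \<Omega> \<and> y \<in> frontier \<Omega> \<and> (\<exists>\<tau>>0. x - y = \<tau> *\<^sub>R e)}"

lemma boundary_pairs_nonempty:
  fixes \<Omega> :: "'a::euclidean_space set"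
  assumes \<Omega>: "open \<Omega>" "bounded \<Omega>" "\<Omega> \<noteq> {}" and e: "norm e = 1"
  shows "boundary_pairs \<Omega> e \<noteq> {}"
proof -
  obtain x where x: "x \<in> \<Omega>" using \<Omega> by blast
  obtain s where s: "0 < s" "x + s *\<^sub>R e \<in> frontier \<Omega>" using exit_point_ray[OF \<Omega>(1,2) x e] .
  have "norm (- e) = 1" using e by simp
  then obtain t where t: "0 < t" "x + t *\<^sub>R (- e) \<in> frontier \<Omega>" using exit_point_ray[OF \<Omega>(1,2) x] by blast
  have "(x + s *\<^sub>R e) - (x + t *\<^sub>R (- e)) = (s + t) *\<^sub>R e" by (simp add: algebra_simps)
  then have "(x + s *\<^sub>R e, x + t *\<^sub>R (- e)) \<in> boundary_pairs \<Omega> e"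
    using s t unfolding boundary_pairs_def by (auto intro!: exI[of _ "s + t"])
  then show ?thesis by blast
qed

text \<open>If the reflection of \<open>x\<close> were outside, the first boundary points above and below \<open>x\<close> would form a
  pair with midpoint beyond the plane.\<close>

lemma cap_reflects_into_if_midpoints_le:
  fixes \<Omega> :: "'a::euclidean_space set"
  assumes \<Omega>: "open \<Omega>" "bounded \<Omega>" and e: "norm e = 1"
    and mid: "\<And>x y. (x, y) \<in> boundary_pairs \<Omega> e \<Longrightarrow> (x + y) \<bullet> e / 2 \<le> c"
  shows "cap_reflects_into e c \<Omega>"
  unfolding cap_reflects_into_def
proof (intro ballI impI)
  fix x assume x: "x \<in> \<Omega>" "c < x \<bullet> e"
  have ee: "e \<bullet> e = 1" using e by (simp add: dot_square_norm)
  show "reflect e c x \<in> \<Omega>"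
  proof (rule ccontr)
    assume "reflect e c x \<notin> \<Omega>"
    then have "x + (2 * (x \<bullet> e - c)) *\<^sub>R (- e) \<notin> \<Omega>" by (simp add: reflect_def algebra_simps)
    then obtain t where t: "0 < t" "t \<le> 2 * (x \<bullet> e - c)" "x + t *\<^sub>R (- e) \<in> frontier \<Omega>"
      using exit_point[OF \<Omega>(1) x(1), of "2 * (x \<bullet> e - c)" "- e"] x(2) by auto
    obtain s where s: "0 < s" "x + s *\<^sub>R e \<in> frontier \<Omega>" using exit_point_ray[OF \<Omega> x(1) e] .
    have "(x + s *\<^sub>R e) - (x + t *\<^sub>R (- e)) = (s + t) *\<^sub>R e" by (simp add: algebra_simps)
    then have "(x + s *\<^sub>R e, x + t *\<^sub>R (- e)) \<in> boundary_pairs \<Omega> e"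
      using s t unfolding boundary_pairs_def by (auto intro!: exI[of _ "s + t"])
    from mid[OF this] show False using s t ee by (simp add: inner_add_left inner_diff_left field_simps)
  qed
qed

text \<open>The moving plane stops at the largest midpoint of a boundary pair; the supremum is attained by a
  reflected pair or by pairs collapsing to a point where the plane meets the boundary orthogonally.\<close>

lemma critical_plane:
  fixes \<Omega> :: "(real^'n) set"
  assumes \<Omega>: "open \<Omega>" "bounded \<Omega>" "\<Omega> \<noteq> {}" "C2_Hoelder_boundary \<alpha> \<Omega>" "\<alpha> \<le> 1" and s: "0 < s" "2 * s < \<alpha>"
    and e: "norm e = 1"
    and H: "\<And>x y. x \<in> frontier \<Omega> \<Longrightarrow> y \<in> frontier \<Omega> \<Longrightarrow>
      \<bar>nonlocal_mean_curvature s \<Omega> x - nonlocal_mean_curvature s \<Omega> y\<bar> \<le> \<delta> * norm (x - y)"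
    and \<delta>: "0 \<le> \<delta>" and D: "\<And>x a. x \<in> \<Omega> \<Longrightarrow> a \<in> frontier \<Omega> \<Longrightarrow> norm (x - a) \<le> D" and D0: "0 \<le> D"
    and \<beta>_def: "\<beta> = real CARD('n) + 2 * s"
  shows "\<exists>c. cap_reflects_into e c \<Omega> \<and>
     (\<forall>x y. (x, y) \<in> boundary_pairs \<Omega> e \<longrightarrow> (x + y) \<bullet> e / 2 \<le> c) \<and>
     2 * \<beta> * D powr (- \<beta> - 2) * excess_moment e c \<Omega> \<le> sphere_area (CARD('n) - 2) * \<delta>"
proof -
  define F where "F = frontier \<Omega>"
  have cF: "compact F" unfolding F_def using \<Omega>(2) by (rule compact_frontier_bounded)
  define P where "P = boundary_pairs \<Omega> e"
  have PF: "P \<subseteq> F \<times> F" by (auto simp: P_def boundary_pairs_def F_def)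
  have cFF: "compact (F \<times> F)" using cF by (intro compact_Times)
  then have clF: "closure P \<subseteq> F \<times> F" by (intro closure_minimal PF compact_imp_closed)
  \<comment> \<open>\<open>P\<close> itself need not be closed, as pairs can collapse to a single
    point; the supremum of the midpoints is therefore taken over its compact closure.\<close>
  have cP: "compact (closure P)"
    using compact_Int_closed[OF cFF closed_closure[of P]] clF by (simp add: Int_absorb1)
  have "P \<noteq> {}" unfolding P_def by (rule boundary_pairs_nonempty[OF \<Omega>(1-3) e])
  then have "closure P \<noteq> {}" by simp
  have ee: "e \<bullet> e = 1" using e by (simp add: dot_square_norm)
  define m where "m z = (fst z + snd z) \<bullet> e / 2" for z :: "(real^'n) \<times> (real^'n)"
  have "continuous_on (closure P) m" unfolding m_def by (intro continuous_intros) auto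
  then obtain z where z: "z \<in> closure P" "\<And>w. w \<in> closure P \<Longrightarrow> m w \<le> m z"
    using continuous_attains_sup[OF cP \<open>closure P \<noteq> {}\<close>] by blast
  define c where "c = m z"
  have mid: "(x + y) \<bullet> e / 2 \<le> c" if "(x, y) \<in> boundary_pairs \<Omega> e" for x y
    using z(2)[of "(x, y)"] that closure_subset[of P] by (auto simp: c_def m_def P_def)
  have cap: "cap_reflects_into e c \<Omega>" by (rule cap_reflects_into_if_midpoints_le[OF \<Omega>(1,2) e mid])
  obtain X where X: "\<And>k. X k \<in> P" "X \<longlonglongrightarrow> z" using z(1) closure_sequential by blast
  define x y where "x = fst z" and "y = snd z"
  define xk yk where "xk k = fst (X k)" and "yk k = snd (X k)" for k
  have lim: "xk \<longlonglongrightarrow> x" "yk \<longlonglongrightarrow> y" unfolding xk_def[abs_def] yk_def[abs_def] x_def y_def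
    by (intro tendsto_intros X)+
  have fr: "x \<in> frontier \<Omega>" "y \<in> frontier \<Omega>"
    using z(1) clF unfolding x_def y_def F_def by (auto dest!: subsetD)
  define \<tau> where "\<tau> k = (xk k - yk k) \<bullet> e" for k
  have k: "xk k \<in> frontier \<Omega>" "yk k \<in> frontier \<Omega>" "0 < \<tau> k" "xk k - yk k = \<tau> k *\<^sub>R e" for k
  proof -
    have "X k \<in> boundary_pairs \<Omega> e" using X(1) by (simp add: P_def)
    then obtain t where t: "xk k \<in> frontier \<Omega>" "yk k \<in> frontier \<Omega>" "0 < t" "xk k - yk k = t *\<^sub>R e"
      by (auto simp: boundary_pairs_def xk_def yk_def)
    moreover have "\<tau> k = t" using t ee by (simp add: \<tau>_def)
    ultimately show "xk k \<in> frontier \<Omega>" "yk k \<in> frontier \<Omega>" "0 < \<tau> k" "xk k - yk k = \<tau> k *\<^sub>R e" by auto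
  qed
  define t where "t = (x - y) \<bullet> e"
  have \<tau>_lim: "\<tau> \<longlonglongrightarrow> t" unfolding \<tau>_def[abs_def] t_def by (intro tendsto_intros lim)
  have t0: "0 \<le> t" using \<tau>_lim k(3) by (intro LIMSEQ_le_const) (auto intro: less_imp_le)
  have "(\<lambda>k. xk k - yk k) \<longlonglongrightarrow> t *\<^sub>R e" unfolding k(4) by (intro tendsto_intros \<tau>_lim)
  moreover have "(\<lambda>k. xk k - yk k) \<longlonglongrightarrow> x - y" by (intro tendsto_intros lim)
  ultimately have xy: "x - y = t *\<^sub>R e" by (rule LIMSEQ_unique[rotated])
  have cxy: "c = (x + y) \<bullet> e / 2" by (simp add: c_def m_def x_def y_def)
  have y_eq: "y = x - t *\<^sub>R e" using xy by (simp add: algebra_simps)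
  have xe: "x \<bullet> e = c + t / 2" 
  proof -
    have "y \<bullet> e = x \<bullet> e - t" unfolding y_eq using ee by (simp add: inner_diff_left)
    then show ?thesis unfolding cxy inner_add_left by (simp add: field_simps)
  qed
  have "2 * \<beta> * D powr (- \<beta> - 2) * excess_moment e c \<Omega> \<le> sphere_area (CARD('n) - 2) * \<delta>"
  proof (cases "t = 0")
    case False
    then have "0 < t" using t0 by simp
    have "reflect e c x = y" unfolding reflect_def xe y_eq by simp
    then show ?thesis
      by (intro reflected_pair_excess_bound[OF \<Omega>(1,2,4,5) s e cap fr(1) _ _ H D D0 \<beta>_def])
         (use fr xe \<open>0 < t\<close> in auto)
  next
    case True
    then have yx: "y = x" using y_eq by simp
    have \<alpha>0: "0 < \<alpha>" using s by linarith
    obtain r \<nu> g G A K where ch: "C2_graph \<Omega> x r \<nu> g G A K \<alpha>"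
      using C2_graph_exists[OF \<Omega>(1,4) \<alpha>0 \<Omega>(5) fr(1)] .
    interpret C2_graph \<Omega> x r \<nu> g G A K \<alpha> by (rule ch)
    have g0: "g x = 0" using frontier_iff[of x] fr r_pos by simp
    \<comment> \<open>\<open>g\<close> vanishes at \<open>xk k\<close> and \<open>yk k\<close>,
      which differ by \<open>\<tau> k\<close> times \<open>e\<close>. Taylor expansion at
      \<open>yk k\<close>, divided by \<open>\<tau> k\<close>, shows that the derivative of
      \<open>g\<close> along \<open>e\<close> there is of order \<open>\<tau> k\<close>; the last
      term transfers this to \<open>x\<close>. In the limit \<open>e\<close> is tangential at
      \<open>x\<close>.\<close>
    have "eventually (\<lambda>k. \<bar>G x \<bullet> e\<bar> \<le> MA / 2 * \<tau> k + K * \<tau> k + MA * norm (yk k - x)) sequentially"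
    proof -
      have "eventually (\<lambda>k. xk k \<in> ball x r) sequentially"
        using lim(1) r_pos by (intro topological_tendstoD) auto
      moreover have "eventually (\<lambda>k. yk k \<in> ball x r) sequentially"
        using lim(2) r_pos yx by (intro topological_tendstoD[where l=y]) auto
      moreover have "eventually (\<lambda>k. \<tau> k < 1) sequentially"
        using \<tau>_lim True by (intro order_tendstoD(2)) auto
      ultimately show ?thesis
      proof eventually_elim
        case (elim k')
        have gk: "g (xk k') = 0" "g (yk k') = 0" using frontier_iff elim k by auto
        have xk_eq: "xk k' = yk k' + \<tau> k' *\<^sub>R e" using k(4)[of k'] by (simp add: algebra_simps)
        have \<tau>n: "norm (\<tau> k' *\<^sub>R e) = \<tau> k'" using k(3)[of k'] e by simp
        have "\<bar>G (yk k') \<bullet> (\<tau> k' *\<^sub>R e) + quad (yk k') (\<tau> k' *\<^sub>R e)\<bar> \<le> K * \<tau> k' powr \<alpha> * (\<tau> k')\<^sup>2"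
          using taylor[of "yk k'" "\<tau> k' *\<^sub>R e"] elim gk \<tau>n unfolding xk_eq[symmetric] by (simp add: abs_minus_commute)
        moreover have "\<bar>quad (yk k') (\<tau> k' *\<^sub>R e)\<bar> \<le> MA / 2 * (\<tau> k')\<^sup>2"
          using quad_bound[of "yk k'" "\<tau> k' *\<^sub>R e"] elim \<tau>n by simp
        moreover have "K * \<tau> k' powr \<alpha> * (\<tau> k')\<^sup>2 \<le> K * 1 * (\<tau> k')\<^sup>2"
          using K powr_le1[of \<alpha> "\<tau> k'"] \<alpha> elim k(3)[of k'] by (intro mult_right_mono mult_left_mono) auto
        ultimately have "\<bar>G (yk k') \<bullet> (\<tau> k' *\<^sub>R e)\<bar> \<le> MA / 2 * (\<tau> k')\<^sup>2 + K * (\<tau> k')\<^sup>2" by linarith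
        then have "\<tau> k' * \<bar>G (yk k') \<bullet> e\<bar> \<le> \<tau> k' * (MA / 2 * \<tau> k' + K * \<tau> k')"
          using k(3)[of k'] by (simp add: abs_mult power2_eq_square algebra_simps)
        then have "\<bar>G (yk k') \<bullet> e\<bar> \<le> MA / 2 * \<tau> k' + K * \<tau> k'"
          using k(3)[of k'] by (simp only: mult_le_cancel_left_pos)
        moreover have "\<bar>G (yk k') \<bullet> e - G x \<bullet> e\<bar> \<le> MA * norm (yk k' - x)"
        proof -
          have "\<bar>(G (yk k') - G x) \<bullet> e\<bar> \<le> norm (G (yk k') - G x) * norm e" by (rule Cauchy_Schwarz_ineq2)
          also have "\<dots> \<le> MA * norm (yk k' - x)" using G_Lipschitz[of "yk k'" x] elim r_pos e by simp
          finally show ?thesis by (simp add: inner_diff_left)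
        qed
        ultimately show ?case by linarith
      qed
    qed
    moreover have "(\<lambda>k. MA / 2 * \<tau> k + K * \<tau> k + MA * norm (yk k - x)) \<longlonglongrightarrow> MA / 2 * 0 + K * 0 + MA * norm (x - x)"
      using \<tau>_lim lim(2) True yx by (intro tendsto_intros) auto
    ultimately have "\<bar>G x \<bullet> e\<bar> \<le> MA / 2 * 0 + K * 0 + MA * norm (x - x)"
      by (intro tendsto_lowerbound[where F=sequentially]) auto
    then have tangent: "G x \<bullet> e = 0" by simp
    have "c = x \<bullet> e" using xe True by simp
    then show ?thesis
      by (intro tangent_plane_excess_bound[OF g0 e tangent _ cap \<Omega>(2,4) s H \<delta> D D0 \<beta>_def])
  qed
  then show ?thesis using cap mid by blast
qed

section \<open>Distance of the critical planes from the barycenter\<close>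

definition barycenter :: "'a::euclidean_space set \<Rightarrow> 'a" where
  "barycenter \<Omega> = (1 / measure lborel \<Omega>) *\<^sub>R (LINT x|lborel. indicator \<Omega> x *\<^sub>R x)"

lemma measure_bounded_open_pos:
  fixes \<Omega> :: "'a::euclidean_space set"
  assumes "open \<Omega>" "bounded \<Omega>" "\<Omega> \<noteq> {}"
  shows "0 < measure lborel \<Omega>"
proof -
  obtain x d where "0 < d" "ball x d \<subseteq> \<Omega>" using assms(1,3) openE by blast
  moreover have "\<Omega> \<in> fmeasurable lborel"
    using assms emeasure_bounded_finite[of \<Omega>] by (intro fmeasurableI) auto
  ultimately have "measure lborel (ball x d) \<le> measure lborel \<Omega>" by (intro measure_mono_fmeasurable) auto
  moreover have "0 < measure lborel (ball x d)" using \<open>0 < d\<close> by (rule content_ball_pos)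
  ultimately show ?thesis by linarith
qed

lemma
  fixes \<Omega> :: "'a::euclidean_space set"
  assumes \<Omega>: "open \<Omega>" "bounded \<Omega>" "\<Omega> \<noteq> {}"
  shows integral_inner_barycenter: "(LINT x|lborel. indicator \<Omega> x * (c - x \<bullet> e)) = measure lborel \<Omega> * (c - barycenter \<Omega> \<bullet> e)"
    and norm_diff_barycenter_le: "(\<And>x. x \<in> \<Omega> \<Longrightarrow> norm (x - z) \<le> D) \<Longrightarrow> norm (z - barycenter \<Omega>) \<le> D"
proof -
  define V where "V = measure lborel \<Omega>"
  have V: "0 < V" unfolding V_def by (rule measure_bounded_open_pos[OF \<Omega>])
  obtain R where R: "\<And>x. x \<in> \<Omega> \<Longrightarrow> norm x \<le> R" using \<Omega>(2) bounded_iff by blast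
  have iO: "integrable lborel (indicator \<Omega> :: 'a \<Rightarrow> real)"
    using emeasure_bounded_finite[OF \<Omega>(2)] \<Omega> by (intro integrable_real_indicator) auto
  have ix: "integrable lborel (\<lambda>x. indicator \<Omega> x *\<^sub>R x)"
  proof (rule Bochner_Integration.integrable_bound)
    show "integrable lborel (\<lambda>x. R * indicator \<Omega> x)" using iO by simp
    show "(\<lambda>x. indicator \<Omega> x *\<^sub>R x) \<in> borel_measurable lborel" using \<Omega>(1) by (intro borel_measurable_scaleR) auto
    show "AE x in lborel. norm (indicator \<Omega> x *\<^sub>R x) \<le> norm (R * indicator \<Omega> x)"
      using R by (intro AE_I2) (force simp: indicator_def)
  qed
  have mV: "(LINT x|lborel. indicator \<Omega> x) = V" using \<Omega>(1) by (simp add: V_def)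
  have bV: "(LINT x|lborel. indicator \<Omega> x *\<^sub>R x) = V *\<^sub>R barycenter \<Omega>"
    using V by (simp add: barycenter_def V_def)
  have ie: "integrable lborel (\<lambda>x. (indicator \<Omega> x *\<^sub>R x) \<bullet> e)" using ix by (rule integrable_inner_left)
  have "(LINT x|lborel. indicator \<Omega> x * (c - x \<bullet> e)) = (LINT x|lborel. c * indicator \<Omega> x - (indicator \<Omega> x *\<^sub>R x) \<bullet> e)"
    by (intro Bochner_Integration.integral_cong) (auto simp: algebra_simps)
  also have "\<dots> = (LINT x|lborel. c * indicator \<Omega> x) - (LINT x|lborel. (indicator \<Omega> x *\<^sub>R x) \<bullet> e)"
    using iO ie by (intro Bochner_Integration.integral_diff) auto
  also have "(LINT x|lborel. (indicator \<Omega> x *\<^sub>R x) \<bullet> e) = V * (barycenter \<Omega> \<bullet> e)"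
    using integral_inner_left[of e lborel "\<lambda>x. indicator \<Omega> x *\<^sub>R x"] ix bV by simp
  finally show "(LINT x|lborel. indicator \<Omega> x * (c - x \<bullet> e)) = measure lborel \<Omega> * (c - barycenter \<Omega> \<bullet> e)"
    using mV by (simp add: V_def algebra_simps)
  assume D: "\<And>x. x \<in> \<Omega> \<Longrightarrow> norm (x - z) \<le> D"
  have "(LINT x|lborel. indicator \<Omega> x *\<^sub>R (x - z)) = (LINT x|lborel. indicator \<Omega> x *\<^sub>R x - indicator \<Omega> x *\<^sub>R z)"
    by (simp add: scaleR_diff_right)
  also have "\<dots> = V *\<^sub>R barycenter \<Omega> - V *\<^sub>R z"
    using ix iO bV mV by simp
  finally have "norm (V *\<^sub>R barycenter \<Omega> - V *\<^sub>R z) = norm (LINT x|lborel. indicator \<Omega> x *\<^sub>R (x - z))" by simp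
  also have "\<dots> \<le> (LINT x|lborel. D * indicator \<Omega> x)"
  proof (rule Bochner_Integration.integral_norm_bound_integral)
    show "integrable lborel (\<lambda>x. indicator \<Omega> x *\<^sub>R (x - z))" using ix iO by (simp add: scaleR_diff_right)
    show "integrable lborel (\<lambda>x. D * indicator \<Omega> x)" using iO by simp
    show "norm (indicator \<Omega> x *\<^sub>R (x - z)) \<le> D * indicator \<Omega> x" for x using D by (auto simp: indicator_def)
  qed
  also have "\<dots> = V * D" using mV by simp
  finally have "V * norm (barycenter \<Omega> - z) \<le> V * D" using V by (simp flip: scaleR_diff_right)
  then show "norm (z - barycenter \<Omega>) \<le> D" using V by (simp add: norm_minus_commute)
qed

text \<open>The constant is \<open>sphere_area (CARD('n) - 2) * \<delta>\<close> divided by the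
  kernel factor \<open>2 * \<beta> * D powr (- \<beta> - 2)\<close> of \<open>critical_plane\<close>
  and by the volume, which converts the moment of the excess into the distance of the plane from the
  barycenter.\<close>

lemma boundary_almost_spherical:
  fixes \<Omega> :: "(real^'n) set"
  assumes \<Omega>: "open \<Omega>" "bounded \<Omega>" "\<Omega> \<noteq> {}" "C2_Hoelder_boundary \<alpha> \<Omega>" "\<alpha> \<le> 1" and s: "0 < s" "2 * s < \<alpha>"
    and H: "\<And>x y. x \<in> frontier \<Omega> \<Longrightarrow> y \<in> frontier \<Omega> \<Longrightarrow>
      \<bar>nonlocal_mean_curvature s \<Omega> x - nonlocal_mean_curvature s \<Omega> y\<bar> \<le> \<delta> * norm (x - y)"
    and \<delta>: "0 \<le> \<delta>" and D: "\<And>x a. x \<in> \<Omega> \<Longrightarrow> a \<in> frontier \<Omega> \<Longrightarrow> norm (x - a) \<le> D" and D0: "0 < D"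
    and \<beta>_def: "\<beta> = real CARD('n) + 2 * s"
    and x: "x \<in> frontier \<Omega>" and y: "y \<in> frontier \<Omega>"
  shows "(norm (x - barycenter \<Omega>))\<^sup>2 - (norm (y - barycenter \<Omega>))\<^sup>2
    \<le> 2 * (sphere_area (CARD('n) - 2) * \<delta> * D powr (\<beta> + 2) / (2 * \<beta> * measure lborel \<Omega>)) * norm (x - y)"
proof (cases "x = y")
  case True then show ?thesis by simp
next
  case False
  define b where "b = barycenter \<Omega>"
  define V where "V = measure lborel \<Omega>"
  have V: "0 < V" unfolding V_def by (rule measure_bounded_open_pos[OF \<Omega>(1-3)])
  have \<beta>: "0 < \<beta>" using s by (auto simp: \<beta>_def)
  define d where "d = norm (x - y)"
  have d: "0 < d" using False by (simp add: d_def)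
  define e where "e = (1 / d) *\<^sub>R (x - y)"
  have e: "norm e = 1" using d by (simp add: e_def d_def)
  have xy: "x - y = d *\<^sub>R e" using d by (simp add: e_def)
  obtain c where c: "cap_reflects_into e c \<Omega>" "\<And>x y. (x, y) \<in> boundary_pairs \<Omega> e \<Longrightarrow> (x + y) \<bullet> e / 2 \<le> c"
     "2 * \<beta> * D powr (- \<beta> - 2) * excess_moment e c \<Omega> \<le> sphere_area (CARD('n) - 2) * \<delta>"
    using critical_plane[OF \<Omega> s e H \<delta> D less_imp_le[OF D0] \<beta>_def] by blast
  have "(x, y) \<in> boundary_pairs \<Omega> e" using x y xy d by (auto simp: boundary_pairs_def)
  then have m: "(x + y) \<bullet> e / 2 \<le> c" by (rule c(2))
  have I: "excess_moment e c \<Omega> = V * (c - b \<bullet> e)"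
    using excess_moment_eq[OF e \<Omega>(1,2) c(1)] integral_inner_barycenter[OF \<Omega>(1-3)] by (simp add: V_def b_def)
  have DD: "D powr (\<beta> + 2) * D powr (- \<beta> - 2) = 1" using D0 by (simp flip: powr_add)
  have "2 * \<beta> * V * (c - b \<bullet> e) = D powr (\<beta> + 2) * (2 * \<beta> * D powr (- \<beta> - 2) * excess_moment e c \<Omega>)"
    unfolding I using DD by (simp add: mult_ac)
  also have "\<dots> \<le> D powr (\<beta> + 2) * (sphere_area (CARD('n) - 2) * \<delta>)" using c(3) by (intro mult_left_mono) auto
  finally have ce: "c - b \<bullet> e \<le> sphere_area (CARD('n) - 2) * \<delta> * D powr (\<beta> + 2) / (2 * \<beta> * V)"
    using \<beta> V by (simp add: field_simps)
  have "(norm (x - b))\<^sup>2 - (norm (y - b))\<^sup>2 = ((x - b) + (y - b)) \<bullet> (x - y)"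
  proof -
    have "(norm u)\<^sup>2 - (norm v)\<^sup>2 = (u + v) \<bullet> (u - v)" for u v :: "real^'n"
      unfolding power2_norm_eq_inner by (simp only: inner_diff_right inner_add_left) (simp add: inner_commute)
    from this[of "x - b" "y - b"] show ?thesis by (simp only: diff_diff_eq2 diff_add_cancel)
  qed
  also have "\<dots> = 2 * d * ((x + y) \<bullet> e / 2 - b \<bullet> e)"
    unfolding xy by (simp only: inner_add_left inner_diff_left inner_scaleR_right) (simp add: field_simps)
  also have "\<dots> \<le> 2 * d * (sphere_area (CARD('n) - 2) * \<delta> * D powr (\<beta> + 2) / (2 * \<beta> * V))"
    using m ce d by (intro mult_left_mono) auto
  finally show ?thesis by (simp add: b_def d_def V_def mult_ac)
qed

section \<open>Almost spherical domains\<close>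

text \<open>From here on the curvature is present only through the inequality \<open>pair\<close>.
  It holds for both orders of \<open>x\<close> and \<open>y\<close>, so it bounds the absolute value
  of the difference of squares.\<close>

locale almost_spherical =
  fixes \<Omega> :: "(real^'n) set" and b :: "real^'n" and \<epsilon> :: real
  assumes \<Omega>: "open \<Omega>" "bounded \<Omega>" "\<Omega> \<noteq> {}" and \<epsilon>: "0 \<le> \<epsilon>"
    and pair: "\<And>x y. x \<in> frontier \<Omega> \<Longrightarrow> y \<in> frontier \<Omega> \<Longrightarrow>
      (norm (x - b))\<^sup>2 - (norm (y - b))\<^sup>2 \<le> 2 * \<epsilon> * norm (x - y)"
begin

lemma not_mem_frontier: "x \<in> \<Omega> \<Longrightarrow> x \<notin> frontier \<Omega>"
  using \<Omega>(1) by (simp add: frontier_def interior_open)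

text \<open>For a farthest and a nearest boundary point, \<open>pair\<close> and
  \<open>norm (x - y) \<le> R + \<rho>\<close> bound the difference of the squared radii by
  \<open>2 * \<epsilon> * (R + \<rho>)\<close>, and the factor \<open>R + \<rho>\<close> cancels. A
  point of \<Omega> is at distance less than \<open>R\<close>, since the outward ray from it meets
  the boundary further out.\<close>

lemma annulus_exists:
  "\<exists>\<rho> R. 0 \<le> \<rho> \<and> R \<le> \<rho> + 2 * \<epsilon> \<and> (\<forall>x\<in>frontier \<Omega>. \<rho> \<le> norm (x - b) \<and> norm (x - b) \<le> R) \<and>
     \<Omega> \<subseteq> ball b R \<and> (\<exists>x\<in>frontier \<Omega>. norm (x - b) = R) \<and> (\<exists>x\<in>frontier \<Omega>. norm (x - b) = \<rho>)"
proof -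
  obtain z where z: "z \<in> \<Omega>" using \<Omega> by blast
  define u :: "real^'n" where "u = axis undefined 1"
  have u: "norm u = 1" by (simp add: u_def norm_axis_1)
  have "frontier \<Omega> \<noteq> {}" using exit_point_ray[OF \<Omega>(1,2) z u] by blast
  moreover have "compact (frontier \<Omega>)" using \<Omega>(2) by (rule compact_frontier_bounded)
  moreover have "continuous_on (frontier \<Omega>) (\<lambda>x. norm (x - b))" by (intro continuous_intros)
  ultimately obtain x y where x: "x \<in> frontier \<Omega>" "\<And>v. v \<in> frontier \<Omega> \<Longrightarrow> norm (v - b) \<le> norm (x - b)"
    and y: "y \<in> frontier \<Omega>" "\<And>v. v \<in> frontier \<Omega> \<Longrightarrow> norm (y - b) \<le> norm (v - b)"
    by (metis continuous_attains_sup continuous_attains_inf)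
  define R \<rho> where "R = norm (x - b)" and "\<rho> = norm (y - b)"
  have sub: "v \<in> ball b R" if v: "v \<in> \<Omega>" for v
  proof -
    \<comment> \<open>At \<open>v = b\<close> there is no outward direction and any unit vector
      serves.\<close>
    define w where "w = (if v = b then u else (1 / norm (v - b)) *\<^sub>R (v - b))"
    have w: "norm w = 1" using u by (simp add: w_def)
    have vw: "v - b = norm (v - b) *\<^sub>R w" by (simp add: w_def)
    obtain t where t: "0 < t" "v + t *\<^sub>R w \<in> frontier \<Omega>" using exit_point_ray[OF \<Omega>(1,2) v w] .
    have "v + t *\<^sub>R w - b = (norm (v - b) + t) *\<^sub>R w" using vw by (simp add: scaleR_add_left algebra_simps)
    then have "norm (v + t *\<^sub>R w - b) = norm (v - b) + t" using w t by simp
    then have "norm (v - b) < R" using x(2)[OF t(2)] t by (simp add: R_def)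
    then show ?thesis by (simp add: dist_norm norm_minus_commute)
  qed
  have R0: "0 < R" using sub[OF z] by (metis dist_not_less_zero less_trans mem_ball not_less_iff_gr_or_eq)
  have \<rho>0: "0 \<le> \<rho>" by (simp add: \<rho>_def)
  have "norm (x - y) \<le> R + \<rho>"
    using norm_triangle_ineq4[of "x - b" "y - b"] by (simp add: R_def \<rho>_def)
  then have "2 * \<epsilon> * norm (x - y) \<le> 2 * \<epsilon> * (R + \<rho>)" using \<epsilon> by (intro mult_left_mono) auto
  then have "R\<^sup>2 - \<rho>\<^sup>2 \<le> 2 * \<epsilon> * (R + \<rho>)" using pair[OF x(1) y(1)] unfolding R_def \<rho>_def by linarith
  then have "(R + \<rho>) * (R - \<rho>) \<le> (R + \<rho>) * (2 * \<epsilon>)" by (simp add: power2_eq_square algebra_simps)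
  then have "R - \<rho> \<le> 2 * \<epsilon>" using R0 \<rho>0 by (simp add: mult_le_cancel_left_pos)
  then have "R \<le> \<rho> + 2 * \<epsilon>" by simp
  moreover have "\<forall>v\<in>frontier \<Omega>. \<rho> \<le> norm (v - b) \<and> norm (v - b) \<le> R" using x y by (simp add: R_def \<rho>_def)
  moreover have "\<Omega> \<subseteq> ball b R" using sub by blast
  moreover have "\<exists>v\<in>frontier \<Omega>. norm (v - b) = R" using x(1) R_def by blast
  moreover have "\<exists>v\<in>frontier \<Omega>. norm (v - b) = \<rho>" using y(1) \<rho>_def by blast
  ultimately show ?thesis using \<rho>0 by (rule_tac x=\<rho> in exI, rule_tac x=R in exI) simp
qed

text \<open>Connectedness leaves two possibilities for the inner ball: it lies in \<Omega> or misses
  it. The second occurs for domains that look like thin shells.\<close>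

lemma ball_meets_imp_subset:
  assumes "\<forall>x\<in>frontier \<Omega>. \<rho> \<le> norm (x - b)" and "ball b \<rho> \<inter> \<Omega> \<noteq> {}"
  shows "ball b \<rho> \<subseteq> \<Omega>"
proof (rule ccontr)
  assume "\<not> ball b \<rho> \<subseteq> \<Omega>"
  then have "ball b \<rho> \<inter> frontier \<Omega> \<noteq> {}"
    by (intro connected_Int_frontier assms(2)) auto
  then show False using assms(1) by (force simp: dist_norm norm_minus_commute)
qed

lemma diameter_le_outer_radius:
  assumes "\<Omega> \<subseteq> ball b R"
  shows "diameter \<Omega> \<le> 2 * R"
proof (rule diameter_le)
  show "norm (x - y) \<le> 2 * R" if "x \<in> \<Omega>" "y \<in> \<Omega>" for x y
  proof -
    have "norm (x - b) < R" "norm (y - b) < R" using that assms by (auto simp: dist_norm norm_minus_commute)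
    then show ?thesis using norm_triangle_ineq4[of "x - b" "y - b"] by simp
  qed
qed (use \<Omega> in auto)

text \<open>The inner ball then misses \<Omega>, which is squeezed into a shell of thickness at most
  \<open>2 * \<epsilon>\<close>. Read backwards, \<epsilon> and with it the deficit cannot be small
  in this case.\<close>

lemma measure_le_if_center_outside:
  assumes fr: "\<forall>x\<in>frontier \<Omega>. \<rho> \<le> norm (x - b)" and \<rho>: "0 \<le> \<rho>" and R: "\<Omega> \<subseteq> ball b R" "R \<le> \<rho> + 2 * \<epsilon>" "R \<le> D" "\<rho> \<le> R"
    and b: "b \<notin> \<Omega>"
  shows "measure lborel \<Omega> \<le> unit_ball_vol CARD('n) * (real CARD('n) * D ^ (CARD('n) - 1) * (2 * \<epsilon>))"
proof -
  define n where "n = CARD('n)"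
  have n: "0 < n" by (simp add: n_def)
  have "ball b \<rho> \<inter> \<Omega> = {}"
  proof (rule ccontr)
    assume ne: "ball b \<rho> \<inter> \<Omega> \<noteq> {}"
    then have "ball b \<rho> \<subseteq> \<Omega>" by (rule ball_meets_imp_subset[OF fr])
    moreover have "0 < \<rho>" using ne by (metis Int_empty_left ball_empty not_le)
    ultimately show False using b centre_in_ball by blast
  qed
  then have "\<Omega> \<subseteq> ball b R - ball b \<rho>" using R by blast
  then have "measure lborel \<Omega> \<le> measure lborel (ball b R - ball b \<rho>)"
    using \<Omega>(1) by (intro measure_mono_fmeasurable fmeasurable_subset_ball[of _ b R]) auto
  also have "\<dots> = measure lborel (ball b R) - measure lborel (ball b \<rho>)"
    using fmeasurable_ball[of b R] R \<rho> by (intro measure_Diff) (auto dest: fmeasurableD2)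
  also have "\<dots> = unit_ball_vol n * (R ^ n - \<rho> ^ n)"
    using R \<rho> by (simp add: content_ball n_def algebra_simps)
  also have "\<dots> \<le> unit_ball_vol n * (real n * R ^ (n - 1) * (R - \<rho>))"
    using R \<rho> n by (intro mult_left_mono power_diff_le) auto
  also have "\<dots> \<le> unit_ball_vol n * (real n * D ^ (n - 1) * (2 * \<epsilon>))"
    using R \<rho> \<epsilon> by (intro mult_left_mono mult_mono power_mono) auto
  finally show ?thesis by (simp add: n_def)
qed

lemma frontier_dilation:
  assumes "0 < \<kappa>"
  shows "frontier ((\<lambda>x. \<kappa> *\<^sub>R x) ` \<Omega>) = (\<lambda>x. \<kappa> *\<^sub>R x) ` frontier \<Omega>"
proof -
  have "open ((\<lambda>x. \<kappa> *\<^sub>R x) ` \<Omega>)" using \<Omega>(1) assms by (intro open_scaling) auto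
  then have "frontier ((\<lambda>x. \<kappa> *\<^sub>R x) ` \<Omega>) = (\<lambda>x. \<kappa> *\<^sub>R x) ` closure \<Omega> - (\<lambda>x. \<kappa> *\<^sub>R x) ` \<Omega>"
    by (simp add: frontier_def interior_open closure_scaleR)
  also have "\<dots> = (\<lambda>x. \<kappa> *\<^sub>R x) ` (closure \<Omega> - \<Omega>)"
    using assms by (intro image_set_diff[symmetric]) (auto simp: inj_on_def)
  finally show ?thesis using \<Omega>(1) by (simp add: frontier_def interior_open)
qed

text \<open>On a single ray \<open>pair\<close> gives \<open>w + w' \<le> 2 * \<epsilon>\<close> for
  two boundary radii, impossible as both are at least \<rho>; so the boundary is a radial graph
  \<open>u\<close>. On two rays it gives \<open>\<bar>u x - u y\<bar> \<le> k * d\<close> with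
  \<open>d\<close> the distance of the boundary points. Scaling by \<open>1 / \<rho>\<close> makes
  all radii at least 1, so \<open>F\<close> does not decrease distances and the whole error sits in
  the upper bound.\<close>

lemma radial_parametrization:
  assumes b: "b \<in> \<Omega>" and \<rho>: "0 < \<rho>" and fr: "\<And>x. x \<in> frontier \<Omega> \<Longrightarrow> \<rho> \<le> norm (x - b) \<and> norm (x - b) \<le> \<rho> + 2 * \<epsilon>"
    and k: "\<epsilon> / \<rho> \<le> 1 / 4"
  shows "\<exists>F :: real^'n \<Rightarrow> real^'n. bilipschitz_map (sphere 0 1) (frontier ((\<lambda>x. (1 / \<rho>) *\<^sub>R x) ` \<Omega>)) F \<and>
     (\<forall>x\<in>sphere 0 1. \<forall>y\<in>sphere 0 1. norm (x - y) \<le> norm (F x - F y) \<and>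
        norm (F x - F y) \<le> (1 + 4 * (\<epsilon> / \<rho>)) * norm (x - y))"
proof -
  define k where "k = \<epsilon> / \<rho>"
  have k0: "0 \<le> k" "k \<le> 1 / 4" using \<epsilon> \<rho> k by (auto simp: k_def)
  have \<epsilon>k: "\<epsilon> = k * \<rho>" using \<rho> by (simp add: k_def)
  define S where "S = sphere (0::real^'n) 1"
  have "\<exists>t. 0 < t \<and> b + t *\<^sub>R \<theta> \<in> frontier \<Omega>" if "\<theta> \<in> S" for \<theta>
    using exit_point_ray[OF \<Omega>(1,2) b, of \<theta>] that by (auto simp: S_def)
  then obtain u where u: "\<And>\<theta>. \<theta> \<in> S \<Longrightarrow> 0 < u \<theta>" "\<And>\<theta>. \<theta> \<in> S \<Longrightarrow> b + u \<theta> *\<^sub>R \<theta> \<in> frontier \<Omega>"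
    by metis
  have nS: "norm \<theta> = 1" if "\<theta> \<in> S" for \<theta> using that by (simp add: S_def)
  have ub: "\<rho> \<le> u \<theta>" "u \<theta> \<le> \<rho> * (1 + 2 * k)" if "\<theta> \<in> S" for \<theta>
    using fr[OF u(2)[OF that]] u(1)[OF that] nS[OF that] by (auto simp: \<epsilon>k algebra_simps)
  have uniq: "t = t'" if t: "0 < t" "0 < t'" "norm \<theta> = 1" "b + t *\<^sub>R \<theta> \<in> frontier \<Omega>" "b + t' *\<^sub>R \<theta> \<in> frontier \<Omega>" for t t' \<theta>
  proof -
    have tb: "\<rho> \<le> t" "\<rho> \<le> t'" using fr[OF t(4)] fr[OF t(5)] t by auto
    have no: False if w: "\<rho> \<le> w'" "w' < w" "b + w *\<^sub>R \<theta> \<in> frontier \<Omega>" "b + w' *\<^sub>R \<theta> \<in> frontier \<Omega>" for w w'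
    proof -
      have "b + w *\<^sub>R \<theta> - (b + w' *\<^sub>R \<theta>) = (w - w') *\<^sub>R \<theta>" by (simp add: algebra_simps)
      then have "norm (b + w *\<^sub>R \<theta> - (b + w' *\<^sub>R \<theta>)) = w - w'" using w t by simp
      then have "w\<^sup>2 - w'\<^sup>2 \<le> 2 * \<epsilon> * (w - w')" using pair[OF w(3,4)] t w \<rho> by simp
      then have "(w - w') * (w + w') \<le> (w - w') * (2 * \<epsilon>)" by (simp add: power2_eq_square algebra_simps)
      then have "w + w' \<le> 2 * \<epsilon>" using w by (simp add: mult_le_cancel_left_pos)
      moreover have "2 * \<epsilon> \<le> 2 * (1 / 4 * \<rho>)" unfolding \<epsilon>k using k0 \<rho> by (intro mult_left_mono mult_right_mono) auto
      ultimately show False using w \<rho> by linarith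
    qed
    show ?thesis using no[of t' t] no[of t t'] tb t by (metis linorder_neqE_linordered_idom)
  qed
  define F where "F \<theta> = (1 / \<rho>) *\<^sub>R (b + u \<theta> *\<^sub>R \<theta>)" for \<theta>
  have est: "norm (x - y) \<le> norm (F x - F y)" "norm (F x - F y) \<le> (1 + 4 * k) * norm (x - y)"
    if xy: "x \<in> S" "y \<in> S" for x y
  proof -
    define d where "d = norm (u x *\<^sub>R x - u y *\<^sub>R y)"
    define m where "m = norm (x - y)"
    have d0: "0 \<le> d" "0 \<le> m" by (auto simp: d_def m_def)
    have xx: "x \<bullet> x = 1" "y \<bullet> y = 1" using nS xy by (auto simp: dot_square_norm)
    have m2: "m\<^sup>2 = 2 - 2 * (x \<bullet> y)"
      unfolding m_def power2_norm_eq_inner by (simp add: inner_diff_left inner_diff_right xx inner_commute)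
    \<comment> \<open>Law of cosines, split into a radial and an angular part; the radial part will
      be absorbed on the left as \<open>k\<^sup>2 * d\<^sup>2\<close>.\<close>
    have d2: "d\<^sup>2 = (u x - u y)\<^sup>2 + u x * u y * m\<^sup>2"
      unfolding m2 unfolding d_def power2_norm_eq_inner
      by (simp add: inner_diff_left inner_diff_right xx inner_commute power2_eq_square algebra_simps)
    have FF: "norm (F x - F y) = d / \<rho>"
    proof -
      have "F x - F y = (1 / \<rho>) *\<^sub>R (u x *\<^sub>R x - u y *\<^sub>R y)" by (simp add: F_def algebra_simps)
      then show ?thesis using \<rho> by (simp add: d_def)
    qed
    have "\<rho> * \<rho> \<le> u x * u y"
      using ub(1)[OF xy(1)] ub(1)[OF xy(2)] u(1)[OF xy(1)] \<rho> by (intro mult_mono) auto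
    then have "(\<rho> * \<rho>) * m\<^sup>2 \<le> u x * u y * m\<^sup>2" by (intro mult_right_mono) auto
    then have "(\<rho> * m)\<^sup>2 \<le> d\<^sup>2" unfolding d2 power_mult_distrib power2_eq_square[of \<rho>]
      using zero_le_power2[of "u x - u y"] by linarith
    then have "\<rho> * m \<le> d" using d0(1) by (rule power2_le_imp_le)
    then show "norm (x - y) \<le> norm (F x - F y)" unfolding FF m_def[symmetric] using \<rho> by (simp add: field_simps)
    have dd: "norm (b + u x *\<^sub>R x - (b + u y *\<^sub>R y)) = d" by (simp add: d_def)
    have "norm (b + u y *\<^sub>R y - (b + u x *\<^sub>R x)) = d" by (simp add: d_def norm_minus_commute)
    then have p: "(u x)\<^sup>2 - (u y)\<^sup>2 \<le> 2 * \<epsilon> * d" "(u y)\<^sup>2 - (u x)\<^sup>2 \<le> 2 * \<epsilon> * d"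
      using pair[OF u(2)[OF xy(1)] u(2)[OF xy(2)]] pair[OF u(2)[OF xy(2)] u(2)[OF xy(1)]] dd u(1)[OF xy(1)] u(1)[OF xy(2)] nS xy
      by auto
    have sum: "2 * \<rho> \<le> u x + u y" using ub(1)[OF xy(1)] ub(1)[OF xy(2)] by linarith
    have "(u x + u y) * \<bar>u x - u y\<bar> = \<bar>(u x)\<^sup>2 - (u y)\<^sup>2\<bar>"
    proof -
      have "(u x)\<^sup>2 - (u y)\<^sup>2 = (u x + u y) * (u x - u y)" by (simp add: power2_eq_square algebra_simps)
      then show ?thesis using sum \<rho> by (simp add: abs_mult)
    qed
    then have "(u x + u y) * \<bar>u x - u y\<bar> \<le> 2 * \<epsilon> * d" using p by linarith
    moreover have "(2 * \<rho>) * \<bar>u x - u y\<bar> \<le> (u x + u y) * \<bar>u x - u y\<bar>" using sum by (intro mult_right_mono) auto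
    ultimately have "(2 * \<rho>) * \<bar>u x - u y\<bar> \<le> (2 * \<rho>) * (k * d)" unfolding \<epsilon>k by (simp add: mult_ac)
    then have "\<bar>u x - u y\<bar> \<le> k * d" using \<rho> by (simp add: mult_le_cancel_left_pos)
    then have "\<bar>u x - u y\<bar>\<^sup>2 \<le> (k * d)\<^sup>2" by (intro power_mono) auto
    then have "(u x - u y)\<^sup>2 \<le> k\<^sup>2 * d\<^sup>2" by (simp add: power_mult_distrib)
    moreover have "u x * u y \<le> (\<rho> * (1 + 2 * k)) * (\<rho> * (1 + 2 * k))"
      using ub(2)[OF xy(1)] ub(2)[OF xy(2)] u(1)[OF xy(1)] u(1)[OF xy(2)] by (intro mult_mono) auto
    then have "u x * u y * m\<^sup>2 \<le> (\<rho> * (1 + 2 * k)) * (\<rho> * (1 + 2 * k)) * m\<^sup>2" by (intro mult_right_mono) auto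
    ultimately have le: "(1 - k\<^sup>2) * d\<^sup>2 \<le> (1 + 2 * k)\<^sup>2 * (\<rho> * m)\<^sup>2"
      using d2 by (simp add: power2_eq_square algebra_simps)
    \<comment> \<open>Replaces the exact factor \<open>(1 + 2 * k) / sqrt (1 - k\<^sup>2)\<close> by
      one linear in \<open>k\<close>, at the price of a larger coefficient.\<close>
    have poly: "(1 + 2 * k)\<^sup>2 \<le> (1 - k\<^sup>2) * (1 + 4 * k)\<^sup>2"
    proof -
      have "(1 - k\<^sup>2) * (1 + 4 * k)\<^sup>2 - (1 + 2 * k)\<^sup>2 = k * (4 + 11 * k - 8 * (k * k) - 16 * (k * (k * k)))"
        by (simp add: power2_eq_square algebra_simps)
      moreover have "k * k \<le> k * (1 / 4)" using k0 by (intro mult_left_mono) auto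
      moreover have "k * (k * k) \<le> k * (1 / 4 * (1 / 4))" using k0 by (intro mult_left_mono mult_mono) auto
      ultimately have "0 \<le> (1 - k\<^sup>2) * (1 + 4 * k)\<^sup>2 - (1 + 2 * k)\<^sup>2" using k0 by simp
      then show ?thesis by simp
    qed
    have k1: "0 < 1 - k\<^sup>2"
    proof -
      have "k\<^sup>2 \<le> (1 / 4)\<^sup>2" using k0 by (intro power_mono) auto
      then show ?thesis by (simp add: power2_eq_square)
    qed
    have "(1 - k\<^sup>2) * d\<^sup>2 \<le> (1 - k\<^sup>2) * ((1 + 4 * k)\<^sup>2 * (\<rho> * m)\<^sup>2)"
      using le mult_right_mono[OF poly, of "(\<rho> * m)\<^sup>2"] by (simp add: mult_ac)
    then have "d\<^sup>2 \<le> ((1 + 4 * k) * (\<rho> * m))\<^sup>2" using k1 by (simp add: power_mult_distrib mult_le_cancel_left_pos)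
    then have "d \<le> (1 + 4 * k) * (\<rho> * m)" by (rule power2_le_imp_le) (use k0 \<rho> d0 in auto)
    then show "norm (F x - F y) \<le> (1 + 4 * k) * norm (x - y)"
      unfolding FF m_def[symmetric] using \<rho> by (simp add: field_simps)
  qed
  define Y where "Y = frontier ((\<lambda>x. (1 / \<rho>) *\<^sub>R x) ` \<Omega>)"
  have Y: "Y = (\<lambda>x. (1 / \<rho>) *\<^sub>R x) ` frontier \<Omega>" unfolding Y_def by (rule frontier_dilation) (use \<rho> in simp)
  have inj: "inj_on F S"
  proof (rule inj_onI)
    fix x y assume "x \<in> S" "y \<in> S" "F x = F y"
    then have "norm (x - y) \<le> 0" using est(1)[of x y] by simp
    then show "x = y" by simp
  qed
  have img: "F ` S = Y"
  proof (intro set_eqI iffI)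
    fix z assume "z \<in> F ` S"
    then show "z \<in> Y" unfolding Y F_def using u(2) by blast
  next
    fix z assume "z \<in> Y"
    then obtain y where y: "y \<in> frontier \<Omega>" "z = (1 / \<rho>) *\<^sub>R y" unfolding Y by blast
    define t where "t = norm (y - b)"
    have t: "0 < t" using fr[OF y(1)] \<rho> unfolding t_def by linarith
    define \<theta> where "\<theta> = (1 / t) *\<^sub>R (y - b)"
    have \<theta>: "norm \<theta> = 1" "\<theta> \<in> S" using t by (auto simp: \<theta>_def t_def S_def)
    have yt: "y = b + t *\<^sub>R \<theta>" using t by (simp add: \<theta>_def)
    have "u \<theta> = t" using uniq[OF u(1)[OF \<theta>(2)] t \<theta>(1) u(2)[OF \<theta>(2)]] y(1) yt by simp
    then have "z = F \<theta>" using y(2) yt by (simp add: F_def)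
    then show "z \<in> F ` S" using \<theta>(2) by blast
  qed
  have bij: "bij_betw F S Y" using inj img by (simp add: bij_betw_def)
  have "(1 + 4 * k)-lipschitz_on S F"
    using est(2) k0 by (intro lipschitz_onI) (auto simp: dist_norm)
  moreover have "1-lipschitz_on Y (inv_into S F)"
  proof (rule lipschitz_onI)
    fix z w assume zw: "z \<in> Y" "w \<in> Y"
    then have i: "inv_into S F z \<in> S" "inv_into S F w \<in> S" "F (inv_into S F z) = z" "F (inv_into S F w) = w"
      using img by (auto simp: inv_into_into f_inv_into_f)
    show "dist (inv_into S F z) (inv_into S F w) \<le> 1 * dist z w"
      using est(1)[OF i(1,2)] i(3,4) by (simp add: dist_norm)
  qed simp
  ultimately have "bilipschitz_map S Y F" unfolding bilipschitz_map_def using bij by blast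
  then show ?thesis using est unfolding S_def Y_def k_def by (intro exI[of _ F] conjI ballI)
qed

end

section \<open>Ball distance and assembly of the constants\<close>

lemma ball_distance_le:
  fixes \<Omega> :: "(real^'n) set"
  assumes \<Omega>: "bounded \<Omega>" and p: "p \<in> \<Omega>" "0 < r" "ball p r \<subseteq> \<Omega>" "\<Omega> \<subseteq> ball p R"
  shows "ball_distance \<Omega> \<le> (R - r) / diameter \<Omega>"
proof -
  have "0 \<le> x" if x: "x \<in> {(R - r) / diameter \<Omega> | p r R. p \<in> \<Omega> \<and> 0 < r \<and> ball p r \<subseteq> \<Omega> \<and> \<Omega> \<subseteq> ball p R}" for x
  proof -
    obtain q r R where q: "x = (R - r) / diameter \<Omega>" "0 < r" "ball q r \<subseteq> \<Omega>" "\<Omega> \<subseteq> ball q R"  using x by blast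
    then have "ball q r \<subseteq> ball q R" by blast
    then have "r \<le> R" using q(2) by (simp add: ball_subset_ball_iff)
    then show ?thesis using q(1) diameter_ge_0[OF \<Omega>] by simp
  qed
  then have "bdd_below {(R - r) / diameter \<Omega> | p r R. p \<in> \<Omega> \<and> 0 < r \<and> ball p r \<subseteq> \<Omega> \<and> \<Omega> \<subseteq> ball p R}"
    by (intro bdd_belowI) auto
  then show ?thesis unfolding ball_distance_def by (intro cInf_lower) (use p in blast)
qed

text \<open>Fallback for a barycenter outside \<Omega>, which cannot serve as the common centre of
  the two balls: the deficit is then so large that this trivial bound suffices.\<close>

lemma ball_distance_le_1:
  fixes \<Omega> :: "(real^'n) set"
  assumes \<Omega>: "open \<Omega>" "bounded \<Omega>" "\<Omega> \<noteq> {}"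
  shows "ball_distance \<Omega> \<le> 1"
proof -
  obtain p r where p: "p \<in> \<Omega>" "0 < r" "ball p r \<subseteq> \<Omega>" using \<Omega> by (metis all_not_in_conv openE)
  have D: "0 \<le> diameter \<Omega>" by (rule diameter_ge_0[OF \<Omega>(2)])
  \<comment> \<open>The outer ball is open, so the distance has to be strictly below the diameter;
    as \<Omega> is open, \<open>x\<close> can be pushed away from \<open>p\<close> within
    \<Omega>.\<close>
  have "x \<in> ball p (diameter \<Omega>)" if x: "x \<in> \<Omega>" for x
  proof -
    define u :: "real^'n" where "u = axis undefined 1"
    define w where "w = (if x = p then u else (1 / norm (x - p)) *\<^sub>R (x - p))"
    have w: "norm w = 1" by (simp add: w_def u_def norm_axis_1)
    have vw: "x - p = norm (x - p) *\<^sub>R w" by (simp add: w_def)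
    obtain d where d: "0 < d" "ball x d \<subseteq> \<Omega>" using \<Omega>(1) x openE by blast
    have "x + (d / 2) *\<^sub>R w \<in> ball x d" using d w by (simp add: dist_norm)
    then have "dist (x + (d / 2) *\<^sub>R w) p \<le> diameter \<Omega>" using d p by (intro diameter_bounded_bound \<Omega>) auto
    moreover have "x + (d / 2) *\<^sub>R w - p = (norm (x - p) + d / 2) *\<^sub>R w"
      using vw by (simp add: scaleR_add_left algebra_simps)
    ultimately show ?thesis using w d by (simp add: dist_norm norm_minus_commute)
  qed
  then have "ball_distance \<Omega> \<le> (diameter \<Omega> - r) / diameter \<Omega>" using p \<Omega> by (intro ball_distance_le) auto
  also have "\<dots> \<le> 1" using D p(2) by (simp add: divide_le_eq)
  finally show ?thesis .
qed

lemma diameter_pos_if_open: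
  fixes \<Omega> :: "(real^'n) set"
  assumes \<Omega>: "open \<Omega>" "bounded \<Omega>" "\<Omega> \<noteq> {}"
  shows "0 < diameter \<Omega>"
proof -
  obtain x d where d: "0 < d" "ball x d \<subseteq> \<Omega>" using \<Omega> by (metis all_not_in_conv openE)
  have "x \<in> \<Omega>" "x + (d / 2) *\<^sub>R axis undefined 1 \<in> \<Omega>"
    using d by (auto intro!: subsetD[OF d(2)] simp: dist_norm norm_axis_1)
  then have "dist (x + (d / 2) *\<^sub>R axis undefined 1) x \<le> diameter \<Omega>" by (intro diameter_bounded_bound \<Omega>(2))
  then show ?thesis using d by (simp add: dist_norm norm_axis_1)
qed

text \<open>Passes from the supremum in \<open>ennreal\<close> to a real Lipschitz bound, possible
  once the deficit is finite. Distances to boundary points are at most \<open>D\<close> because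
  \<Omega> and its closure have the same diameter.\<close>

lemma almost_spherical_from_curvature:
  fixes \<Omega> :: "(real^'n) set"
  assumes \<Omega>: "open \<Omega>" "bounded \<Omega>" "\<Omega> \<noteq> {}" "C2_Hoelder_boundary \<alpha> \<Omega>" "\<alpha> \<le> 1" and s: "0 < s" "2 * s < \<alpha>"
    and \<delta>: "curvature_deficit s \<Omega> = ennreal \<delta>" "0 \<le> \<delta>"
  defines "\<beta> \<equiv> real CARD('n) + 2 * s" and "D \<equiv> diameter \<Omega>"
  shows "0 < D"
    and "almost_spherical \<Omega> (barycenter \<Omega>) (sphere_area (CARD('n) - 2) * \<delta> * D powr (\<beta> + 2) / (2 * \<beta> * measure lborel \<Omega>))"
    and "\<And>x. x \<in> frontier \<Omega> \<Longrightarrow> norm (x - barycenter \<Omega>) \<le> D"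
proof -
  have H: "\<bar>nonlocal_mean_curvature s \<Omega> x - nonlocal_mean_curvature s \<Omega> y\<bar> \<le> \<delta> * norm (x - y)"
    if xy: "x \<in> frontier \<Omega>" "y \<in> frontier \<Omega>" for x y
  proof (cases "x = y")
    case False
    have "ennreal (\<bar>nonlocal_mean_curvature s \<Omega> x - nonlocal_mean_curvature s \<Omega> y\<bar> / norm (x - y)) \<le> curvature_deficit s \<Omega>"
      unfolding curvature_deficit_def by (rule SUP_upper2[where i="(x, y)"]) (use xy False in auto)
    then have "\<bar>nonlocal_mean_curvature s \<Omega> x - nonlocal_mean_curvature s \<Omega> y\<bar> / norm (x - y) \<le> \<delta>"
      using \<delta> by (simp add: ennreal_le_iff)
    then show ?thesis using False by (simp add: divide_le_eq)
  qed simp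
  have cl: "norm (x - y) \<le> D" if "x \<in> closure \<Omega>" "y \<in> closure \<Omega>" for x y
    using diameter_bounded_bound[OF bounded_closure[OF \<Omega>(2)] that] diameter_closure[OF \<Omega>(2)]
    by (simp add: D_def dist_norm)
  have sub: "\<Omega> \<subseteq> closure \<Omega>" "frontier \<Omega> \<subseteq> closure \<Omega>" by (auto simp: closure_subset frontier_def)
  show D0: "0 < D" unfolding D_def by (rule diameter_pos_if_open[OF \<Omega>(1-3)])
  show fb: "norm (x - barycenter \<Omega>) \<le> D" if "x \<in> frontier \<Omega>" for x
    by (rule norm_diff_barycenter_le[OF \<Omega>(1-3)]) (use cl sub that in blast)
  have V: "0 < measure lborel \<Omega>" by (rule measure_bounded_open_pos[OF \<Omega>(1-3)])
  have \<beta>0: "0 < \<beta>" using s by (auto simp: \<beta>_def)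
  show "almost_spherical \<Omega> (barycenter \<Omega>) (sphere_area (CARD('n) - 2) * \<delta> * D powr (\<beta> + 2) / (2 * \<beta> * measure lborel \<Omega>))"
  proof
    show "0 \<le> sphere_area (CARD('n) - 2) * \<delta> * D powr (\<beta> + 2) / (2 * \<beta> * measure lborel \<Omega>)"
      using sphere_area_pos[of "CARD('n) - 2"] \<delta> V \<beta>0 by simp
    show "(norm (x - barycenter \<Omega>))\<^sup>2 - (norm (y - barycenter \<Omega>))\<^sup>2
       \<le> 2 * (sphere_area (CARD('n) - 2) * \<delta> * D powr (\<beta> + 2) / (2 * \<beta> * measure lborel \<Omega>)) * norm (x - y)"
      if "x \<in> frontier \<Omega>" "y \<in> frontier \<Omega>" for x y
      by (rule boundary_almost_spherical[OF \<Omega> s H \<delta>(2) _ D0 _ that]) (use cl sub in \<open>auto simp: \<beta>_def\<close>)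
  qed (use \<Omega> in auto)
qed

text \<open>The exponents in the deficit fit: \<open>\<epsilon> * D ^ (n - 1) = \<omega> * \<eta> *
  V / (2 * \<beta>)\<close>. Replacing \<beta> by \<open>n \<le> \<beta>\<close> removes
  \<open>s\<close> from the constant, and \<open>V \<le> v * D ^ n\<close> leads to
  \<open>2 * \<epsilon> \<le> C * \<eta> * D\<close>. The threshold \<open>1 / 8\<close> keeps the
  barycenter inside \<Omega> and the inner radius comparable to \<open>D\<close>.\<close>

lemma stability_estimates:
  fixes \<Omega> :: "(real^'n) set"
  defines "n \<equiv> CARD('n)"
  defines "C \<equiv> unit_ball_vol n * sphere_area (n - 2)"
  assumes \<Omega>: "open \<Omega>" "bounded \<Omega>" "\<Omega> \<noteq> {}" "C2_Hoelder_boundary \<alpha> \<Omega>" "\<alpha> \<le> 1" and s: "0 < s" "2 * s < \<alpha>"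
    and \<eta>: "scaled_deficit s \<Omega> = ennreal \<eta>" "0 \<le> \<eta>"
  shows "ball_distance \<Omega> \<le> C * \<eta>"
    and "C * \<eta> \<le> 1 / 8 \<Longrightarrow> \<exists>\<kappa>>0. \<exists>F :: real^'n \<Rightarrow> real^'n.
          bilipschitz_map (sphere 0 1) (frontier ((\<lambda>x. \<kappa> *\<^sub>R x) ` \<Omega>)) F \<and>
          (\<forall>x\<in>sphere 0 1. \<forall>y\<in>sphere 0 1. norm (x - y) \<le> norm (F x - F y) \<and>
            norm (F x - F y) \<le> (1 + 8 * (C * \<eta>)) * norm (x - y))"
proof -
  define \<beta> where "\<beta> = real n + 2 * s"
  define D where "D = diameter \<Omega>"
  define V where "V = measure lborel \<Omega>"
  have n: "0 < n" by (simp add: n_def)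
  have V: "0 < V" unfolding V_def by (rule measure_bounded_open_pos[OF \<Omega>(1-3)])
  have Vl: "measure lebesgue \<Omega> = V" using \<Omega>(1) by (simp add: V_def)
  define \<omega> where "\<omega> = sphere_area (n - 2)"
  define v where "v = unit_ball_vol n"
  have \<omega>: "0 < \<omega>" unfolding \<omega>_def by (rule sphere_area_pos)
  have v: "0 < v" by (simp add: v_def)
  have Cv: "C = v * \<omega>" by (simp add: C_def v_def \<omega>_def)
  have C: "0 < C" using v \<omega> by (simp add: Cv)
  have \<beta>0: "0 < \<beta>" "real n \<le> \<beta>" using s n by (auto simp: \<beta>_def)
  have D00: "0 \<le> D" unfolding D_def by (rule diameter_ge_0[OF \<Omega>(2)])
  define q where "q = D powr (2 * real n + 2 * s + 1) / V\<^sup>2"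
  have scaled: "scaled_deficit s \<Omega> = ennreal q * curvature_deficit s \<Omega>"
    unfolding scaled_deficit_def Vl q_def D_def n_def by simp
  have D0: "0 < D" unfolding D_def by (rule diameter_pos_if_open[OF \<Omega>(1-3)])
  have q: "0 < q" using D0 V by (simp add: q_def)
  have "curvature_deficit s \<Omega> \<noteq> \<infinity>"
  proof
    assume "curvature_deficit s \<Omega> = \<infinity>"
    then have "scaled_deficit s \<Omega> = \<infinity>" using q unfolding scaled by (simp add: ennreal_mult_top)
    then show False using \<eta> by simp
  qed
  then obtain \<delta> where \<delta>: "curvature_deficit s \<Omega> = ennreal \<delta>" "0 \<le> \<delta>"
    by (cases "curvature_deficit s \<Omega>") auto
  have \<eta>q: "\<eta> = q * \<delta>"
    using \<eta> \<delta> q unfolding scaled by (simp add: ennreal_mult[symmetric] ennreal_inj)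
  define \<epsilon> where "\<epsilon> = \<omega> * \<delta> * D powr (\<beta> + 2) / (2 * \<beta> * V)"
  define b where "b = barycenter \<Omega>"
  interpret AS: almost_spherical \<Omega> b \<epsilon>
    using almost_spherical_from_curvature(2)[OF \<Omega> s \<delta>]
    by (simp add: \<epsilon>_def b_def \<beta>_def n_def D_def V_def \<omega>_def)
  have frD: "norm (x - b) \<le> D" if "x \<in> frontier \<Omega>" for x
    using almost_spherical_from_curvature(3)[OF \<Omega> s \<delta> that] by (simp add: b_def D_def)
  have \<epsilon>V: "\<epsilon> * D ^ (n - 1) \<le> \<omega> * \<eta> * V / (2 * real n)"
  proof -
    have p: "D powr (\<beta> + 2) * D ^ (n - 1) = D powr (2 * real n + 2 * s + 1)"
    proof -
      have "D ^ (n - 1) = D powr (real (n - 1))" using D0 by (simp add: powr_realpow)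
      then have "D powr (\<beta> + 2) * D ^ (n - 1) = D powr (\<beta> + 2 + real (n - 1))" by (simp only: powr_add)
      also have "\<beta> + 2 + real (n - 1) = 2 * real n + 2 * s + 1" using n by (simp add: \<beta>_def of_nat_diff)
      finally show ?thesis .
    qed
    have "\<epsilon> * D ^ (n - 1) = \<omega> * \<delta> * (D powr (\<beta> + 2) * D ^ (n - 1)) / (2 * \<beta> * V)" by (simp add: \<epsilon>_def)
    also have "\<dots> = \<omega> * \<eta> * V / (2 * \<beta>)"
      unfolding p \<eta>q q_def using V \<beta>0 by (simp add: field_simps power2_eq_square)
    also have "\<dots> \<le> \<omega> * \<eta> * V / (2 * real n)"
      using \<beta>0 n \<omega> \<eta> V by (intro divide_left_mono) auto
    finally show ?thesis .
  qed
  have VD: "V \<le> v * D ^ n"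
  proof -
    obtain z where z: "z \<in> \<Omega>" using \<Omega> by blast
    have sub: "\<Omega> \<subseteq> cball z D" unfolding D_def using z by (auto intro: diameter_bounded_bound[OF \<Omega>(2)])
    have "V \<le> measure lborel (cball z D)"
      unfolding V_def using sub \<Omega>(1) emeasure_bounded_finite[OF bounded_cball[of z D]]
      by (intro measure_mono_fmeasurable fmeasurableI) auto
    also have "\<dots> = v * D ^ n" using D0 by (simp add: content_cball v_def n_def)
    finally show ?thesis .
  qed
  have \<epsilon>D: "2 * \<epsilon> \<le> C * \<eta> * D"
  proof -
    have Dn: "D ^ n = D ^ (n - 1) * D" using n by (metis Suc_pred' power_Suc2)
    have "\<epsilon> * D ^ (n - 1) \<le> \<omega> * \<eta> * V / 2"
    proof -
      have "\<omega> * \<eta> * V / (2 * real n) \<le> \<omega> * \<eta> * V / (2 * 1)" using n \<omega> \<eta> V by (intro divide_left_mono) auto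
      then show ?thesis using \<epsilon>V by linarith
    qed
    also have "\<dots> \<le> \<omega> * \<eta> * (v * D ^ n) / 2" using VD \<omega> \<eta> by (intro divide_right_mono mult_left_mono) auto
    also have "\<dots> = (C * \<eta> * D / 2) * D ^ (n - 1)" unfolding Dn Cv by simp
    finally have "\<epsilon> \<le> C * \<eta> * D / 2" using D0 by (simp add: mult_le_cancel_right)
    then show ?thesis by simp
  qed
  obtain \<rho> R where \<rho>: "0 \<le> \<rho>" "R \<le> \<rho> + 2 * \<epsilon>" "\<And>x. x \<in> frontier \<Omega> \<Longrightarrow> \<rho> \<le> norm (x - b) \<and> norm (x - b) \<le> R"
     "\<Omega> \<subseteq> ball b R" "\<exists>x\<in>frontier \<Omega>. norm (x - b) = R" "\<exists>x\<in>frontier \<Omega>. norm (x - b) = \<rho>"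
    using AS.annulus_exists by blast
  have R: "R \<le> D" "\<rho> \<le> R" using \<rho>(3,5) frD by (blast, force)
  have DR: "D \<le> 2 * R" unfolding D_def by (rule AS.diameter_le_outer_radius[OF \<rho>(4)])
  \<comment> \<open>The factor \<open>real n\<close> kept in the denominator of
    \<open>\<epsilon>V\<close> cancels the one in the volume of the shell, so the same
    \<open>C\<close> serves here.\<close>
  have out: "1 \<le> C * \<eta>" if "b \<notin> \<Omega>"
  proof -
    have "V \<le> v * (real n * D ^ (n - 1) * (2 * \<epsilon>))"
      unfolding V_def v_def n_def by (rule AS.measure_le_if_center_outside[where \<rho>=\<rho> and R=R]) (use \<rho> R that in auto)
    also have "\<dots> = v * real n * 2 * (\<epsilon> * D ^ (n - 1))" by simp
    also have "\<dots> \<le> v * real n * 2 * (\<omega> * \<eta> * V / (2 * real n))" using \<epsilon>V v by (intro mult_left_mono) auto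
    also have "\<dots> = C * \<eta> * V" using n by (simp add: Cv)
    finally have "1 * V \<le> C * \<eta> * V" by simp
    then show ?thesis using V by (simp only: mult_le_cancel_right_pos)
  qed
  have ins: "0 < \<rho>" "ball b \<rho> \<subseteq> \<Omega>" if b: "b \<in> \<Omega>"
  proof -
    obtain y where "y \<in> frontier \<Omega>" "norm (y - b) = \<rho>" using \<rho>(6) by blast
    then have "\<rho> \<noteq> 0" using AS.not_mem_frontier[OF b] by auto
    then show "0 < \<rho>" using \<rho>(1) by simp
    then have "ball b \<rho> \<inter> \<Omega> \<noteq> {}" using b centre_in_ball by blast
    then show "ball b \<rho> \<subseteq> \<Omega>" using \<rho>(3) by (intro AS.ball_meets_imp_subset) auto
  qed
  show "ball_distance \<Omega> \<le> C * \<eta>"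
  proof (cases "b \<in> \<Omega>")
    case True
    have "ball_distance \<Omega> \<le> (R - \<rho>) / D"
      unfolding D_def by (rule ball_distance_le[OF \<Omega>(2) True ins[OF True] \<rho>(4)])
    also have "\<dots> \<le> (C * \<eta> * D) / D" using \<rho>(2) \<epsilon>D D0 by (intro divide_right_mono) auto
    finally show ?thesis using D0 by simp
  next
    case False
    then show ?thesis using out ball_distance_le_1[OF \<Omega>(1-3)] by linarith
  qed
  assume small: "C * \<eta> \<le> 1 / 8"
  then have b: "b \<in> \<Omega>" using out by force
  have "C * \<eta> * D \<le> 1 / 8 * D" using small D0 by (intro mult_right_mono) auto
  \<comment> \<open>From \<open>D \<le> 2 * R \<le> 2 * \<rho> + 4 * \<epsilon>\<close> and
    \<open>4 * \<epsilon> \<le> D / 4\<close>.\<close>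
  then have \<rho>D: "D / 4 \<le> \<rho>" using \<rho>(2) \<epsilon>D DR D0 by linarith
  have "\<epsilon> / \<rho> \<le> (C * \<eta> * D / 2) / (D / 4)" using \<epsilon>D \<rho>D D0 AS.\<epsilon> by (intro frac_le) auto
  also have "\<dots> = 2 * (C * \<eta>)" using D0 by simp
  finally have k: "\<epsilon> / \<rho> \<le> 2 * (C * \<eta>)" .
  have fr: "\<rho> \<le> norm (x - b) \<and> norm (x - b) \<le> \<rho> + 2 * \<epsilon>" if "x \<in> frontier \<Omega>" for x
    using \<rho>(2) \<rho>(3)[OF that] by linarith
  have k4: "\<epsilon> / \<rho> \<le> 1 / 4" using k small by linarith
  obtain F :: "real^'n \<Rightarrow> real^'n" where F: "bilipschitz_map (sphere 0 1) (frontier ((\<lambda>x. (1 / \<rho>) *\<^sub>R x) ` \<Omega>)) F"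
     "\<And>x y. x \<in> sphere 0 1 \<Longrightarrow> y \<in> sphere 0 1 \<Longrightarrow> norm (x - y) \<le> norm (F x - F y) \<and>
        norm (F x - F y) \<le> (1 + 4 * (\<epsilon> / \<rho>)) * norm (x - y)"
    using AS.radial_parametrization[OF b ins(1)[OF b] fr k4] by blast
  have "norm (F x - F y) \<le> (1 + 8 * (C * \<eta>)) * norm (x - y)" if "x \<in> sphere 0 1" "y \<in> sphere 0 1" for x y
  proof -
    have "(1 + 4 * (\<epsilon> / \<rho>)) * norm (x - y) \<le> (1 + 8 * (C * \<eta>)) * norm (x - y)"
      using k by (intro mult_right_mono) auto
    then show ?thesis using F(2)[OF that] by linarith
  qed
  then show "\<exists>\<kappa>>0. \<exists>F :: real^'n \<Rightarrow> real^'n.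
          bilipschitz_map (sphere 0 1) (frontier ((\<lambda>x. \<kappa> *\<^sub>R x) ` \<Omega>)) F \<and>
          (\<forall>x\<in>sphere 0 1. \<forall>y\<in>sphere 0 1. norm (x - y) \<le> norm (F x - F y) \<and>
            norm (F x - F y) \<le> (1 + 8 * (C * \<eta>)) * norm (x - y))"
    using F ins(1)[OF b] by (intro exI[of _ "1 / \<rho>"] conjI exI[of _ F]) auto
qed

theorem theorem1p2:
  assumes "CARD('n::finite) \<ge> 2"
  shows "\<exists>C_hat>0. \<exists>\<eta>>0. \<exists>C_bar>0.
    \<forall>s::real. \<forall>\<Omega> :: (real^'n) set.
      0 < s \<longrightarrow> s < 1/2 \<longrightarrow>
      \<Omega> \<noteq> {} \<longrightarrow> bounded \<Omega> \<longrightarrow> open \<Omega> \<longrightarrow>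
      (\<exists>\<alpha>. 2 * s < \<alpha> \<and> \<alpha> \<le> 1 \<and> C2_Hoelder_boundary \<alpha> \<Omega>) \<longrightarrow>
      ennreal (ball_distance \<Omega>) \<le> ennreal C_hat * scaled_deficit s \<Omega> \<and>
      (scaled_deficit s \<Omega> \<le> ennreal \<eta> \<longrightarrow>
        (\<exists>\<kappa>>0. \<exists>F :: real^'n \<Rightarrow> real^'n.
          bilipschitz_map (sphere 0 1) (frontier ((\<lambda>x. \<kappa> *\<^sub>R x) ` \<Omega>)) F \<and>
          (\<forall>x\<in>sphere 0 1. \<forall>y\<in>sphere 0 1.
            (1 - C_bar * sqrt (enn2real (scaled_deficit s \<Omega>))) * norm (x - y) \<le> norm (F x - F y) \<and>
            norm (F x - F y) \<le> (1 + C_bar * sqrt (enn2real (scaled_deficit s \<Omega>))) * norm (x - y))))"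
proof -
  define C where "C = unit_ball_vol CARD('n) * sphere_area (CARD('n) - 2)"
  have C: "0 < C" using sphere_area_pos by (simp add: C_def)
  \<comment> \<open>The second entry gives \<open>C * \<eta> \<le> 1 / 8\<close>; the first gives
    \<open>\<eta> \<le> sqrt \<eta>\<close>, by which the linear estimate of
    \<open>stability_estimates\<close> implies the one with the square root.\<close>
  define \<eta>0 where "\<eta>0 = min 1 (1 / (8 * C))"
  have \<eta>0: "0 < \<eta>0" using C by (simp add: \<eta>0_def)
  have main: "ennreal (ball_distance \<Omega>) \<le> ennreal C * scaled_deficit s \<Omega> \<and>
      (scaled_deficit s \<Omega> \<le> ennreal \<eta>0 \<longrightarrow>
        (\<exists>\<kappa>>0. \<exists>F :: real^'n \<Rightarrow> real^'n.
          bilipschitz_map (sphere 0 1) (frontier ((\<lambda>x. \<kappa> *\<^sub>R x) ` \<Omega>)) F \<and>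
          (\<forall>x\<in>sphere 0 1. \<forall>y\<in>sphere 0 1.
            (1 - 8 * C * sqrt (enn2real (scaled_deficit s \<Omega>))) * norm (x - y) \<le> norm (F x - F y) \<and>
            norm (F x - F y) \<le> (1 + 8 * C * sqrt (enn2real (scaled_deficit s \<Omega>))) * norm (x - y))))"
    if s: "0 < s" and \<Omega>: "\<Omega> \<noteq> {}" "bounded \<Omega>" "open \<Omega>" and \<alpha>: "2 * s < \<alpha>" "\<alpha> \<le> 1" "C2_Hoelder_boundary \<alpha> \<Omega>"
    for s \<alpha> and \<Omega> :: "(real^'n) set"
  \<comment> \<open>For an infinite deficit the first claim is trivial and the premise of the second
    fails. The case must be split off because \<open>enn2real\<close> sends infinity to 0.\<close>
  proof (cases "scaled_deficit s \<Omega> = \<infinity>")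
    case True
    then show ?thesis using C by (simp add: ennreal_mult_top top_unique)
  next
    case False
    define \<eta> where "\<eta> = enn2real (scaled_deficit s \<Omega>)"
    have \<eta>: "scaled_deficit s \<Omega> = ennreal \<eta>" "0 \<le> \<eta>" using False by (auto simp: \<eta>_def less_top)
    note est = stability_estimates[OF \<Omega>(3,2,1) \<alpha>(3,2) s \<alpha>(1) \<eta>, folded C_def]
    have "ennreal (ball_distance \<Omega>) \<le> ennreal C * scaled_deficit s \<Omega>"
      unfolding \<eta>(1) using est(1) C by (simp add: ennreal_mult[symmetric] \<eta>(2) ennreal_leI)
    moreover have "\<exists>\<kappa>>0. \<exists>F :: real^'n \<Rightarrow> real^'n.
          bilipschitz_map (sphere 0 1) (frontier ((\<lambda>x. \<kappa> *\<^sub>R x) ` \<Omega>)) F \<and>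
          (\<forall>x\<in>sphere 0 1. \<forall>y\<in>sphere 0 1.
            (1 - 8 * C * sqrt \<eta>) * norm (x - y) \<le> norm (F x - F y) \<and>
            norm (F x - F y) \<le> (1 + 8 * C * sqrt \<eta>) * norm (x - y))"
      if "scaled_deficit s \<Omega> \<le> ennreal \<eta>0"
    proof -
      have le: "\<eta> \<le> \<eta>0" using that \<eta>0 unfolding \<eta>(1) by (simp add: ennreal_le_iff)
      have "C * \<eta> \<le> C * (1 / (8 * C))" using le C by (intro mult_left_mono) (auto simp: \<eta>0_def)
      then have "C * \<eta> \<le> 1 / 8" using C by simp
      from est(2)[OF this] obtain \<kappa> and F :: "real^'n \<Rightarrow> real^'n" where F: "0 < \<kappa>"
        "bilipschitz_map (sphere 0 1) (frontier ((\<lambda>x. \<kappa> *\<^sub>R x) ` \<Omega>)) F"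
        "\<And>x y. x \<in> sphere 0 1 \<Longrightarrow> y \<in> sphere 0 1 \<Longrightarrow> norm (x - y) \<le> norm (F x - F y) \<and>
            norm (F x - F y) \<le> (1 + 8 * (C * \<eta>)) * norm (x - y)" by blast
      have "\<eta> * \<eta> \<le> \<eta> * 1" using le \<eta>(2) by (intro mult_left_mono) (auto simp: \<eta>0_def)
      then have "\<eta> \<le> sqrt \<eta>" by (intro real_le_rsqrt) (simp add: power2_eq_square)
      then have C\<eta>: "8 * (C * \<eta>) \<le> 8 * C * sqrt \<eta>" using C by simp
      have "(1 - 8 * C * sqrt \<eta>) * norm (x - y) \<le> norm (F x - F y) \<and>
            norm (F x - F y) \<le> (1 + 8 * C * sqrt \<eta>) * norm (x - y)"
        if xy: "x \<in> sphere 0 1" "y \<in> sphere 0 1" for x y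
      proof -
        have "(1 - 8 * C * sqrt \<eta>) * norm (x - y) \<le> 1 * norm (x - y)"
          using C \<eta>(2) by (intro mult_right_mono) auto
        moreover have "(1 + 8 * (C * \<eta>)) * norm (x - y) \<le> (1 + 8 * C * sqrt \<eta>) * norm (x - y)"
          using C\<eta> by (intro mult_right_mono) auto
        ultimately show ?thesis using F(3)[OF xy] by linarith
      qed
      then show ?thesis using F(1,2) by blast
    qed
    ultimately show ?thesis unfolding \<eta>_def by blast
  qed
  show ?thesis
  proof (rule exI[of _ C], rule conjI[OF C], rule exI[of _ \<eta>0], rule conjI[OF \<eta>0], rule exI[of _ "8 * C"],
      rule conjI, goal_cases)
    case 1
    show ?case using C by simp
  next
    case 2
    show ?case
    proof (intro allI impI, elim exE conjE, goal_cases)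
      case (1 s \<Omega> \<alpha>)
      then show ?case by (intro main)
    qed
  qed
qed

end
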